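(* Let $\Omega\subset\mathbb{R}^2$ be an open, bounded, simply connected set, let $f\in L^{7/6}(\Omega)$, and fix a Hölder exponent $\alpha<\frac17$. Then the set of $\mathcal{C}^{1,\alpha}(\bar\Omega)$ solutions $v$ to the equation $\mathcal{D}et\,\nabla^2 v=f$ in $\Omega$ is dense in the space $\mathcal{C}^0(\bar\Omega)$. More precisely, for every $v_0\in\mathcal{C}^0(\bar\Omega)$ there exists a sequence $v_n\in\mathcal{C}^{1,\alpha}(\bar\Omega)$ converging uniformly on $\bar\Omega$ to $v_0$ and satisfying, for every $n$, $$\mathcal{D}et\,\nabla^2 v_n=f\quad\text{in }\Omega .$$ Moreover, when $f\in L^p(\Omega)$ with $p\in(1,\frac76)$, the same result is true for any Hölder exponent $\alpha<1-\frac1p$.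
   Context: For $v\in W^{1,2}_{loc}(\Omega)$, the very weak Hessian determinant is the distribution $\mathcal{D}et\,\nabla^2 v=-\frac12\,\mathrm{curl}\,\mathrm{curl}(\nabla v\otimes\nabla v)$, where for a symmetric $2\times2$ matrix field $A$ one sets $\mathrm{curl}\,\mathrm{curl}\,A=\partial_{22}A_{11}+\partial_{11}A_{22}-2\partial_{12}A_{12}$ in the sense of distributions (for smooth $v$ this gives $\mathcal{D}et\,\nabla^2 v=\det\nabla^2 v$). Equations involving $\mathcal{D}et\,\nabla^2$ are understood in the sense of distributions in $\Omega$. The space $\mathcal{C}^{k,\alpha}(\bar\Omega)$ consists of restrictions to $\Omega$ of functions in $\mathcal{C}^{k,\alpha}(\mathbb{R}^2)$, and Hölder exponents $\alpha$ are positive. *)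

theory Defs
  imports "HOL-Analysis.Analysis"
begin

section \<open>Classical derivatives and Hoelder spaces\<close>

text \<open>The derivatives below are meaningful only where \<^const>\<open>differentiable\<close> holds;
  every use is guarded by \<open>C_k\<close>.\<close>

definition partial :: "2 \<Rightarrow> (real^2 \<Rightarrow> real) \<Rightarrow> real^2 \<Rightarrow> real" where
  "partial i u = (\<lambda>x. frechet_derivative u (at x) (axis i 1))"

primrec iter_partial :: "2 list \<Rightarrow> (real^2 \<Rightarrow> real) \<Rightarrow> real^2 \<Rightarrow> real" where
  "iter_partial [] u = u"
| "iter_partial (i # is) u = partial i (iter_partial is u)"

definition C_k :: "nat \<Rightarrow> (real^2 \<Rightarrow> real) set" where
  "C_k k = {u. (\<forall>is. length is < k \<longrightarrow> (\<forall>x. iter_partial is u differentiable (at x))) \<and>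
               (\<forall>is. length is \<le> k \<longrightarrow> continuous_on UNIV (iter_partial is u))}"

definition test_functions :: "(real^2) set \<Rightarrow> (real^2 \<Rightarrow> real) set" where
  "test_functions \<Omega> =
     {\<phi>. (\<forall>k. \<phi> \<in> C_k k) \<and> compact (closure {x. \<phi> x \<noteq> 0}) \<and> closure {x. \<phi> x \<noteq> 0} \<subseteq> \<Omega>}"

definition holder_space :: "nat \<Rightarrow> real \<Rightarrow> (real^2 \<Rightarrow> real) set" where
  "holder_space k \<alpha> =
     {u \<in> C_k k.
        (\<forall>is. length is \<le> k \<longrightarrow> bounded (range (iter_partial is u))) \<and>
        (\<forall>is. length is = k \<longrightarrow>
           (\<exists>C. \<forall>x y. \<bar>iter_partial is u x - iter_partial is u y\<bar> \<le> C * dist x y powr \<alpha>))}"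

text \<open>A function on \<open>closure \<Omega>\<close> is represented by a total function whose values off the
  closure are irrelevant.\<close>

definition holder_space_closure :: "nat \<Rightarrow> real \<Rightarrow> (real^2) set \<Rightarrow> (real^2 \<Rightarrow> real) set" where
  "holder_space_closure k \<alpha> \<Omega> = {v. \<exists>u \<in> holder_space k \<alpha>. \<forall>x \<in> closure \<Omega>. v x = u x}"

section \<open>Lebesgue and Sobolev spaces\<close>

definition Lp :: "real \<Rightarrow> (real^2) set \<Rightarrow> (real^2 \<Rightarrow> real) set" where
  "Lp p S = {f \<in> borel_measurable (lebesgue_on S). integrable (lebesgue_on S) (\<lambda>x. \<bar>f x\<bar> powr p)}"

definition Lp_loc :: "real \<Rightarrow> (real^2) set \<Rightarrow> (real^2 \<Rightarrow> real) set" where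
  "Lp_loc p \<Omega> = {f. \<forall>K. compact K \<and> K \<subseteq> \<Omega> \<longrightarrow> f \<in> Lp p K}"

text \<open>Distributions on \<open>\<Omega>\<close> are represented as functionals that are only ever evaluated on
  \<open>test_functions \<Omega>\<close>; all those occurring here are built from locally integrable functions.\<close>

type_synonym distribution = "(real^2 \<Rightarrow> real) \<Rightarrow> real"

definition regular :: "(real^2) set \<Rightarrow> (real^2 \<Rightarrow> real) \<Rightarrow> distribution" where
  "regular \<Omega> f = (\<lambda>\<phi>. LINT x|lebesgue_on \<Omega>. f x * \<phi> x)"

definition dpartial :: "2 \<Rightarrow> distribution \<Rightarrow> distribution" where
  "dpartial i T = (\<lambda>\<phi>. - T (partial i \<phi>))"

definition weak_gradient :: "(real^2) set \<Rightarrow> (real^2 \<Rightarrow> real) \<Rightarrow> (real^2 \<Rightarrow> real^2) \<Rightarrow> bool" where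
  "weak_gradient \<Omega> v g \<longleftrightarrow>
     (\<forall>i. (\<lambda>x. g x $ i) \<in> Lp_loc 1 \<Omega> \<and>
          (\<forall>\<phi> \<in> test_functions \<Omega>. dpartial i (regular \<Omega> v) \<phi> = regular \<Omega> (\<lambda>x. g x $ i) \<phi>))"

definition W12_loc :: "(real^2) set \<Rightarrow> (real^2 \<Rightarrow> real) set" where
  "W12_loc \<Omega> =
     {v \<in> Lp_loc 2 \<Omega>. \<exists>g. weak_gradient \<Omega> v g \<and> (\<forall>i. (\<lambda>x. g x $ i) \<in> Lp_loc 2 \<Omega>)}"

text \<open>For \<open>v \<in> W12_loc \<Omega>\<close> weak gradients agree almost everywhere in \<open>\<Omega>\<close>, so the choice below
  does not affect any integral.\<close>

definition weak_grad :: "(real^2) set \<Rightarrow> (real^2 \<Rightarrow> real) \<Rightarrow> real^2 \<Rightarrow> real^2" where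
  "weak_grad \<Omega> v = (SOME g. weak_gradient \<Omega> v g)"

section \<open>The very weak Hessian determinant\<close>

definition curl_curl :: "(real^2) set \<Rightarrow> (real^2 \<Rightarrow> real^2^2) \<Rightarrow> distribution" where
  "curl_curl \<Omega> A = (\<lambda>\<phi>.
       dpartial 2 (dpartial 2 (regular \<Omega> (\<lambda>x. A x $ 1 $ 1))) \<phi>
     + dpartial 1 (dpartial 1 (regular \<Omega> (\<lambda>x. A x $ 2 $ 2))) \<phi>
     - 2 * dpartial 1 (dpartial 2 (regular \<Omega> (\<lambda>x. A x $ 1 $ 2))) \<phi>)"

definition outer :: "real^2 \<Rightarrow> real^2 \<Rightarrow> real^2^2" where
  "outer a b = (\<chi> i j. a $ i * b $ j)"

definition Det_Hess :: "(real^2) set \<Rightarrow> (real^2 \<Rightarrow> real) \<Rightarrow> distribution" where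
  "Det_Hess \<Omega> v =
     (\<lambda>\<phi>. - (1 / 2) * curl_curl \<Omega> (\<lambda>x. outer (weak_grad \<Omega> v x) (weak_grad \<Omega> v x)) \<phi>)"

definition solves_Det_Hess :: "(real^2) set \<Rightarrow> (real^2 \<Rightarrow> real) \<Rightarrow> (real^2 \<Rightarrow> real) \<Rightarrow> bool" where
  "solves_Det_Hess \<Omega> f v \<longleftrightarrow>
     v \<in> W12_loc \<Omega> \<and> (\<forall>\<phi> \<in> test_functions \<Omega>. Det_Hess \<Omega> v \<phi> = regular \<Omega> f \<phi>)"

end

theory Submission
  imports Defs
begin

text \<open>If \<open>A\<close> is a symmetric matrix field with \<open>curl curl A = - f\<close>, then \<open>v\<close> solves the equation as soon as
  \<open>\<nabla>v \<otimes> \<nabla>v / 2 + sym \<nabla>w = A\<close> for some vector field \<open>w\<close>. Such an \<open>A\<close>, Hoelder continuous with every exponent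
  \<open>\<beta> < 2 - 2 / p\<close>, is the convolution of \<open>f\<close> with a kernel that is homogeneous of degree \<open>0\<close> and supported
  in a cone: it comes from averaging \<open>\<phi>(y) = \<integral> t \<partial>\<^sub>t\<^sup>2 \<phi>(y + t (1, s)) dt\<close> over the slopes \<open>s\<close>. Adding a large
  multiple of the identity to \<open>A\<close>, which does not change \<open>curl curl A\<close>, makes every smooth \<open>v\<close> with \<open>w = 0\<close>
  a strict subsolution whose defect is almost a multiple of the identity.

  The relaxed equation is then solved by Nash-Kuiper iteration on the whole plane. A stage mollifies
  \<open>v\<close> and \<open>w\<close>, writes the defect as a sum of three primitive metrics \<open>a\<^sup>2 \<eta> \<otimes> \<eta>\<close> and adds three
  corrugations of increasing frequency. It divides the defect by \<open>r\<close> and multiplies the Hessian of \<open>v\<close>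
  by a multiple of \<open>r\<^sup>3\<close>, so that the gradients converge in every Hoelder space of exponent below \<open>1/7\<close>;
  the roughness of \<open>A\<close> forces larger frequencies, hence the bound \<open>1 - 1 / p\<close>.\<close>

section \<open>Partial derivatives\<close>

text \<open>The numerology of one stage decides both thresholds. With defect
  \<open>s\<^sup>2\<close> and Hessian bound \<open>M\<close> the natural length is
  \<open>s / M\<close>; in these units a stage involves universal constants only. A corrugation
  leaves an error of the size of the Hessian that it meets, divided by its own frequency, so each
  frequency has to exceed the previous one by a factor comparable to \<open>r\<close>. Symmetric
  matrices of order two need three primitive metrics, hence the loss \<open>r ^ 3\<close>. With
  \<open>r = \<rho>\<^sup>2\<close> the gradient moves by a multiple of \<open>\<rho>\<close> to the
  power \<open>- n\<close>, while each stage multiplies the Hessian by a constant times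
  \<open>\<rho> ^ 6\<close>; interpolation gives a convergent series for
  \<open>7 * \<alpha> < 1\<close>, and a large \<open>\<rho>\<close> absorbs the constant. The field
  \<open>A\<close> is averaged over length \<open>s / M\<close> and may oscillate there only by a
  fraction of the next defect. If the Hessian grows by \<open>\<rho>\<close> to the power
  \<open>N - 1\<close>, this length shrinks by \<open>\<rho>\<close> to the power \<open>N\<close>
  and the defect by \<open>\<rho>\<^sup>2\<close>. So \<open>A\<close> must have Hoelder exponent
  \<open>2 / N\<close>, twice the limit exponent \<open>1 / N\<close> of the gradient, and
  \<open>2 - 2 / p\<close> becomes \<open>1 - 1 / p\<close>.\<close>

abbreviation ax :: "2 \<Rightarrow> real^2" where "ax i \<equiv> axis i 1"

definition pd :: "2 \<Rightarrow> (real^2 \<Rightarrow> real) \<Rightarrow> (real^2 \<Rightarrow> real) \<Rightarrow> bool" where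
  "pd i u u' \<longleftrightarrow> (\<forall>x. ((\<lambda>t. u (x + t *\<^sub>R ax i)) has_real_derivative u' x) (at 0))"

text \<open>Derivatives are carried as explicit functions, so that the product and chain rules
  become closed formulas that can be estimated. Continuity of the partial derivatives makes them the
  Frechet derivative (\<open>C1_has_derivative\<close>), to which \<open>partial\<close>
  refers.\<close>

definition C1 :: "(real^2 \<Rightarrow> real) \<Rightarrow> (2 \<Rightarrow> real^2 \<Rightarrow> real) \<Rightarrow> bool" where
  "C1 u u' \<longleftrightarrow> continuous_on UNIV u \<and> (\<forall>i. pd i u (u' i) \<and> continuous_on UNIV (u' i))"

lemma pd_at:
  assumes "pd i u u'"
  shows "((\<lambda>t. u (x + t *\<^sub>R ax i)) has_real_derivative u' (x + t *\<^sub>R ax i)) (at t within S)"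
proof -
  have "((\<lambda>r. u ((x + t *\<^sub>R ax i) + r *\<^sub>R ax i)) has_real_derivative u' (x + t *\<^sub>R ax i)) (at 0)"
    using assms unfolding pd_def by blast
  then have "((\<lambda>r. u (x + (r + t) *\<^sub>R ax i)) has_real_derivative u' (x + t *\<^sub>R ax i)) (at 0)"
    by (simp add: algebra_simps)
  then have "((\<lambda>t. u (x + t *\<^sub>R ax i)) has_real_derivative u' (x + t *\<^sub>R ax i)) (at (0 + t))"
    by (subst DERIV_shift) simp
  then show ?thesis by (simp add: has_field_derivative_at_within)
qed

lemma pd_unique: "pd i u u' \<Longrightarrow> pd i u u'' \<Longrightarrow> u' = u''"
  unfolding pd_def by (auto intro!: ext DERIV_unique)

lemma C1_unique: "C1 u u' \<Longrightarrow> C1 u u'' \<Longrightarrow> u' i = u'' i"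
  unfolding C1_def by (blast intro: pd_unique)

lemma C1_cont: "C1 u u' \<Longrightarrow> continuous_on UNIV u"
  and C1_cont': "C1 u u' \<Longrightarrow> continuous_on UNIV (u' i)"
  and C1_pd: "C1 u u' \<Longrightarrow> pd i u (u' i)"
  unfolding C1_def by auto

lemma C1_const: "C1 (\<lambda>x. c) (\<lambda>i x. 0)"
  unfolding C1_def pd_def by auto

lemma C1_add: "C1 u u' \<Longrightarrow> C1 v v' \<Longrightarrow> C1 (\<lambda>x. u x + v x) (\<lambda>i x. u' i x + v' i x)"
  unfolding C1_def pd_def by (auto intro!: continuous_intros DERIV_add)

lemma C1_diff: "C1 u u' \<Longrightarrow> C1 v v' \<Longrightarrow> C1 (\<lambda>x. u x - v x) (\<lambda>i x. u' i x - v' i x)"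
  unfolding C1_def pd_def by (auto intro!: continuous_intros DERIV_diff)

lemma C1_mult: "C1 u u' \<Longrightarrow> C1 v v' \<Longrightarrow> C1 (\<lambda>x. u x * v x) (\<lambda>i x. u' i x * v x + u x * v' i x)"
  unfolding C1_def pd_def by (auto intro!: continuous_intros derivative_eq_intros)

lemma C1_cmult: "C1 u u' \<Longrightarrow> C1 (\<lambda>x. c * u x) (\<lambda>i x. c * u' i x)"
  unfolding C1_def pd_def by (auto intro!: continuous_intros derivative_eq_intros)

lemma C1_cong: "C1 u u' \<Longrightarrow> (\<And>x. u x = v x) \<Longrightarrow> (\<And>i x. u' i x = v' i x) \<Longrightarrow> C1 v v'"
proof -
  assume "C1 u u'" and "\<And>x. u x = v x" "\<And>i x. u' i x = v' i x"
  moreover from this have "u = v" by auto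
  moreover have "u' = v'" using \<open>\<And>i x. u' i x = v' i x\<close> by blast
  ultimately show ?thesis by simp
qed

lemma C1_compose:
  assumes "C1 u u'" and h: "\<And>x. (h has_real_derivative h' (u x)) (at (u x))"
    and "continuous_on (range u) h'"
  shows "C1 (\<lambda>x. h (u x)) (\<lambda>i x. h' (u x) * u' i x)"
proof -
  have ch: "continuous_on (range u) h"
    by (rule DERIV_continuous_on[of _ _ h']) (use h in \<open>auto intro: has_field_derivative_at_within\<close>)
  have cu: "continuous_on UNIV u" "continuous_on UNIV (u' i)" for i using assms C1_def by auto
  have 1: "continuous_on UNIV (\<lambda>x. h (u x))" "continuous_on UNIV (\<lambda>x. h' (u x))"
    using continuous_on_compose2[OF ch cu(1)] continuous_on_compose2[OF assms(3) cu(1)] by auto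
  have "((\<lambda>t. h (u (x + t *\<^sub>R ax i))) has_real_derivative h' (u x) * u' i x) (at 0)" for i x
    using DERIV_chain2[of h "h' (u x)" "\<lambda>t. u (x + t *\<^sub>R ax i)" 0 "u' i x" UNIV] h[of x] assms(1)
    unfolding C1_def pd_def by auto
  then show ?thesis using 1 cu unfolding C1_def pd_def by (auto intro!: continuous_intros)
qed

lemma C1_scaled:
  assumes "C1 u u'" shows "C1 (\<lambda>x. u (l *\<^sub>R x)) (\<lambda>i x. l * u' i (l *\<^sub>R x))"
proof -
  have cu: "continuous_on UNIV u" "continuous_on UNIV (u' i)" for i using assms C1_def by auto
  have "((\<lambda>t. u (l *\<^sub>R (x + t *\<^sub>R ax i))) has_real_derivative l * u' i (l *\<^sub>R x)) (at 0)" for i x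
  proof -
    have "((\<lambda>t. u (l *\<^sub>R x + t *\<^sub>R ax i)) has_real_derivative u' i (l *\<^sub>R x)) (at (l * 0))"
      using assms unfolding C1_def pd_def by simp
    moreover have "((\<lambda>t. l * t) has_real_derivative l) (at 0)" by (auto intro!: derivative_eq_intros)
    ultimately have "((\<lambda>t. u (l *\<^sub>R x + (l * t) *\<^sub>R ax i)) has_real_derivative u' i (l *\<^sub>R x) * l) (at 0)"
      by (rule DERIV_chain2)
    then show ?thesis by (simp add: algebra_simps)
  qed
  then show ?thesis unfolding C1_def pd_def
    by (auto intro!: continuous_on_compose2[OF cu(1)] continuous_on_compose2[OF cu(2)] continuous_intros)
qed

lemma axis_nth: "(axis i (1::real)::real^2) $ j = (if j = i then 1 else 0)"
  by (simp add: axis_def)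

lemma C1_nth: "C1 (\<lambda>x. x $ k) (\<lambda>i x. if i = k then 1 else 0)"
  unfolding C1_def pd_def by (auto intro!: continuous_intros derivative_eq_intros simp: axis_nth)

lemma C1_linear:
  "C1 (\<lambda>x. m * (\<Sum>k\<in>UNIV. \<eta> k * x $ k)) (\<lambda>i x. m * (\<eta> i))" for \<eta> :: "2 \<Rightarrow> real"
proof -
  have "((\<lambda>t. m * (\<Sum>k\<in>UNIV. \<eta> k * (x + t *\<^sub>R ax i) $ k)) has_real_derivative m * \<eta> i) (at 0)" for i x
  proof -
    have "(\<lambda>t. m * (\<Sum>k\<in>UNIV. \<eta> k * (x + t *\<^sub>R ax i) $ k)) = (\<lambda>t. m * (\<Sum>k\<in>UNIV. \<eta> k * x $ k) + (m * \<eta> i) * t)"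
      using exhaust_2[of i] by (auto simp: sum_2 axis_nth algebra_simps)
    then show ?thesis by (auto intro!: derivative_eq_intros)
  qed
  then show ?thesis unfolding C1_def pd_def by (auto intro!: continuous_intros)
qed

lemma vec2_diff: "y - x = (y$1 - x$1) *\<^sub>R ax 1 + (y$2 - x$2) *\<^sub>R ax 2" for x y :: "real^2"
  by (simp add: vec_eq_iff forall_2 axis_nth)

lemma C1_mvt_axis:
  assumes "C1 u u'" shows "\<exists>s. \<bar>s\<bar> \<le> \<bar>t\<bar> \<and> u (x + t *\<^sub>R ax i) - u x = t * u' i (x + s *\<^sub>R ax i)"
proof -
  let ?f = "\<lambda>t. u (x + t *\<^sub>R ax i)"
  have d: "DERIV ?f t :> u' i (x + t *\<^sub>R ax i)" for t by (rule pd_at[OF C1_pd[OF assms]])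
  consider "t = 0" | "t > 0" | "t < 0" by linarith
  then show ?thesis
  proof cases
    case 2
    from MVT2[OF this d] obtain z where "0 < z" "z < t" "?f t - ?f 0 = (t - 0) * u' i (x + z *\<^sub>R ax i)" by metis
    then show ?thesis by (intro exI[of _ z]) auto
  next
    case 3
    from MVT2[OF this d] obtain z where "t < z" "z < 0" "?f 0 - ?f t = (0 - t) * u' i (x + z *\<^sub>R ax i)" by metis
    then show ?thesis by (intro exI[of _ z]) (auto simp: algebra_simps)
  qed auto
qed

text \<open>The points are joined by an L-shaped path, first along axis 1 and then along axis 2.
  Bounds on this path suffice, so the lemma also applies when the derivatives are small only near
  one point.\<close>

lemma C1_lipschitz_local:
  assumes "C1 u u'"
    and "\<And>s. \<bar>s\<bar> \<le> \<bar>y$1 - x$1\<bar> \<Longrightarrow> \<bar>u' 1 (x + s *\<^sub>R ax 1)\<bar> \<le> M"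
    and "\<And>s. \<bar>s\<bar> \<le> \<bar>y$2 - x$2\<bar> \<Longrightarrow> \<bar>u' 2 (x + (y$1 - x$1) *\<^sub>R ax 1 + s *\<^sub>R ax 2)\<bar> \<le> M"
  shows "\<bar>u y - u x\<bar> \<le> M * (\<bar>y$1 - x$1\<bar> + \<bar>y$2 - x$2\<bar>)"
proof -
  let ?z = "x + (y$1 - x$1) *\<^sub>R ax 1"
  obtain s where s: "\<bar>s\<bar> \<le> \<bar>y$1 - x$1\<bar>" "u ?z - u x = (y$1 - x$1) * u' 1 (x + s *\<^sub>R ax 1)"
    using C1_mvt_axis[OF assms(1)] by blast
  obtain t where t: "\<bar>t\<bar> \<le> \<bar>y$2 - x$2\<bar>"
    "u (?z + (y$2 - x$2) *\<^sub>R ax 2) - u ?z = (y$2 - x$2) * u' 2 (?z + t *\<^sub>R ax 2)"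
    using C1_mvt_axis[OF assms(1)] by blast
  have y: "?z + (y$2 - x$2) *\<^sub>R ax 2 = y" using vec2_diff[of y x] by (simp add: algebra_simps)
  have "\<bar>u ?z - u x\<bar> \<le> M * \<bar>y$1 - x$1\<bar>"
    using s assms(2)[OF s(1)] by (simp add: abs_mult mult.commute[of M] mult_left_mono)
  moreover have "\<bar>u y - u ?z\<bar> \<le> M * \<bar>y$2 - x$2\<bar>"
    using t assms(3)[OF t(1)] unfolding y by (simp add: abs_mult mult.commute[of M] mult_left_mono)
  ultimately show ?thesis by (simp add: algebra_simps)
qed

lemma C1_lipschitz:
  assumes "C1 u u'" "\<And>i x. \<bar>u' i x\<bar> \<le> M"
  shows "\<bar>u y - u x\<bar> \<le> M * (\<bar>y$1 - x$1\<bar> + \<bar>y$2 - x$2\<bar>)"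
  using C1_lipschitz_local[of u u' y x M] assms by blast

lemma C1_has_derivative:
  assumes "C1 u u'"
  shows "(u has_derivative (\<lambda>h. \<Sum>i\<in>UNIV. u' i x * h $ i)) (at x)"
proof -
  let ?L = "\<lambda>h::real^2. \<Sum>i\<in>UNIV. u' i x * h $ i"
  have bl: "bounded_linear ?L"
    by (intro bounded_linear_sum bounded_linear_compose[OF bounded_linear_mult_right]
         bounded_linear_vec_nth)
  have c: "\<And>i. isCont (u' i) x" using C1_cont'[OF assms] by (simp add: continuous_on_eq_continuous_at)
  show "(u has_derivative ?L) (at x)"
    unfolding has_derivative_at_alt
  proof (intro conjI bl allI impI)
    fix e :: real assume "e > 0"
    then have "\<forall>i. \<exists>d>0. \<forall>y. dist y x < d \<longrightarrow> dist (u' i y) (u' i x) < e/2"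
      using c unfolding continuous_at_eps_delta by (metis half_gt_zero)
    then obtain d where d: "\<And>i. d i > 0" "\<And>i y. dist y x < d i \<Longrightarrow> dist (u' i y) (u' i x) < e/2" by metis
    \<comment> \<open>Halved because points on the second leg of the path can be at distance up to
      \<open>2 * r\<close> from \<open>x\<close>.\<close>
    define r where "r = min (d 1) (d 2) / 2"
    have r: "r > 0" "2 * r \<le> d 1" "2 * r \<le> d 2" using d by (auto simp: r_def)
    show "\<exists>r>0. \<forall>y. norm (y - x) < r \<longrightarrow> norm (u y - u x - ?L (y - x)) \<le> e * norm (y - x)"
    proof (intro exI conjI allI impI)
      fix y assume y: "norm (y - x) < r"
      \<comment> \<open>Subtracting the linear function with gradient frozen at \<open>x\<close>
        leaves partial derivatives below \<open>e / 2\<close> near \<open>x\<close>, and the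
        Lipschitz estimate for \<open>?w\<close> is the claim.\<close>
      let ?w = "\<lambda>z. u z - (\<Sum>i\<in>UNIV. u' i x * z $ i)"
      have C: "C1 ?w (\<lambda>i z. u' i z - u' i x)"
        using C1_diff[OF assms C1_linear[of 1 "\<lambda>i. u' i x"]] by simp
      have n: "\<bar>y$1 - x$1\<bar> \<le> norm (y - x)" "\<bar>y$2 - x$2\<bar> \<le> norm (y - x)"
        using component_le_norm_cart[of "y - x"] by (metis vector_minus_component)+
      have "\<bar>?w y - ?w x\<bar> \<le> (e/2) * (\<bar>y$1 - x$1\<bar> + \<bar>y$2 - x$2\<bar>)"
      proof (rule C1_lipschitz_local[OF C])
        fix s assume "\<bar>s\<bar> \<le> \<bar>y$1 - x$1\<bar>"
        then have "dist (x + s *\<^sub>R ax 1) x < d 1" using n y r by (simp add: dist_norm)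
        from d(2)[OF this] show "\<bar>u' 1 (x + s *\<^sub>R ax 1) - u' 1 x\<bar> \<le> e / 2" by (simp add: dist_real_def)
      next
        fix s assume "\<bar>s\<bar> \<le> \<bar>y$2 - x$2\<bar>"
        then have "dist (x + (y $ 1 - x $ 1) *\<^sub>R ax 1 + s *\<^sub>R ax 2) x < d 2"
        proof -
          have "norm ((y $ 1 - x $ 1) *\<^sub>R ax 1 + s *\<^sub>R ax 2) \<le> \<bar>y $ 1 - x $ 1\<bar> + \<bar>s\<bar>"
            using norm_triangle_ineq[of "(y $ 1 - x $ 1) *\<^sub>R ax 1" "s *\<^sub>R ax 2"] by simp
          also have "\<dots> < d 2" using n y r \<open>\<bar>s\<bar> \<le> \<bar>y$2 - x$2\<bar>\<close> by linarith
          finally show ?thesis by (simp add: dist_norm add.assoc)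
        qed
        from d(2)[OF this] show "\<bar>u' 2 (x + (y $ 1 - x $ 1) *\<^sub>R ax 1 + s *\<^sub>R ax 2) - u' 2 x\<bar> \<le> e / 2"
          by (simp add: dist_real_def)
      qed
      also have "\<dots> \<le> (e/2) * (2 * norm (y - x))" using n \<open>e > 0\<close> by (intro mult_left_mono) auto
      finally show "norm (u y - u x - ?L (y - x)) \<le> e * norm (y - x)"
        by (simp add: sum_2 algebra_simps)
    qed (use r in auto)
  qed
qed

section \<open>Box averages and jets\<close>

definition axis_avg :: "2 \<Rightarrow> (real^2 \<Rightarrow> real) \<Rightarrow> real^2 \<Rightarrow> real" where
  "axis_avg i u x = integral {0..1} (\<lambda>t. u (x + t *\<^sub>R ax i))"

lemma cont_along: "continuous_on UNIV u \<Longrightarrow> continuous_on S (\<lambda>t. u (x + t *\<^sub>R ax i))"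
  by (rule continuous_on_compose2[of UNIV u]) (auto intro!: continuous_intros)

lemma axis_avg_int: "continuous_on UNIV u \<Longrightarrow> (\<lambda>t. u (x + t *\<^sub>R ax i)) integrable_on {a..b}" for u :: "real^2 \<Rightarrow> real"
  by (rule integrable_continuous_interval[OF cont_along])

lemma axis_avg_cont: assumes "continuous_on UNIV u" shows "continuous_on UNIV (axis_avg i u)"
proof -
  have "continuous_on (UNIV \<times> cbox 0 1) (\<lambda>(x, t). u (x + t *\<^sub>R ax i))"
    unfolding split_def by (rule continuous_on_compose2[OF assms]) (auto intro!: continuous_intros)
  from integral_continuous_on_param[OF this] show ?thesis by (simp add: axis_avg_def[abs_def])
qed

lemma axis_avg_add: "continuous_on UNIV u \<Longrightarrow> continuous_on UNIV v \<Longrightarrow> axis_avg i (\<lambda>x. u x + v x) x = axis_avg i u x + axis_avg i v x"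
  unfolding axis_avg_def by (intro integral_add axis_avg_int)

lemma axis_avg_diff: "continuous_on UNIV u \<Longrightarrow> continuous_on UNIV v \<Longrightarrow> axis_avg i (\<lambda>x. u x - v x) x = axis_avg i u x - axis_avg i v x"
  unfolding axis_avg_def by (intro integral_diff axis_avg_int)

lemma axis_avg_cmult: "axis_avg i (\<lambda>x. c * u x) x = c * axis_avg i u x"
  unfolding axis_avg_def by simp

lemma axis_avg_const: "axis_avg i (\<lambda>x. c) x = c"
  unfolding axis_avg_def by simp

text \<open>The averages run over \<open>[0, 1]\<close> and not over a centred interval, so the
  value of an average at \<open>x\<close> depends only on points in this forward square.\<close>

definition fwd_box :: "real \<Rightarrow> real^2 \<Rightarrow> (real^2) set" where
  "fwd_box n x = {y. \<forall>i. x $ i \<le> y $ i \<and> y $ i \<le> x $ i + n}"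

lemma axis_avg_bound:
  assumes "continuous_on UNIV u" "\<And>t. t \<in> {0..1} \<Longrightarrow> \<bar>u (x + t *\<^sub>R ax i) - c\<bar> \<le> B"
  shows "\<bar>axis_avg i u x - c\<bar> \<le> B"
proof -
  have "norm (integral (cbox 0 1) (\<lambda>t. u (x + t *\<^sub>R ax i) - c)) \<le> B * measure lborel (cbox (0::real) 1)"
    using assms(2)[of 0] assms by (intro integrable_bound integrable_diff) (auto intro: order_trans[OF abs_ge_zero] axis_avg_int)
  moreover have "integral {0..1} (\<lambda>t. u (x + t *\<^sub>R ax i) - c) = axis_avg i u x - integral {0..1} (\<lambda>t::real. c)"
    unfolding axis_avg_def by (intro integral_diff axis_avg_int assms(1)) simp
  ultimately show ?thesis by simp
qed

lemma axis_avg_pd_param: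
  assumes "continuous_on UNIV u" "pd j u u'" "continuous_on UNIV u'" shows "pd j (axis_avg i u) (axis_avg i u')"
  unfolding pd_def
proof
  fix x
  have "((\<lambda>r. integral (cbox 0 1) (\<lambda>t. u (x + t *\<^sub>R ax i + r *\<^sub>R ax j))) has_field_derivative 
          integral (cbox 0 1) (\<lambda>t. u' (x + t *\<^sub>R ax i + 0 *\<^sub>R ax j))) (at 0 within UNIV)"
  proof (rule leibniz_rule_field_derivative[where fx = "\<lambda>r t. u' (x + t *\<^sub>R ax i + r *\<^sub>R ax j)"])
    show "((\<lambda>r. u (x + t *\<^sub>R ax i + r *\<^sub>R ax j)) has_field_derivative u' (x + t *\<^sub>R ax i + r *\<^sub>R ax j)) (at r within UNIV)" for r t
      by (rule pd_at[OF assms(2)])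
    show "(\<lambda>t. u (x + t *\<^sub>R ax i + r *\<^sub>R ax j)) integrable_on cbox 0 1" for r
      using axis_avg_int[OF assms(1), of "x + r *\<^sub>R ax j" i 0 1] by (simp add: algebra_simps)
    show "continuous_on (UNIV \<times> cbox 0 1) (\<lambda>(r, t). u' (x + t *\<^sub>R ax i + r *\<^sub>R ax j))"
      unfolding split_def by (rule continuous_on_compose2[OF assms(3)]) (auto intro!: continuous_intros)
  qed auto
  then show "((\<lambda>t. axis_avg i u (x + t *\<^sub>R ax j)) has_real_derivative axis_avg i u' x) (at 0)"
    by (simp add: axis_avg_def algebra_simps)
qed

lemma axis_avg_C1: "C1 u u' \<Longrightarrow> C1 (axis_avg i u) (\<lambda>j. axis_avg i (u' j))"
  unfolding C1_def by (auto intro: axis_avg_pd_param axis_avg_cont)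

text \<open>Averaging gains a derivative along its axis: after a shift of variables the average is
  the difference of two values of one primitive of \<open>u\<close> along the line.\<close>

lemma axis_avg_pd:
  assumes "continuous_on UNIV u" shows "pd i (axis_avg i u) (\<lambda>x. u (x + ax i) - u x)"
  unfolding pd_def
proof
  fix x
  let ?f = "\<lambda>t. u (x + t *\<^sub>R ax i)"
  have c: "continuous_on S ?f" for S using assms by (rule cont_along)
  \<comment> \<open>The base point \<open>-1\<close> leaves room on both sides of the two arguments
    \<open>r\<close> and \<open>1 + r\<close> near \<open>r = 0\<close>.\<close>
  define F where "F = (\<lambda>r. integral {-1..r} ?f)"
  have dF: "(F has_real_derivative ?f r) (at r)" if "-1 < r" "r < 3" for r
  proof -
    have "(F has_vector_derivative ?f r) (at r within {-1..3})"
      unfolding F_def by (rule integral_has_vector_derivative) (use that c in auto)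
    then show ?thesis using that
      by (simp add: has_real_derivative_iff_has_vector_derivative at_within_Icc_at)
  qed
  have "((\<lambda>r. F (1 + r) - F r) has_real_derivative ?f 1 * 1 - ?f 0) (at 0)"
    using dF[of 1] by (intro DERIV_diff DERIV_chain2[where f = F] dF) (auto intro!: derivative_eq_intros)
  moreover have "axis_avg i u (x + r *\<^sub>R ax i) = F (1 + r) - F r" if "r \<in> {-1<..<1}" for r
  proof -
    have "axis_avg i u (x + r *\<^sub>R ax i) = integral {0..1} (\<lambda>t. ?f (t + r))"
      by (simp add: axis_avg_def algebra_simps)
    also have "\<dots> = integral {r..1+r} ?f"
      using integral_shift[of 0 r 1 ?f] c by (simp add: add.commute comp_def)
    also have "\<dots> = F (1 + r) - F r"
      using Henstock_Kurzweil_Integration.integral_combine[of "-1" r "1+r" ?f] that axis_avg_int[OF assms]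
      by (simp add: F_def)
    finally show ?thesis .
  qed
  ultimately show "((\<lambda>t. axis_avg i u (x + t *\<^sub>R ax i)) has_real_derivative u (x + ax i) - u x) (at 0)"
    using has_field_derivative_transform_within_open[of "\<lambda>r. F (1 + r) - F r" _ 0 "{-1<..<1}" "\<lambda>t. axis_avg i u (x + t *\<^sub>R ax i)"]
    by auto
qed

definition box_avg :: "(real^2 \<Rightarrow> real) \<Rightarrow> real^2 \<Rightarrow> real" where
  "box_avg u = axis_avg 1 (axis_avg 2 u)"

text \<open>No derivative of \<open>u\<close> occurs: each partial derivative of the average is a
  difference. The two cases look different because \<open>box_avg\<close> averages along axis 2
  first.\<close>

definition box_avg_deriv :: "(real^2 \<Rightarrow> real) \<Rightarrow> 2 \<Rightarrow> real^2 \<Rightarrow> real" where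
  "box_avg_deriv u i = (if i = 1 then (\<lambda>x. axis_avg 2 u (x + ax 1) - axis_avg 2 u x) else axis_avg 1 (\<lambda>x. u (x + ax 2) - u x))"

lemma cont_shift: "continuous_on UNIV u \<Longrightarrow> continuous_on UNIV (\<lambda>x. u (x + c))"
  for u :: "real^2 \<Rightarrow> real"
  by (rule continuous_on_compose2[of UNIV u]) (auto intro!: continuous_intros)

lemma box_avg_cont: "continuous_on UNIV u \<Longrightarrow> continuous_on UNIV (box_avg u)"
  unfolding box_avg_def by (intro axis_avg_cont)

lemma box_avg_C1: "C1 u u' \<Longrightarrow> C1 (box_avg u) (\<lambda>i. box_avg (u' i))"
  unfolding box_avg_def by (intro axis_avg_C1)

lemma box_avg_gain:
  assumes u: "continuous_on UNIV u" shows "C1 (box_avg u) (box_avg_deriv u)"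
  unfolding C1_def
proof (intro conjI allI)
  show "continuous_on UNIV (box_avg u)" by (rule box_avg_cont[OF u])
  fix i :: 2
  consider "i = 1" | "i = 2" using exhaust_2 by blast
  then show "pd i (box_avg u) (box_avg_deriv u i)" "continuous_on UNIV (box_avg_deriv u i)"
    by (cases; auto simp: box_avg_def box_avg_deriv_def intro!: axis_avg_pd axis_avg_pd_param axis_avg_cont u continuous_intros cont_shift)+
qed

lemma box_avg_bound:
  assumes u: "continuous_on UNIV u" and "\<And>y. y \<in> fwd_box 1 x \<Longrightarrow> \<bar>u y - c\<bar> \<le> B"
  shows "\<bar>box_avg u x - c\<bar> \<le> B"
  unfolding box_avg_def
  by (intro axis_avg_bound axis_avg_cont u assms(2)) (auto simp: fwd_box_def axis_nth)

lemma box_avg_deriv_bound: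
  assumes u: "continuous_on UNIV u" and b: "\<And>y. y \<in> fwd_box 1 x \<Longrightarrow> \<bar>u y\<bar> \<le> B"
  shows "\<bar>box_avg_deriv u i x\<bar> \<le> 2 * B"
proof -
  have "\<bar>axis_avg 2 u (x + ax 1) - 0\<bar> \<le> B" "\<bar>axis_avg 2 u x - 0\<bar> \<le> B"
    by (intro axis_avg_bound u; simp add: b fwd_box_def axis_nth)+
  moreover have "\<bar>axis_avg 1 (\<lambda>x. u (x + ax 2) - u x) x - 0\<bar> \<le> 2 * B"
  proof (intro axis_avg_bound continuous_intros cont_shift u)
    fix t :: real assume "t \<in> {0..1}"
    then have "\<bar>u (x + t *\<^sub>R ax 1 + ax 2)\<bar> \<le> B" "\<bar>u (x + t *\<^sub>R ax 1)\<bar> \<le> B"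
      by (auto intro!: b simp: fwd_box_def axis_nth)
    then show "\<bar>u (x + t *\<^sub>R ax 1 + ax 2) - u (x + t *\<^sub>R ax 1) - 0\<bar> \<le> 2 * B" by linarith
  qed
  ultimately show ?thesis by (auto simp: box_avg_deriv_def)
qed

lemma box_avg_add: "continuous_on UNIV u \<Longrightarrow> continuous_on UNIV v \<Longrightarrow> box_avg (\<lambda>x. u x + v x) = (\<lambda>x. box_avg u x + box_avg v x)"
proof -
  have f: "axis_avg i (\<lambda>x. u x + v x) = (\<lambda>x. axis_avg i u x + axis_avg i v x)"
    if "continuous_on UNIV u" "continuous_on UNIV v" for i u v using axis_avg_add[OF that] by auto
  show "continuous_on UNIV u \<Longrightarrow> continuous_on UNIV v \<Longrightarrow> ?thesis"
    unfolding box_avg_def by (simp add: f axis_avg_cont)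
qed

lemma box_avg_diff: "continuous_on UNIV u \<Longrightarrow> continuous_on UNIV v \<Longrightarrow> box_avg (\<lambda>x. u x - v x) = (\<lambda>x. box_avg u x - box_avg v x)"
proof -
  have f: "axis_avg i (\<lambda>x. u x - v x) = (\<lambda>x. axis_avg i u x - axis_avg i v x)"
    if "continuous_on UNIV u" "continuous_on UNIV v" for i u v using axis_avg_diff[OF that] by auto
  show "continuous_on UNIV u \<Longrightarrow> continuous_on UNIV v \<Longrightarrow> ?thesis"
    unfolding box_avg_def by (simp add: f axis_avg_cont)
qed

lemma box_avg_cmult: "box_avg (\<lambda>x. c * u x) = (\<lambda>x. c * box_avg u x)"
  unfolding box_avg_def by (simp add: axis_avg_cmult[abs_def] fun_eq_iff)

lemma box_avg_const: "box_avg (\<lambda>x. c) = (\<lambda>x. c)"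
  unfolding box_avg_def by (simp add: axis_avg_const[abs_def])

text \<open>The amplitude of a corrugation must be twice continuously differentiable, and two
  averages produce just that from a continuous defect.\<close>

abbreviation box_avg2 :: "(real^2 \<Rightarrow> real) \<Rightarrow> real^2 \<Rightarrow> real" where "box_avg2 u \<equiv> box_avg (box_avg u)"

lemma fwd_box_trans: "y \<in> fwd_box 1 x \<Longrightarrow> z \<in> fwd_box 1 y \<Longrightarrow> z \<in> fwd_box 2 x"
  unfolding fwd_box_def by (auto intro: order_trans) (smt (verit))

lemma box_avg2_bound:
  assumes u: "continuous_on UNIV u" and "\<And>y. y \<in> fwd_box 2 x \<Longrightarrow> \<bar>u y - c\<bar> \<le> B"
  shows "\<bar>box_avg2 u x - c\<bar> \<le> B"
  by (intro box_avg_bound box_avg_cont u assms(2)) (rule fwd_box_trans)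

lemmas box_avg2_C1 = box_avg_C1[OF box_avg_C1]

text \<open>\<open>jet u x K\<close> requires \<open>u\<close> to be twice continuously differentiable everywhere, but bounds the
  derivatives only at \<open>x\<close>.\<close>

definition jet :: "(real^2 \<Rightarrow> real) \<Rightarrow> real^2 \<Rightarrow> real \<Rightarrow> bool" where
  "jet u x K \<longleftrightarrow> (\<exists>u' u''. C1 u u' \<and> (\<forall>i. C1 (u' i) (u'' i)) \<and> \<bar>u x\<bar> \<le> K \<and>
     (\<forall>i. \<bar>u' i x\<bar> \<le> K) \<and> (\<forall>i j. \<bar>u'' i j x\<bar> \<le> K))"

lemma jet_mono: "jet u x K \<Longrightarrow> K \<le> L \<Longrightarrow> jet u x L"
  unfolding jet_def by (meson order_trans)

lemma jet_nonneg: "jet u x K \<Longrightarrow> 0 \<le> K"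
  unfolding jet_def by (auto intro: order_trans[OF abs_ge_zero])

lemma jet_const: "jet (\<lambda>x. c) x \<bar>c\<bar>"
  unfolding jet_def by (intro exI[of _ "\<lambda>i x. 0"] exI[of _ "\<lambda>i j x. 0"]) (auto intro: C1_const)

lemma jet_add: assumes "jet u x K" "jet v x L" shows "jet (\<lambda>x. u x + v x) x (K + L)"
proof -
  from assms obtain u' u'' v' v'' where
    a: "C1 u u'" "\<And>i. C1 (u' i) (u'' i)" "\<bar>u x\<bar> \<le> K" "\<And>i. \<bar>u' i x\<bar> \<le> K" "\<And>i j. \<bar>u'' i j x\<bar> \<le> K"
    and b: "C1 v v'" "\<And>i. C1 (v' i) (v'' i)" "\<bar>v x\<bar> \<le> L" "\<And>i. \<bar>v' i x\<bar> \<le> L" "\<And>i j. \<bar>v'' i j x\<bar> \<le> L"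
    unfolding jet_def by metis
  show ?thesis unfolding jet_def
    by (intro exI conjI allI, rule C1_add[OF a(1) b(1)], rule C1_add[OF a(2) b(2)])
      (auto intro!: abs_triangle_ineq[THEN order_trans] add_mono a b)
qed

text \<open>The Leibniz rule for a second derivative has four terms, hence the factor.\<close>

lemma jet_mult: assumes "jet u x K" "jet v x L" shows "jet (\<lambda>x. u x * v x) x (4 * (K * L))"
proof -
  from assms obtain u' u'' v' v'' where
    a: "C1 u u'" "\<And>i. C1 (u' i) (u'' i)" "\<bar>u x\<bar> \<le> K" "\<And>i. \<bar>u' i x\<bar> \<le> K" "\<And>i j. \<bar>u'' i j x\<bar> \<le> K"
    and b: "C1 v v'" "\<And>i. C1 (v' i) (v'' i)" "\<bar>v x\<bar> \<le> L" "\<And>i. \<bar>v' i x\<bar> \<le> L" "\<And>i j. \<bar>v'' i j x\<bar> \<le> L"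
    unfolding jet_def by metis
  have m: "\<bar>p * q\<bar> \<le> K * L" if "\<bar>p\<bar> \<le> K" "\<bar>q\<bar> \<le> L" for p q :: real
    unfolding abs_mult using that by (intro mult_mono) auto
  have KL: "0 \<le> K * L" using jet_nonneg assms by simp
  show ?thesis unfolding jet_def
  proof (intro exI conjI allI)
    show "C1 (\<lambda>x. u x * v x) (\<lambda>i x. u' i x * v x + u x * v' i x)" by (rule C1_mult[OF a(1) b(1)])
    show "C1 (\<lambda>x. u' i x * v x + u x * v' i x)
            (\<lambda>j x. (u'' i j x * v x + u' i x * v' j x) + (u' j x * v' i x + u x * v'' i j x))" for i
      by (intro C1_add C1_mult a b)
    show "\<bar>u x * v x\<bar> \<le> 4 * (K * L)" using m[OF a(3) b(3)] KL by linarith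
    show "\<bar>u' i x * v x + u x * v' i x\<bar> \<le> 4 * (K * L)" for i
      using m[OF a(4) b(3), of i] m[OF a(3) b(4), of i] KL by linarith
    show "\<bar>(u'' i j x * v x + u' i x * v' j x) + (u' j x * v' i x + u x * v'' i j x)\<bar> \<le> 4 * (K * L)" for i j
      using m[OF a(5) b(3), of i j] m[OF a(3) b(5), of i j] m[OF a(4) b(4), of i j] m[OF a(4) b(4), of j i] by linarith
  qed
qed

lemma jet_cmult: assumes "jet u x K" shows "jet (\<lambda>x. c * u x) x (\<bar>c\<bar> * K)"
proof -
  from assms obtain u' u'' where
    a: "C1 u u'" "\<And>i. C1 (u' i) (u'' i)" "\<bar>u x\<bar> \<le> K" "\<And>i. \<bar>u' i x\<bar> \<le> K" "\<And>i j. \<bar>u'' i j x\<bar> \<le> K"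
    unfolding jet_def by metis
  show ?thesis unfolding jet_def
    by (intro exI conjI allI, rule C1_cmult[OF a(1)], rule C1_cmult[OF a(2)])
      (auto simp: abs_mult intro!: mult_left_mono a)
qed

lemma jet_diff: assumes "jet u x K" "jet v x L" shows "jet (\<lambda>x. u x - v x) x (K + L)"
  using jet_add[OF assms(1) jet_cmult[OF assms(2), of "-1"]] by simp

text \<open>Each of the two averages absorbs one derivative and turns it into a difference, which
  costs a factor 2.\<close>

lemma jet_box_avg2:
  assumes u: "continuous_on UNIV u" and b: "\<And>y. y \<in> fwd_box 2 x \<Longrightarrow> \<bar>u y\<bar> \<le> B"
  shows "jet (box_avg2 u) x (4 * B)"
  unfolding jet_def
proof (intro exI conjI allI)
  have du: "continuous_on UNIV (box_avg_deriv u i)" for i using C1_cont'[OF box_avg_gain[OF u]] .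
  show "C1 (box_avg2 u) (\<lambda>i. box_avg (box_avg_deriv u i))" by (rule box_avg_C1[OF box_avg_gain[OF u]])
  show "C1 (box_avg (box_avg_deriv u i)) (box_avg_deriv (box_avg_deriv u i))" for i by (rule box_avg_gain[OF du])
  have 1: "\<bar>box_avg_deriv u i y\<bar> \<le> 2 * B" if "y \<in> fwd_box 1 x" for y i
    by (rule box_avg_deriv_bound[OF u b]) (rule fwd_box_trans[OF that])
  show 2: "\<bar>box_avg_deriv (box_avg_deriv u i) j x\<bar> \<le> 4 * B" for i j using box_avg_deriv_bound[OF du 1, where i=j and x=x] by simp
  then have B: "B \<ge> 0" by (metis abs_ge_zero order_trans zero_le_mult_iff zero_less_numeral not_numeral_le_zero)
  have "\<bar>box_avg (box_avg_deriv u i) x - 0\<bar> \<le> 2 * B" for i by (rule box_avg_bound[OF du]) (simp add: 1)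
  then have "\<bar>box_avg (box_avg_deriv u i) x\<bar> \<le> 2 * B" for i by simp
  from order_trans[OF this] show "\<bar>box_avg (box_avg_deriv u i) x\<bar> \<le> 4 * B" for i using B by simp
  show "\<bar>box_avg2 u x\<bar> \<le> 4 * B" using box_avg2_bound[of u x 0 B] u b B by fastforce
qed

text \<open>The commutator does not change when constants are subtracted from \<open>p\<close> and \<open>q\<close>, so at \<open>x\<close> only
  their oscillation matters, not their size.\<close>

lemma jet_comm:
  assumes p: "continuous_on UNIV p" and q: "continuous_on UNIV q"
    and bp: "\<And>y. y \<in> fwd_box 2 x \<Longrightarrow> \<bar>p y - p x\<bar> \<le> B" and bq: "\<And>y. y \<in> fwd_box 2 x \<Longrightarrow> \<bar>q y - q x\<bar> \<le> B"
  shows "jet (\<lambda>z. box_avg2 (\<lambda>x. p x * q x) z - box_avg2 p z * box_avg2 q z) x (68 * B\<^sup>2)"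
proof -
  define P R where "P = (\<lambda>y. p y - p x)" and "R = (\<lambda>y. q y - q x)"
  have c: "continuous_on UNIV P" "continuous_on UNIV R" by (auto simp: P_def R_def intro!: continuous_intros p q)
  have eqp: "box_avg2 P = (\<lambda>z. box_avg2 p z - p x)" "box_avg2 R = (\<lambda>z. box_avg2 q z - q x)"
    unfolding P_def R_def by (simp_all add: box_avg_diff box_avg_const p q box_avg_cont continuous_on_const)
  have "(\<lambda>y. P y * R y) = (\<lambda>y. (p y * q y - p x * q y) - (q x * p y - p x * q x))"
    by (auto simp: P_def R_def algebra_simps)
  then have "box_avg2 (\<lambda>y. P y * R y) = (\<lambda>z. (box_avg2 (\<lambda>y. p y * q y) z - p x * box_avg2 q z) - (q x * box_avg2 p z - p x * q x))"
    by (simp add: box_avg_diff box_avg_const box_avg_cmult p q box_avg_cont continuous_on_const continuous_on_mult continuous_on_diff)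
  then have eq: "(\<lambda>z. box_avg2 (\<lambda>x. p x * q x) z - box_avg2 p z * box_avg2 q z) = (\<lambda>z. box_avg2 (\<lambda>y. P y * R y) z - box_avg2 P z * box_avg2 R z)"
    unfolding eqp by (auto simp: algebra_simps)
  \<comment> \<open>The average of the product contributes \<open>4 * B\<^sup>2\<close> and the
    product of the averages \<open>4 * (4 * B)\<^sup>2\<close>, together 68.\<close>
  have "jet (\<lambda>z. box_avg2 (\<lambda>y. P y * R y) z - box_avg2 P z * box_avg2 R z) x (4 * (B * B) + 4 * ((4 * B) * (4 * B)))"
  proof (intro jet_diff jet_mult jet_box_avg2 c continuous_on_mult)
    fix y assume y: "y \<in> fwd_box 2 x"
    then show "\<bar>P y\<bar> \<le> B" "\<bar>R y\<bar> \<le> B" "\<bar>P y * R y\<bar> \<le> B * B"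
      using bp[OF y] bq[OF y] by (auto simp: P_def R_def abs_mult intro!: mult_mono)
  qed
  then show ?thesis unfolding eq by (simp add: power2_eq_square)
qed

text \<open>The lower bound keeps the inverse of the root below 4. In the second derivative the
  products of first derivatives then have a coefficient of at most \<open>4 ^ 3 / 4 = 16\<close>,
  the second derivative of \<open>c\<close> one of at most 2, and \<open>18 = 16 + 2\<close>. The
  lower bound is required everywhere because the root has to be differentiable everywhere.\<close>

lemma jet_sqrt:
  assumes "jet c x K" and c: "\<And>y. c y \<ge> 1/16" and "K \<ge> 1"
  shows "jet (\<lambda>y. sqrt (c y)) x (18 * K\<^sup>2)"
proof -
  from assms(1) obtain u' u'' where
    a: "C1 c u'" "\<And>i. C1 (u' i) (u'' i)" "\<bar>c x\<bar> \<le> K" "\<And>i. \<bar>u' i x\<bar> \<le> K" "\<And>i j. \<bar>u'' i j x\<bar> \<le> K"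
    unfolding jet_def by metis
  let ?s = "\<lambda>y. inverse (sqrt (c y))"
  have cp: "c y > 0" for y using c[of y] by simp
  have d1: "C1 (\<lambda>y. sqrt (c y)) (\<lambda>i y. (?s y / 2) * u' i y)"
    by (rule C1_compose[OF a(1), of sqrt "\<lambda>y. inverse (sqrt y) / 2"])
       (use cp in \<open>auto intro!: DERIV_real_sqrt continuous_intros simp: less_imp_neq[symmetric]\<close>)
  have d2: "C1 (\<lambda>y. ?s y / 2) (\<lambda>i y. (- (?s y ^ 3 / 4)) * u' i y)"
  proof (rule C1_compose[OF a(1), of "\<lambda>y. inverse (sqrt y) / 2" "\<lambda>y. - (inverse (sqrt y) ^ 3 / 4)"])
    fix y show "((\<lambda>y. inverse (sqrt y) / 2) has_real_derivative - (inverse (sqrt (c y)) ^ 3 / 4)) (at (c y))"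
      using cp[of y] by (auto intro!: derivative_eq_intros simp: field_simps power2_eq_square power3_eq_cube)
  qed (use cp in \<open>auto intro!: continuous_intros simp: less_imp_neq[symmetric]\<close>)
  have d: "C1 (\<lambda>y. (?s y / 2) * u' i y) 
     (\<lambda>j y. ((- (?s y ^ 3 / 4)) * u' j y) * u' i y + (?s y / 2) * u'' i j y)" for i
    by (rule C1_mult[OF d2 a(2)])
  have "sqrt (1/16) \<le> sqrt (c x)" using c by (rule real_sqrt_le_mono)
  then have s4: "1/4 \<le> sqrt (c x)" by (simp add: real_sqrt_divide)
  then have s: "0 \<le> ?s x" "?s x \<le> 4" using le_imp_inverse_le[OF s4] less_imp_le[OF cp[of x]] by auto
  then have s3: "?s x ^ 3 \<le> 64" using power_mono[of "?s x" 4 3] by simp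
  have K2: "K \<le> K\<^sup>2" using assms(3) by (simp add: power2_eq_square)
  show ?thesis unfolding jet_def
  proof (intro exI conjI allI)
    show "\<bar>sqrt (c x)\<bar> \<le> 18 * K\<^sup>2"
    proof -
      have "sqrt (c x) \<le> sqrt (K\<^sup>2)" using a(3) K2 cp[of x] by (intro real_sqrt_le_mono) auto
      then show ?thesis using K2 assms(3) cp[of x] by auto
    qed
    have 1: "\<bar>?s x / 2 * t\<bar> \<le> 2 * K" if "\<bar>t\<bar> \<le> K" for t
      using mult_mono[of "?s x / 2" 2 "\<bar>t\<bar>" K] that s by (simp add: abs_mult)
    show "\<bar>?s x / 2 * u' i x\<bar> \<le> 18 * K\<^sup>2" for i
      using 1[OF a(4), of i] K2 assms(3) by linarith
    have 2: "\<bar>(- (?s x ^ 3 / 4)) * t * r\<bar> \<le> 16 * K\<^sup>2" if "\<bar>t\<bar> \<le> K" "\<bar>r\<bar> \<le> K" for t r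
    proof -
      have "(?s x ^ 3 / 4) * (\<bar>t\<bar> * \<bar>r\<bar>) \<le> 16 * (K * K)"
        using that s3 s assms(3) by (intro mult_mono) auto
      then show ?thesis using s by (simp add: abs_mult power2_eq_square mult.assoc)
    qed
    show "\<bar>((- (?s x ^ 3 / 4)) * u' j x) * u' i x + (?s x / 2) * u'' i j x\<bar> \<le> 18 * K\<^sup>2" for i j
      using 2[OF a(4) a(4), of j i] 1[OF a(5), of i j] K2 assms(3) by linarith
  qed (rule d1 d)+
qed

text \<open>The derivatives hidden in \<open>jet\<close> could a priori depend on the point at which
  it is stated; uniqueness of partial derivatives merges them into one family.\<close>

lemma jet_all:
  assumes "\<And>x. jet u x K"
  obtains u' u'' where "C1 u u'" "\<And>i. C1 (u' i) (u'' i)" "\<And>x. \<bar>u x\<bar> \<le> K" "\<And>i x. \<bar>u' i x\<bar> \<le> K"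
    "\<And>i j x. \<bar>u'' i j x\<bar> \<le> K"
proof -
  from assms[of 0] obtain u' u'' where a: "C1 u u'" "\<And>i. C1 (u' i) (u'' i)"
    unfolding jet_def by metis
  have "\<bar>u x\<bar> \<le> K \<and> (\<forall>i. \<bar>u' i x\<bar> \<le> K) \<and> (\<forall>i j. \<bar>u'' i j x\<bar> \<le> K)" for x
  proof -
    from assms[of x] obtain w' w'' where b: "C1 u w'" "\<And>i. C1 (w' i) (w'' i)" "\<bar>u x\<bar> \<le> K" 
      "\<And>i. \<bar>w' i x\<bar> \<le> K" "\<And>i j. \<bar>w'' i j x\<bar> \<le> K"
      unfolding jet_def by metis
    have "w' = u'" using C1_unique[OF a(1) b(1)] by auto
    moreover have "w'' i j = u'' i j" for i j using C1_unique[OF a(2)[of i], of "w'' i"] b(2)[of i] \<open>w' = u'\<close> by auto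
    ultimately show ?thesis using b by auto
  qed
  then show thesis using that a by blast
qed

section \<open>Corrugations and the iteration\<close>

text \<open>The state of the iteration: \<open>g\<close> and \<open>H\<close> are gradient and
  Hessian of \<open>v\<close>, and \<open>W\<close> is the Jacobian of the companion field
  \<open>w\<close>.\<close>

definition St :: "(real^2 \<Rightarrow> real) \<Rightarrow> (2 \<Rightarrow> real^2 \<Rightarrow> real) \<Rightarrow> (2 \<Rightarrow> 2 \<Rightarrow> real^2 \<Rightarrow> real) \<Rightarrow>
    (2 \<Rightarrow> real^2 \<Rightarrow> real) \<Rightarrow> (2 \<Rightarrow> 2 \<Rightarrow> real^2 \<Rightarrow> real) \<Rightarrow> bool" where
  "St v g H w W \<longleftrightarrow> C1 v g \<and> (\<forall>i. C1 (g i) (H i)) \<and> (\<forall>i. C1 (w i) (W i))"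

text \<open>Up to the factor 2 this is the coefficient of t^2 in the metric induced on the plane by
  the map x -> (x + t^2 w(x), t v(x)), the stretching term of von Karman plate theory. This is why a
  construction for isometric embeddings applies.\<close>

definition metric_form :: "(2 \<Rightarrow> real^2 \<Rightarrow> real) \<Rightarrow> (2 \<Rightarrow> 2 \<Rightarrow> real^2 \<Rightarrow> real) \<Rightarrow> 2 \<Rightarrow> 2 \<Rightarrow> real^2 \<Rightarrow> real" where
  "metric_form g W i j x = g i x * g j x / 2 + (W i j x + W j i x) / 2"

text \<open>Here \<open>s\<close>, \<open>c\<close> are the sine and cosine of the phase and \<open>m\<close> is the inverse frequency. The
  corrugation profile \<open>2 sin\<close> and its companion \<open>- sin (2 t) / 2\<close> are chosen so that half the square of
  the derivative of the first plus the derivative of the second is \<open>1\<close>; the terms of order one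
  then cancel except for \<open>a\<^sup>2 \<eta> \<otimes> \<eta>\<close>.\<close>

lemma corrugation_identity:
  fixes s c m a ai aj gi gj hij hji ei ej wij wji :: real
  assumes sc: "s\<^sup>2 + c\<^sup>2 = 1"
  shows "(gi + (2 * m * ai * s + 2 * a * c * ei)) * (gj + (2 * m * aj * s + 2 * a * c * ej)) / 2 +
    ((wij - ((2 * m * aj * s + 2 * a * c * ej) * gi + 2 * m * a * s * hij)
          - ei * (m * a * aj * (2 * s * c) + a\<^sup>2 * (c\<^sup>2 - s\<^sup>2) * ej)) +
     (wji - ((2 * m * ai * s + 2 * a * c * ei) * gj + 2 * m * a * s * hji)
          - ej * (m * a * ai * (2 * s * c) + a\<^sup>2 * (c\<^sup>2 - s\<^sup>2) * ei))) / 2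
    - (gi * gj / 2 + (wij + wji) / 2) - a\<^sup>2 * ei * ej
    = - (m * a * s * (hij + hji)) + 2 * m\<^sup>2 * s\<^sup>2 * ai * aj + m * a * (s * c) * (ai * ej + aj * ei)"
  (is "?L = ?R")
proof -
  have "?L - ?R = a\<^sup>2 * ei * ej * (s\<^sup>2 + c\<^sup>2 - 1)"
    by (simp add: field_simps power2_eq_square)
  then show ?thesis using sc by simp
qed

text \<open>The error consists of the terms that survive in \<open>corrugation_identity\<close>, all
  with a factor \<open>1 / \<mu>\<close>: \<open>2 * K * P\<close> comes from the Hessian of
  \<open>v\<close>, \<open>4 * K\<^sup>2\<close> from derivatives of the amplitude. The first one
  makes every later corrugation more expensive than its predecessor.\<close>

lemma corrugation:
  fixes \<eta> :: "2 \<Rightarrow> real"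
  assumes St: "St v g H w W" and a: "C1 a a'" "\<And>i. C1 (a' i) (a'' i)"
    and K: "\<And>x. \<bar>a x\<bar> \<le> K" "\<And>i x. \<bar>a' i x\<bar> \<le> K" "\<And>i j x. \<bar>a'' i j x\<bar> \<le> K"
    and P: "\<And>i j x. \<bar>H i j x\<bar> \<le> P" and \<eta>: "\<And>i. \<bar>\<eta> i\<bar> \<le> 2" and \<mu>: "\<mu> \<ge> 1"
  shows "\<exists>v1 g1 H1 w1 W1. St v1 g1 H1 w1 W1 \<and> (\<forall>x. \<bar>v1 x - v x\<bar> \<le> 2 * K) \<and>
     (\<forall>i x. \<bar>g1 i x - g i x\<bar> \<le> 6 * K) \<and> (\<forall>i j x. \<bar>H1 i j x\<bar> \<le> P + 18 * K * \<mu>) \<and>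
     (\<forall>i j x. \<bar>metric_form g1 W1 i j x - metric_form g W i j x - (a x)\<^sup>2 * \<eta> i * \<eta> j\<bar> \<le> (2 * K * P + 4 * K\<^sup>2) / \<mu>)"
proof -
  have K0: "K \<ge> 0" using K(1)[of 0] by simp
  have P0: "P \<ge> 0" using P[of 1 1 0] by simp
  have v: "C1 v g" and g: "\<And>i. C1 (g i) (H i)" and w: "\<And>i. C1 (w i) (W i)" using St St_def by auto
  define m where "m = 1 / \<mu>"
  have m: "0 < m" "m \<le> 1" "m * \<mu> = 1" using \<mu> by (auto simp: m_def)
  define th where "th = (\<lambda>x. \<mu> * (\<Sum>k\<in>UNIV. \<eta> k * x $ k))"
  have th: "C1 th (\<lambda>i x. \<mu> * \<eta> i)" unfolding th_def by (rule C1_linear)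
  define s c where "s = (\<lambda>x. sin (th x))" and "c = (\<lambda>x. cos (th x))"
  have s: "C1 s (\<lambda>i x. c x * (\<mu> * \<eta> i))" unfolding s_def c_def
    by (rule C1_compose[OF th]) (auto intro!: continuous_intros DERIV_sin)
  have c: "C1 c (\<lambda>i x. - s x * (\<mu> * \<eta> i))" unfolding s_def c_def
    by (rule C1_compose[OF th, of cos "\<lambda>x. - sin x"]) (auto intro!: continuous_intros DERIV_cos)
  have sc: "(s x)\<^sup>2 + (c x)\<^sup>2 = 1" for x by (simp add: s_def c_def)
  have sb: "\<bar>s x\<bar> \<le> 1" "\<bar>c x\<bar> \<le> 1" for x by (simp_all add: s_def c_def)
  define v1 where "v1 = (\<lambda>x. v x + 2 * m * (a x * s x))"
  define g1 where "g1 = (\<lambda>i x. g i x + (2 * m * a' i x * s x + 2 * a x * c x * \<eta> i))"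
  define H1 where "H1 = (\<lambda>i j x. H i j x + (2 * m * a'' i j x * s x + 2 * a' i x * c x * \<eta> j
      + 2 * a' j x * c x * \<eta> i - 2 * \<mu> * a x * s x * \<eta> i * \<eta> j))"
  \<comment> \<open>The first correction cancels the cross terms between the oscillation of
    \<open>v1\<close> and the old gradient, at the price of differentiating \<open>g\<close>. The
    second is the companion profile, since \<open>s * c\<close> is half the sine of the doubled
    phase.\<close>
  define w1 where "w1 = (\<lambda>i x. w i x - 2 * m * ((a x * s x) * g i x) - (\<eta> i * m) * ((a x * a x) * (s x * c x)))"
  define W1 where "W1 = (\<lambda>i j x. W i j x
      - ((2 * m * a' j x * s x + 2 * a x * c x * \<eta> j) * g i x + 2 * m * a x * s x * H i j x)
      - \<eta> i * (m * a x * a' j x * (2 * s x * c x) + (a x)\<^sup>2 * ((c x)\<^sup>2 - (s x)\<^sup>2) * \<eta> j))"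
  have m': "m * (\<mu> * r) = r" "m * (r * \<mu>) = r" for r using m(3) by (metis mult.assoc mult.commute mult_1)+
  have m'': "\<mu> = 1 / m" using m by (simp add: field_simps)
  have 1: "C1 v1 g1"
    by (rule C1_cong[OF C1_add[OF v C1_cmult[OF C1_mult[OF a(1) s], of "2*m"]]])
      (use m in \<open>auto simp: v1_def g1_def m'' field_simps\<close>)
  have "C1 (g1 i) (H1 i)" for i
    by (rule C1_cong[OF C1_add[OF g[of i] C1_add[OF C1_cmult[OF C1_mult[OF a(2)[of i] s], of "2*m"]
          C1_cmult[OF C1_mult[OF a(1) c], of "2 * \<eta> i"]]]])
      (use m in \<open>auto simp: H1_def g1_def m'' field_simps\<close>)
  moreover have "C1 (w1 i) (W1 i)" for i
    by (rule C1_cong[OF C1_diff[OF C1_diff[OF w[of i] C1_cmult[OF C1_mult[OF C1_mult[OF a(1) s] g[of i]], of "2*m"]]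
          C1_cmult[OF C1_mult[OF C1_mult[OF a(1) a(1)] C1_mult[OF s c]], of "\<eta> i * m"]]])
      (use m in \<open>auto simp: w1_def W1_def m'' field_simps power2_eq_square\<close>)
  ultimately have St1: "St v1 g1 H1 w1 W1" using 1 St_def by auto
  have B: "\<bar>p * q\<bar> \<le> P * Q" if "\<bar>p\<bar> \<le> P" "\<bar>q\<bar> \<le> Q" for p q P Q :: real
    unfolding abs_mult using that by (intro mult_mono) auto
  have m2: "m\<^sup>2 \<le> m" using m by (simp add: power2_eq_square mult_left_le)
  have am: "\<bar>m\<bar> \<le> 1" "\<bar>m\<bar> \<le> m" "\<bar>\<mu>\<bar> \<le> \<mu>" using m \<mu> by auto
  show ?thesis
  proof (intro exI conjI allI, rule St1)
    fix i j x
    have "\<bar>m * (a x * s x)\<bar> \<le> 1 * (K * 1)" by (intro B am K sb)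
    then show "\<bar>v1 x - v x\<bar> \<le> 2 * K" by (auto simp: v1_def)
    have t1: "\<bar>m * (a' i x * s x)\<bar> \<le> 1 * (K * 1)" by (intro B am K sb)
    have t2: "\<bar>a x * c x * \<eta> i\<bar> \<le> K * 1 * 2" by (intro B K sb \<eta>)
    show "\<bar>g1 i x - g i x\<bar> \<le> 6 * K" unfolding g1_def using t1 t2 by (simp add: mult.assoc)
    have u1: "\<bar>m * (a'' i j x * s x)\<bar> \<le> 1 * (K * 1)" by (intro B am K sb)
    have u2: "\<bar>a' i x * c x * \<eta> j\<bar> \<le> K * 1 * 2" by (intro B K sb \<eta>)
    have u3: "\<bar>a' j x * c x * \<eta> i\<bar> \<le> K * 1 * 2" by (intro B K sb \<eta>)
    have u4: "\<bar>\<mu> * a x * s x * \<eta> i * \<eta> j\<bar> \<le> \<mu> * K * 1 * 2 * 2" by (intro B K sb \<eta> am)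
    have K\<mu>: "K \<le> K * \<mu>" using K0 \<mu> by (simp add: mult_le_cancel_left1)
    have "\<bar>H1 i j x\<bar> = \<bar>H i j x + (2 * (m * (a'' i j x * s x)) + 2 * (a' i x * c x * \<eta> j)
      + 2 * (a' j x * c x * \<eta> i) - 2 * (\<mu> * a x * s x * \<eta> i * \<eta> j))\<bar>"
      unfolding H1_def by (simp add: algebra_simps)
    also have "\<dots> \<le> P + 18 * (K * \<mu>)" using u1 u2 u3 u4 K\<mu> P[of i j x] by (simp add: mult.commute[of \<mu> K])
    finally show "\<bar>H1 i j x\<bar> \<le> P + 18 * K * \<mu>" by simp
    have "metric_form g1 W1 i j x - metric_form g W i j x - (a x)\<^sup>2 * \<eta> i * \<eta> j = 
      - (m * a x * s x * (H i j x + H j i x)) + 2 * m\<^sup>2 * (s x)\<^sup>2 * a' i x * a' j x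
        + m * a x * (s x * c x) * (a' i x * \<eta> j + a' j x * \<eta> i)"
      using corrugation_identity[OF sc, of "g i x" m "a' i x" x "a x" "\<eta> i" "g j x" "a' j x" "\<eta> j" "W i j x" "H i j x" "W j i x" "H j i x"]
      unfolding metric_form_def g1_def W1_def by simp
    also have "\<bar>\<dots>\<bar> \<le> m * K * 1 * (P + P) + m * (K * K * 2) + m * K * (1 * 1) * (K + K)"
    proof -
      have "\<bar>H i j x + H j i x\<bar> \<le> P + P" using P[of i j x] P[of j i x] by linarith
      then have dir1: "\<bar>m * a x * s x * (H i j x + H j i x)\<bar> \<le> m * K * 1 * (P + P)" by (intro B am K sb)
      have "\<bar>m\<^sup>2 * ((s x)\<^sup>2 * (a' i x * a' j x))\<bar> \<le> m * (1 * (K * K))"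
        by (intro B K) (use m2 sb[of x] in \<open>auto simp: abs_square_le_1\<close>)
      then have dir2: "\<bar>2 * m\<^sup>2 * (s x)\<^sup>2 * a' i x * a' j x\<bar> \<le> m * (K * K * 2)" by (simp add: mult.assoc abs_mult)
      \<comment> \<open>The factor one half brings the last error term down to
        \<open>2 * m * K\<^sup>2\<close>, which together with the middle one gives
        \<open>4 * K\<^sup>2 / \<mu>\<close>.\<close>
      have "\<bar>s x * c x\<bar> \<le> 1/2" using sum_squares_bound[of "s x" "c x"] sum_squares_bound[of "- s x" "c x"] sc[of x] by auto
      moreover have "\<bar>a' i x * \<eta> j\<bar> \<le> K * 2" "\<bar>a' j x * \<eta> i\<bar> \<le> K * 2" by (intro B K \<eta>)+
      then have "\<bar>a' i x * \<eta> j + a' j x * \<eta> i\<bar> \<le> 4 * K" by linarith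
      ultimately have "\<bar>m * a x * (s x * c x) * (a' i x * \<eta> j + a' j x * \<eta> i)\<bar> \<le> m * K * (1/2) * (4 * K)"
        by (intro B am K)
      also have "\<dots> = m * K * (1 * 1) * (K + K)" by simp
      finally have dir3: "\<bar>m * a x * (s x * c x) * (a' i x * \<eta> j + a' j x * \<eta> i)\<bar> \<le> m * K * (1 * 1) * (K + K)" .
      have "\<bar>- p + q + t\<bar> \<le> \<bar>p\<bar> + \<bar>q\<bar> + \<bar>t\<bar>" for p q t :: real by simp
      from order_trans[OF this add_mono[OF add_mono[OF dir1 dir2] dir3]] show ?thesis .
    qed
    also have "\<dots> = (2 * K * P + 4 * K\<^sup>2) / \<mu>" by (simp add: m_def add_divide_distrib power2_eq_square algebra_simps)
    finally show "\<bar>metric_form g1 W1 i j x - metric_form g W i j x - (a x)\<^sup>2 * \<eta> i * \<eta> j\<bar> \<le> (2 * K * P + 4 * K\<^sup>2) / \<mu>" .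
  qed
qed

section \<open>A stage at unit scale\<close>

definition kronecker :: "2 \<Rightarrow> 2 \<Rightarrow> real" where "kronecker i j = (if i = j then 1 else 0)"

lemma C1_box_avg2_bound:
  assumes "C1 u u'" "\<And>i x. \<bar>u' i x\<bar> \<le> M"
  shows "\<And>y. y \<in> fwd_box 2 x \<Longrightarrow> \<bar>u y - u x\<bar> \<le> 4 * M" and "\<bar>box_avg2 u x - u x\<bar> \<le> 4 * M"
proof -
  show 1: "\<bar>u y - u x\<bar> \<le> 4 * M" if "y \<in> fwd_box 2 x" for y
  proof -
    have M: "M \<ge> 0" using assms(2)[of 1 0] by simp
    have "\<bar>y$1 - x$1\<bar> + \<bar>y$2 - x$2\<bar> \<le> 4" using that unfolding fwd_box_def by (auto simp: forall_2)
    with C1_lipschitz[OF assms, where y=y and x=x] mult_left_mono[OF this M] show ?thesis by simp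
  qed
  show "\<bar>box_avg2 u x - u x\<bar> \<le> 4 * M" by (rule box_avg2_bound[OF C1_cont[OF assms(1)] 1])
qed

text \<open>The squares \<open>\<eta> \<otimes> \<eta>\<close> of these vectors are a basis of the
  symmetric matrices in which the identity has the positive coefficients 3/4, 1/8, 1/8. Matrices
  close to the identity therefore have positive coefficients, and their roots can serve as
  amplitudes.\<close>

definition dir1 :: "2 \<Rightarrow> real" where "dir1 i = (if i = 1 then 1 else 0)"
definition dir2 :: "2 \<Rightarrow> real" where "dir2 i = (if i = 1 then 1 else 2)"
definition dir3 :: "2 \<Rightarrow> real" where "dir3 i = (if i = 1 then 1 else - 2)"

lemma decomposition:
  fixes D :: "2 \<Rightarrow> 2 \<Rightarrow> real"
  assumes "D 1 2 = D 2 1"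
  shows "(D 1 1 - D 2 2 / 4) * dir1 i * dir1 j + (D 2 2 / 8 + D 1 2 / 4) * dir2 i * dir2 j
      + (D 2 2 / 8 - D 1 2 / 4) * dir3 i * dir3 j = D i j"
  using exhaust_2[of i] exhaust_2[of j] assms by (auto simp: dir1_def dir2_def dir3_def)

lemma corrugation_obtain:
  assumes "\<exists>v1 g1 H1 w1 W1. St v1 g1 H1 w1 W1 \<and> (\<forall>x. P v1 x) \<and> (\<forall>i x. R g1 i x) \<and>
     (\<forall>i j x. S H1 i j x) \<and> (\<forall>i j x. U g1 W1 i j x)"
  obtains v1 g1 H1 w1 W1 where "St v1 g1 H1 w1 W1" "\<And>x. P v1 x" "\<And>i x. R g1 i x" "\<And>i j x. S H1 i j x" "\<And>i j x. U g1 W1 i j x"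
  using assms by blast

text \<open>The frequencies are \<open>L\<close>, \<open>L ^ 2\<close>, \<open>L ^ 3\<close>. The
  corrugations meet Hessians of order \<open>1\<close>, \<open>K * L\<close> and
  \<open>K * L ^ 2\<close>, so that each of the three errors is of order
  \<open>K\<^sup>2 / L\<close>; the constants add up as \<open>6 + 42 + 78 = 126\<close>.\<close>

lemma three_corrugations:
  assumes St: "St v g H w W" and H: "\<And>i j x. \<bar>H i j x\<bar> \<le> 1"
    and cont: "\<And>x. jet a1 x K" "\<And>x. jet a2 x K" "\<And>x. jet a3 x K" and K: "K \<ge> 1" and L: "L \<ge> 1"
  shows "\<exists>v1 g1 H1 w1 W1. St v1 g1 H1 w1 W1 \<and> (\<forall>x. \<bar>v1 x - v x\<bar> \<le> 6 * K) \<and>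
     (\<forall>i x. \<bar>g1 i x - g i x\<bar> \<le> 18 * K) \<and> (\<forall>i j x. \<bar>H1 i j x\<bar> \<le> 55 * K * L ^ 3) \<and>
     (\<forall>i j x. \<bar>metric_form g1 W1 i j x - metric_form g W i j x 
        - ((a1 x)\<^sup>2 * dir1 i * dir1 j + (a2 x)\<^sup>2 * dir2 i * dir2 j + (a3 x)\<^sup>2 * dir3 i * dir3 j)\<bar> \<le> 126 * K\<^sup>2 / L)"
proof -
  have ee: "\<And>i. \<bar>dir1 i\<bar> \<le> 2" "\<And>i. \<bar>dir2 i\<bar> \<le> 2" "\<And>i. \<bar>dir3 i\<bar> \<le> 2" by (auto simp: dir1_def dir2_def dir3_def)
  have L2: "L \<le> L^2" "L^2 \<le> L^3" "1 \<le> L^2" "1 \<le> L^3"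
    using L power_increasing[of 1 2 L] power_increasing[of 2 3 L] by (auto intro: one_le_power)
  obtain b1 c1 where a1: "C1 a1 b1" "\<And>i. C1 (b1 i) (c1 i)" "\<And>x. \<bar>a1 x\<bar> \<le> K" "\<And>i x. \<bar>b1 i x\<bar> \<le> K"
    "\<And>i j x. \<bar>c1 i j x\<bar> \<le> K" by (rule jet_all[OF cont(1)]) (rule that)
  obtain b2 c2 where a2: "C1 a2 b2" "\<And>i. C1 (b2 i) (c2 i)" "\<And>x. \<bar>a2 x\<bar> \<le> K" "\<And>i x. \<bar>b2 i x\<bar> \<le> K"
    "\<And>i j x. \<bar>c2 i j x\<bar> \<le> K" by (rule jet_all[OF cont(2)]) (rule that)
  obtain b3 c3 where a3: "C1 a3 b3" "\<And>i. C1 (b3 i) (c3 i)" "\<And>x. \<bar>a3 x\<bar> \<le> K" "\<And>i x. \<bar>b3 i x\<bar> \<le> K"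
    "\<And>i j x. \<bar>c3 i j x\<bar> \<le> K" by (rule jet_all[OF cont(3)]) (rule that)
  obtain v1 g1 H1 w1 W1 where s1: "St v1 g1 H1 w1 W1" "\<And>x. \<bar>v1 x - v x\<bar> \<le> 2 * K"
    "\<And>i x. \<bar>g1 i x - g i x\<bar> \<le> 6 * K" "\<And>i j x. \<bar>H1 i j x\<bar> \<le> 1 + 18 * K * L"
    "\<And>i j x. \<bar>metric_form g1 W1 i j x - metric_form g W i j x - (a1 x)\<^sup>2 * dir1 i * dir1 j\<bar> \<le> (2 * K * 1 + 4 * K\<^sup>2) / L"
    by (rule corrugation_obtain[OF corrugation[OF St a1 H ee(1) L]]) (rule that)
  have "1 * 1 \<le> K * L" using K L by (intro mult_mono) auto
  then have "1 + 18 * K * L \<le> 19 * K * L" by simp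
  then have H1: "\<bar>H1 i j x\<bar> \<le> 19 * K * L" for i j x using s1(4)[of i j x] by linarith
  obtain v2 g2 H2 w2 W2 where s2: "St v2 g2 H2 w2 W2" "\<And>x. \<bar>v2 x - v1 x\<bar> \<le> 2 * K"
    "\<And>i x. \<bar>g2 i x - g1 i x\<bar> \<le> 6 * K" "\<And>i j x. \<bar>H2 i j x\<bar> \<le> 19 * K * L + 18 * K * L^2"
    "\<And>i j x. \<bar>metric_form g2 W2 i j x - metric_form g1 W1 i j x - (a2 x)\<^sup>2 * dir2 i * dir2 j\<bar> \<le> (2 * K * (19 * K * L) + 4 * K\<^sup>2) / L^2"
    by (rule corrugation_obtain[OF corrugation[OF s1(1) a2 H1 ee(2) L2(3)]]) (rule that)
  have "K * L \<le> K * L^2" using K L2 by (intro mult_left_mono) auto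
  then have H2: "\<bar>H2 i j x\<bar> \<le> 37 * K * L^2" for i j x using s2(4)[of i j x] by linarith
  obtain v3 g3 H3 w3 W3 where s3: "St v3 g3 H3 w3 W3" "\<And>x. \<bar>v3 x - v2 x\<bar> \<le> 2 * K"
    "\<And>i x. \<bar>g3 i x - g2 i x\<bar> \<le> 6 * K" "\<And>i j x. \<bar>H3 i j x\<bar> \<le> 37 * K * L^2 + 18 * K * L^3"
    "\<And>i j x. \<bar>metric_form g3 W3 i j x - metric_form g2 W2 i j x - (a3 x)\<^sup>2 * dir3 i * dir3 j\<bar> \<le> (2 * K * (37 * K * L^2) + 4 * K\<^sup>2) / L^3"
    by (rule corrugation_obtain[OF corrugation[OF s2(1) a3 H2 ee(3) L2(4)]]) (rule that)
  have "K * L^2 \<le> K * L^3" using K L2 by (intro mult_left_mono) auto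
  then have H3: "\<bar>H3 i j x\<bar> \<le> 55 * K * L^3" for i j x using s3(4)[of i j x] by linarith
  have K2: "K \<le> K\<^sup>2" using K by (simp add: power2_eq_square)
  have E1: "(2 * K * 1 + 4 * K\<^sup>2) / L \<le> 6 * K\<^sup>2 / L"
    using L K2 by (intro divide_right_mono) auto
  have E2: "(2 * K * (19 * K * L) + 4 * K\<^sup>2) / L^2 \<le> 42 * K\<^sup>2 / L"
  proof -
    have "(2 * K * (19 * K * L) + 4 * K\<^sup>2) / L^2 \<le> (42 * K\<^sup>2 * L) / L^2"
      using L mult_left_mono[OF L, of "K * K"] by (intro divide_right_mono) (auto simp: power2_eq_square algebra_simps)
    also have "\<dots> = 42 * K\<^sup>2 / L" using L by (simp add: power2_eq_square)
    finally show ?thesis .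
  qed
  have E3: "(2 * K * (37 * K * L^2) + 4 * K\<^sup>2) / L^3 \<le> 78 * K\<^sup>2 / L"
  proof -
    have "K\<^sup>2 * 1 \<le> K\<^sup>2 * L\<^sup>2" using L2 by (intro mult_left_mono) auto
    then have "2 * K * (37 * K * L^2) + 4 * K\<^sup>2 \<le> 78 * K\<^sup>2 * L^2"
      by (simp add: power2_eq_square algebra_simps)
    then have "(2 * K * (37 * K * L^2) + 4 * K\<^sup>2) / L^3 \<le> (78 * K\<^sup>2 * L^2) / L^3"
      using L by (intro divide_right_mono) auto
    also have "\<dots> = 78 * K\<^sup>2 / L" using L by (simp add: power2_eq_square power3_eq_cube)
    finally show ?thesis .
  qed
  show ?thesis
  proof (intro exI conjI allI, rule s3(1))
    fix i j x
    show "\<bar>v3 x - v x\<bar> \<le> 6 * K" using s1(2)[of x] s2(2)[of x] s3(2)[of x] by linarith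
    show "\<bar>g3 i x - g i x\<bar> \<le> 18 * K" using s1(3)[of i x] s2(3)[of i x] s3(3)[of i x] by linarith
    show "\<bar>H3 i j x\<bar> \<le> 55 * K * L^3" by (rule H3)
    have "126 * K\<^sup>2 / L = 6 * K\<^sup>2 / L + 42 * K\<^sup>2 / L + 78 * K\<^sup>2 / L" by (simp add: add_divide_distrib[symmetric])
    then show "\<bar>metric_form g3 W3 i j x - metric_form g W i j x 
        - ((a1 x)\<^sup>2 * dir1 i * dir1 j + (a2 x)\<^sup>2 * dir2 i * dir2 j + (a3 x)\<^sup>2 * dir3 i * dir3 j)\<bar> \<le> 126 * K\<^sup>2 / L"
      using s1(5)[of i j x] s2(5)[of i j x] s3(5)[of i j x] E1 E2 E3 by linarith
  qed
qed

text \<open>The averages of \<open>v\<close> and \<open>w\<close> are perturbed, so the mollification error of the quadratic term is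
  absorbed in the defect that the corrugations cancel; it does not have to be of the size of the
  next defect. No bound on \<open>w\<close> is needed or claimed.\<close>

definition unit_stage_constant :: "real \<Rightarrow> bool" where
  "unit_stage_constant C \<longleftrightarrow> (\<forall>r\<ge>24. \<forall>A v g H w W. St v g H w W \<longrightarrow> (\<forall>i j. continuous_on UNIV (A i j)) \<longrightarrow>
    (\<forall>x. A 1 2 x = A 2 1 x) \<longrightarrow> (\<forall>i j x. \<bar>H i j x\<bar> \<le> 1/200) \<longrightarrow>
    (\<forall>i j x. \<bar>A i j x - metric_form g W i j x - kronecker i j\<bar> \<le> 1/24) \<longrightarrow>
    (\<forall>i j x. \<forall>y \<in> fwd_box 2 x. \<bar>A i j y - A i j x\<bar> \<le> 1/(48*r)) \<longrightarrow>
    (\<exists>v1 g1 H1 w1 W1. St v1 g1 H1 w1 W1 \<and> (\<forall>G. (\<forall>i x. \<bar>g i x\<bar> \<le> G) \<longrightarrow> (\<forall>x. \<bar>v1 x - v x\<bar> \<le> C + 4 * G)) \<and>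
      (\<forall>i x. \<bar>g1 i x - g i x\<bar> \<le> C) \<and> (\<forall>i j x. \<bar>H1 i j x\<bar> \<le> C * r ^ 3) \<and>
      (\<forall>i j x. \<bar>A i j x - metric_form g1 W1 i j x - kronecker i j / r\<bar> \<le> 1/(24*r))))"

text \<open>A Hessian of at most \<open>1 / 200\<close> means that the gradient is almost constant
  on an averaging square. Averaging \<open>v\<close> and \<open>w\<close> then changes the metric
  form, compared with the average of the old one, by a small commutator only, and the metric to be
  added stays close to the identity.\<close>

lemma unit_stage: "\<exists>C\<ge>1. unit_stage_constant C"
proof -
  \<comment> \<open>The value \<open>18 * 20\<^sup>2\<close> that \<open>jet_sqrt\<close> returns
    for coefficients with jets bounded by 20.\<close>
  define K :: real where "K = 7200"
  \<comment> \<open>Makes the corrugation error \<open>126 * K\<^sup>2 / (\<Lambda> * r)\<close>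
    equal to \<open>1 / (48 * r)\<close>, half of the final tolerance; the other half is reserved
    for the oscillation of \<open>A\<close>.\<close>
  define \<Lambda> where "\<Lambda> = 6048 * K\<^sup>2"
  have \<Lambda>: "\<Lambda> \<ge> 1" by (simp add: \<Lambda>_def K_def)
  define C where "C = 55 * K * \<Lambda> ^ 3"
  have C: "C \<ge> 19 * K" 
  proof -
    have "1 \<le> \<Lambda> ^ 3" using \<Lambda> by (rule one_le_power)
    then show ?thesis unfolding C_def by (simp add: K_def)
  qed
  show ?thesis unfolding unit_stage_constant_def
  proof (intro exI[of _ C] conjI allI impI)
    show "1 \<le> C" using C by (simp add: K_def)
    fix r :: real and A v g H w W
    assume r: "24 \<le> r" and St: "St v g H w W" and A: "\<forall>i j. continuous_on UNIV (A i j)"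
      and sym: "\<forall>x. A 1 2 x = A 2 1 x" and H: "\<forall>i j x. \<bar>H i j x\<bar> \<le> 1/200"
      and D0: "\<forall>i j x. \<bar>A i j x - metric_form g W i j x - kronecker i j\<bar> \<le> 1/24"
      and AQ: "\<forall>i j x. \<forall>y \<in> fwd_box 2 x. \<bar>A i j y - A i j x\<bar> \<le> 1/(48*r)"
    have v: "C1 v g" and g: "\<And>i. C1 (g i) (H i)" and w: "\<And>i. C1 (w i) (W i)" using St St_def by auto
    have cg: "continuous_on UNIV (g i)" and cW: "continuous_on UNIV (W i j)" and cA: "continuous_on UNIV (A i j)"
      and cH: "continuous_on UNIV (H i j)" for i j
      using C1_cont[OF g] C1_cont'[OF w] A C1_cont'[OF g] by blast+
    define D where "D = (\<lambda>i j x. A i j x - metric_form g W i j x)"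
    have cSG: "continuous_on UNIV (metric_form g W i j)" for i j
      unfolding metric_form_def[abs_def] by (intro continuous_intros cg cW) auto
    have cD: "continuous_on UNIV (D i j)" for i j unfolding D_def by (intro continuous_intros cA cSG)
    define cm where "cm = (\<lambda>i j z. box_avg2 (\<lambda>x. g i x * g j x) z - box_avg2 (g i) z * box_avg2 (g j) z)"
    \<comment> \<open>The metric that the corrugations have to produce: the averaged defect, plus
      half the commutator caused by averaging a quadratic term, minus the part
      \<open>kronecker i j / r\<close> that is left over as the next defect.\<close>
    define Dt where "Dt = (\<lambda>i j x. box_avg2 (D i j) x + (1/2) * cm i j x - kronecker i j / r)"
    have St0: "St (box_avg2 v) (\<lambda>i. box_avg2 (g i)) (\<lambda>i j. box_avg2 (H i j)) (\<lambda>i. box_avg2 (w i)) (\<lambda>i j. box_avg2 (W i j))"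
      unfolding St_def by (intro conjI allI box_avg2_C1[OF v] box_avg2_C1[OF g] box_avg2_C1[OF w])
    have H0: "\<bar>box_avg2 (H i j) x\<bar> \<le> 1" for i j x
    proof -
      have "\<bar>H i j y - 0\<bar> \<le> 1" for y using H[rule_format, of i j y] by simp
      from box_avg2_bound[OF cH this] show ?thesis by simp
    qed
    \<comment> \<open>The origin of the constant \<open>1 / 200\<close>: on a square of side 2 the
      gradient oscillates by at most \<open>4 / 200\<close>, and
      \<open>68 * (1 / 50)\<^sup>2\<close> is below \<open>1 / 24\<close>.\<close>
    have jcm: "jet (cm i j) x (1/24)" for i j x
    proof -
      have gb: "\<bar>g k y - g k x\<bar> \<le> 1/50" if "y \<in> fwd_box 2 x" for k y
        using C1_box_avg2_bound(1)[OF g, of k "1/200" y x] H that by auto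
      have "jet (cm i j) x (68 * (1/50)\<^sup>2)"
        unfolding cm_def by (rule jet_comm[OF cg cg gb gb])
      then show ?thesis by (rule jet_mono) (simp add: power2_eq_square)
    qed
    \<comment> \<open>Averaging commutes with differentiation, so the metric form of the averaged
      fields differs from the averaged metric form only through the product of gradients, and
      \<open>Dt\<close> contains exactly this difference.\<close>
    have SGTT: "metric_form (\<lambda>i. box_avg2 (g i)) (\<lambda>i j. box_avg2 (W i j)) i j x + Dt i j x = box_avg2 (A i j) x - kronecker i j / r" for i j x
    proof -
      have e: "A i j = (\<lambda>x. D i j x + (1/2) * (g i x * g j x + (W i j x + W j i x)))"
        by (rule ext, simp add: D_def metric_form_def field_simps)
      have cgg: "continuous_on UNIV (\<lambda>x. g i x * g j x)" by (intro continuous_intros cg)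
      note c = continuous_on_add[OF cgg continuous_on_add[OF cW[of i j] cW[of j i]]]
      have "box_avg (A i j) = (\<lambda>x. box_avg (D i j) x + (1/2) * (box_avg (\<lambda>x. g i x * g j x) x + (box_avg (W i j) x + box_avg (W j i) x)))"
        unfolding e box_avg_add[OF cD continuous_on_mult[OF continuous_on_const c]] box_avg_cmult
          box_avg_add[OF cgg continuous_on_add[OF cW cW]] box_avg_add[OF cW cW] ..
      moreover note c' = continuous_on_add[OF box_avg_cont[OF cgg] continuous_on_add[OF box_avg_cont[OF cW[of i j]] box_avg_cont[OF cW[of j i]]]]
      have "box_avg (\<lambda>x. box_avg (D i j) x + (1/2) * (box_avg (\<lambda>x. g i x * g j x) x + (box_avg (W i j) x + box_avg (W j i) x))) =
        (\<lambda>x. box_avg2 (D i j) x + (1/2) * (box_avg2 (\<lambda>x. g i x * g j x) x + (box_avg2 (W i j) x + box_avg2 (W j i) x)))"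
        unfolding box_avg_add[OF box_avg_cont[OF cD] continuous_on_mult[OF continuous_on_const c']] box_avg_cmult
          box_avg_add[OF box_avg_cont[OF cgg] continuous_on_add[OF box_avg_cont[OF cW] box_avg_cont[OF cW]]] box_avg_add[OF box_avg_cont[OF cW] box_avg_cont[OF cW]] ..
      ultimately have "box_avg2 (A i j) x = box_avg2 (D i j) x + (1/2) * (box_avg2 (\<lambda>x. g i x * g j x) x + (box_avg2 (W i j) x + box_avg2 (W j i) x))"
        by simp
      then show ?thesis unfolding Dt_def metric_form_def cm_def by (simp add: field_simps)
    qed
    \<comment> \<open>Averaged defect, commutator and \<open>kronecker i j / r\<close> contribute at
      most \<open>1 / 24\<close> each, the last one because of \<open>24 \<le> r\<close>. A distance
      of \<open>1 / 8\<close> from the identity in turn keeps all three coefficients above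
      \<open>1 / 16\<close>.\<close>
    have Dt_near: "\<bar>Dt i j x - kronecker i j\<bar> \<le> 1/8" for i j x
    proof -
      have "\<bar>box_avg2 (D i j) x - kronecker i j\<bar> \<le> 1/24" by (rule box_avg2_bound[OF cD]) (use D0 in \<open>simp add: D_def\<close>)
      moreover have "\<bar>cm i j x\<bar> \<le> 1/24" using jcm[of i j x] unfolding jet_def by auto
      moreover have "\<bar>kronecker i j / r\<bar> \<le> 1/24" using r by (auto simp: kronecker_def field_simps)
      ultimately show ?thesis unfolding Dt_def by linarith
    qed
    have jDt: "jet (Dt i j) x 10" for i j x
    proof -
      have "\<bar>D i j y\<bar> \<le> 2" for y
      proof -
        have "\<bar>kronecker i j\<bar> \<le> 1" by (simp add: kronecker_def)
        then show ?thesis using D0[rule_format, of i j y] unfolding D_def by linarith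
      qed
      then have "jet (Dt i j) x (4 * 2 + \<bar>1/2\<bar> * (1/24) + \<bar>kronecker i j / r\<bar>)"
        unfolding Dt_def by (intro jet_diff jet_add jet_box_avg2 jet_cmult jet_const jcm cD)
      moreover have "\<bar>kronecker i j / r\<bar> \<le> 1" using r by (auto simp: kronecker_def field_simps)
      ultimately show ?thesis by (elim jet_mono) simp
    qed
    have symDt: "Dt 1 2 x = Dt 2 1 x" for x
    proof -
      have "D 1 2 = D 2 1" using sym by (simp add: D_def metric_form_def mult.commute add.commute)
      moreover have "cm 1 2 = cm 2 1" by (simp add: cm_def mult.commute)
      ultimately show ?thesis by (simp add: Dt_def kronecker_def)
    qed
    define c1 where "c1 = (\<lambda>x. Dt 1 1 x - (1/4) * Dt 2 2 x)"
    define c2 where "c2 = (\<lambda>x. (1/8) * Dt 2 2 x + (1/4) * Dt 1 2 x)"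
    define c3 where "c3 = (\<lambda>x. (1/8) * Dt 2 2 x - (1/4) * Dt 1 2 x)"
    have jc1: "jet c1 x 20" for x unfolding c1_def
      by (rule jet_mono[OF jet_diff[OF jDt jet_cmult[OF jDt]]]) simp
    have jc2: "jet c2 x 20" for x unfolding c2_def
      by (rule jet_mono[OF jet_add[OF jet_cmult[OF jDt] jet_cmult[OF jDt]]]) simp
    have jc3: "jet c3 x 20" for x unfolding c3_def
      by (rule jet_mono[OF jet_diff[OF jet_cmult[OF jDt] jet_cmult[OF jDt]]]) simp
    have pos: "c1 x \<ge> 1/16" "c2 x \<ge> 1/16" "c3 x \<ge> 1/16" for x
    proof -
      have "- (1/8) \<le> Dt 1 1 x - 1" "Dt 2 2 x - 1 \<le> 1/8" "- (1/8) \<le> Dt 2 2 x - 1"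
        "Dt 1 2 x \<le> 1/8" "- (1/8) \<le> Dt 1 2 x"
        using Dt_near[of 1 1 x] Dt_near[of 2 2 x] Dt_near[of 1 2 x] by (simp_all only: kronecker_def abs_le_iff) auto
      then show "c1 x \<ge> 1/16" "c2 x \<ge> 1/16" "c3 x \<ge> 1/16"
        unfolding c1_def c2_def c3_def by linarith+
    qed
    have ja: "jet (\<lambda>y. sqrt (c1 y)) x K" "jet (\<lambda>y. sqrt (c2 y)) x K" "jet (\<lambda>y. sqrt (c3 y)) x K" for x
      using jet_sqrt[OF jc1 pos(1)] jet_sqrt[OF jc2 pos(2)] jet_sqrt[OF jc3 pos(3)] by (simp_all add: K_def)
    have L: "\<Lambda> * r \<ge> 1" "K \<ge> 1" using mult_mono[of 1 \<Lambda> 1 r] \<Lambda> r by (auto simp: K_def)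
    obtain v1 g1 H1 w1 W1 where s: "St v1 g1 H1 w1 W1" "\<And>x. \<bar>v1 x - box_avg2 v x\<bar> \<le> 6 * K"
      "\<And>i x. \<bar>g1 i x - box_avg2 (g i) x\<bar> \<le> 18 * K" "\<And>i j x. \<bar>H1 i j x\<bar> \<le> 55 * K * (\<Lambda> * r) ^ 3"
      "\<And>i j x. \<bar>metric_form g1 W1 i j x - metric_form (\<lambda>i. box_avg2 (g i)) (\<lambda>i j. box_avg2 (W i j)) i j x 
        - ((sqrt (c1 x))\<^sup>2 * dir1 i * dir1 j + (sqrt (c2 x))\<^sup>2 * dir2 i * dir2 j + (sqrt (c3 x))\<^sup>2 * dir3 i * dir3 j)\<bar> \<le> 126 * K\<^sup>2 / (\<Lambda> * r)"
      by (rule corrugation_obtain[OF three_corrugations[OF St0 H0 ja L(2,1)]]) (rule that)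
    have dec: "(sqrt (c1 x))\<^sup>2 * dir1 i * dir1 j + (sqrt (c2 x))\<^sup>2 * dir2 i * dir2 j + (sqrt (c3 x))\<^sup>2 * dir3 i * dir3 j = Dt i j x" for i j x
    proof -
      have "0 \<le> c1 x" "0 \<le> c2 x" "0 \<le> c3 x" using pos[of x] by auto
      then have "(sqrt (c1 x))\<^sup>2 = c1 x" "(sqrt (c2 x))\<^sup>2 = c2 x" "(sqrt (c3 x))\<^sup>2 = c3 x" by simp_all
      then show ?thesis using decomposition[of "\<lambda>i j. Dt i j x" i j] symDt[of x] by (simp add: c1_def c2_def c3_def)
    qed
    show "\<exists>v1 g1 H1 w1 W1. St v1 g1 H1 w1 W1 \<and> (\<forall>G. (\<forall>i x. \<bar>g i x\<bar> \<le> G) \<longrightarrow> (\<forall>x. \<bar>v1 x - v x\<bar> \<le> C + 4 * G)) \<and>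
      (\<forall>i x. \<bar>g1 i x - g i x\<bar> \<le> C) \<and> (\<forall>i j x. \<bar>H1 i j x\<bar> \<le> C * r ^ 3) \<and>
      (\<forall>i j x. \<bar>A i j x - metric_form g1 W1 i j x - kronecker i j / r\<bar> \<le> 1/(24*r))"
    proof (intro exI conjI allI impI, rule s(1))
      fix i j x
      show "\<bar>v1 x - v x\<bar> \<le> C + 4 * G" if "\<forall>i x. \<bar>g i x\<bar> \<le> G" for G
        using C1_box_avg2_bound(2)[OF v, of G x] that s(2)[of x] C by (simp add: K_def)
      show "\<bar>g1 i x - g i x\<bar> \<le> C"
      proof -
        have "\<bar>box_avg2 (g i) x - g i x\<bar> \<le> 4 * (1/200)" by (rule C1_box_avg2_bound(2)[OF g]) (use H in auto)
        then show ?thesis using s(3)[of i x] C L(2) by linarith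
      qed
      show "\<bar>H1 i j x\<bar> \<le> C * r^3" using s(4)[of i j x] by (simp add: C_def power_mult_distrib mult.assoc)
      have "126 * K\<^sup>2 / (\<Lambda> * r) = 1/(48*r)" by (simp add: \<Lambda>_def K_def)
      moreover have "\<bar>box_avg2 (A i j) x - A i j x\<bar> \<le> 1/(48*r)" by (rule box_avg2_bound[OF cA]) (use AQ in auto)
      moreover have "1/(24*r) = 1/(48*r) + 1/(48*r)" by simp
      ultimately show "\<bar>A i j x - metric_form g1 W1 i j x - kronecker i j / r\<bar> \<le> 1/(24*r)"
        using s(5)[of i j x] SGTT[of i j x] unfolding dec by linarith
    qed
  qed
qed

section \<open>Rescaling a stage to arbitrary defect and Hessian\<close>

lemma St_scale:
  assumes "St v g H w W" "l \<noteq> 0"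
  shows "St (\<lambda>x. (p / l) * v (l *\<^sub>R x)) (\<lambda>i x. p * g i (l *\<^sub>R x)) (\<lambda>i j x. (p * l) * H i j (l *\<^sub>R x))
            (\<lambda>i x. (p\<^sup>2 / l) * w i (l *\<^sub>R x)) (\<lambda>i j x. p\<^sup>2 * W i j (l *\<^sub>R x))"
proof -
  have v: "C1 v g" and g: "\<And>i. C1 (g i) (H i)" and w: "\<And>i. C1 (w i) (W i)" using assms St_def by auto
  have "C1 (\<lambda>x. (p / l) * v (l *\<^sub>R x)) (\<lambda>i x. p * g i (l *\<^sub>R x))"
    by (rule C1_cong[OF C1_cmult[OF C1_scaled[OF v, of l], of "p/l"]]) (use assms in auto)
  moreover have "C1 (\<lambda>x. p * g i (l *\<^sub>R x)) (\<lambda>j x. (p * l) * H i j (l *\<^sub>R x))" for i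
    by (rule C1_cong[OF C1_cmult[OF C1_scaled[OF g[of i], of l], of p]]) auto
  moreover have "C1 (\<lambda>x. (p\<^sup>2 / l) * w i (l *\<^sub>R x)) (\<lambda>j x. p\<^sup>2 * W i j (l *\<^sub>R x))" for i
    by (rule C1_cong[OF C1_cmult[OF C1_scaled[OF w[of i], of l], of "p\<^sup>2/l"]]) (use assms in auto)
  ultimately show ?thesis unfolding St_def by blast
qed

lemma metric_form_scale: "metric_form (\<lambda>i x. p * g i (l *\<^sub>R x)) (\<lambda>i j x. p\<^sup>2 * W i j (l *\<^sub>R x)) i j x = p\<^sup>2 * metric_form g W i j (l *\<^sub>R x)"
  unfolding metric_form_def by (simp add: power2_eq_square field_simps)

text \<open>Measuring lengths in units of \<open>s / (200 * M)\<close> and gradients in units of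
  \<open>s\<close> turns the Hessian bound \<open>M\<close> into \<open>1 / 200\<close>. The
  displacement of \<open>v\<close> keeps the length unit as a factor; since \<open>M\<close> is only
  an upper bound for the Hessian, a generous \<open>M\<close> makes the displacement as small as
  desired.\<close>

definition stage_constant :: "real \<Rightarrow> bool" where
  "stage_constant C \<longleftrightarrow> (\<forall>r\<ge>24. \<forall>s>0. \<forall>M>0. \<forall>A v g H w W. St v g H w W \<longrightarrow> (\<forall>i j. continuous_on UNIV (A i j)) \<longrightarrow>
    (\<forall>x. A 1 2 x = A 2 1 x) \<longrightarrow> (\<forall>i j x. \<bar>H i j x\<bar> \<le> M) \<longrightarrow>
    (\<forall>i j x. \<bar>A i j x - metric_form g W i j x - s\<^sup>2 * kronecker i j\<bar> \<le> s\<^sup>2/24) \<longrightarrow>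
    (\<forall>i j x. \<forall>y \<in> fwd_box (2 * (s / (200 * M))) x. \<bar>A i j y - A i j x\<bar> \<le> s\<^sup>2/(48*r)) \<longrightarrow>
    (\<exists>v1 g1 H1 w1 W1. St v1 g1 H1 w1 W1 \<and>
      (\<forall>x. \<forall>G. (\<forall>i x. \<bar>g i x\<bar> \<le> G) \<longrightarrow> \<bar>v1 x - v x\<bar> \<le> (s / (200 * M)) * (C * s + 4 * G)) \<and>
      (\<forall>i x. \<bar>g1 i x - g i x\<bar> \<le> C * s) \<and> (\<forall>i j x. \<bar>H1 i j x\<bar> \<le> 200 * C * r ^ 3 * M) \<and>
      (\<forall>i j x. \<bar>A i j x - metric_form g1 W1 i j x - s\<^sup>2 / r * kronecker i j\<bar> \<le> s\<^sup>2/(24*r))))"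

lemma stage: "\<exists>C\<ge>1. stage_constant C"
proof -
  obtain C where C: "C \<ge> 1" and "unit_stage_constant C" using unit_stage by blast
  note unit = this(2)[unfolded unit_stage_constant_def]
  show ?thesis unfolding stage_constant_def
  proof (intro exI[of _ C] conjI allI impI C)
    fix r s M :: real and A v g H w W
    assume r: "24 \<le> r" and s: "0 < s" and M: "0 < M" and St: "St v g H w W" 
      and A: "\<forall>i j. continuous_on UNIV (A i j)"
      and sym: "\<forall>x. A 1 2 x = A 2 1 x" and H: "\<forall>i j x. \<bar>H i j x\<bar> \<le> M"
      and D0: "\<forall>i j x. \<bar>A i j x - metric_form g W i j x - s\<^sup>2 * kronecker i j\<bar> \<le> s\<^sup>2/24"
      and AQ: "\<forall>i j x. \<forall>y \<in> fwd_box (2 * (s / (200 * M))) x. \<bar>A i j y - A i j x\<bar> \<le> s\<^sup>2/(48*r)"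
    define l where "l = s / (200 * M)"
    have l: "l > 0" using s M by (simp add: l_def)
    have lM: "l * M / s = 1/200" using s M by (simp add: l_def)
    define p where "p = 1 / s"
    have p: "p > 0" "p * s = 1" "p\<^sup>2 * s\<^sup>2 = 1" using s by (simp_all add: p_def power_divide)
    let ?v = "\<lambda>x. (p / l) * v (l *\<^sub>R x)"
    let ?g = "\<lambda>i x. p * g i (l *\<^sub>R x)"
    let ?H = "\<lambda>i j x. (p * l) * H i j (l *\<^sub>R x)"
    let ?w = "\<lambda>i x. (p\<^sup>2 / l) * w i (l *\<^sub>R x)"
    let ?W = "\<lambda>i j x. p\<^sup>2 * W i j (l *\<^sub>R x)"
    let ?A = "\<lambda>i j x. p\<^sup>2 * A i j (l *\<^sub>R x)"
    have sc: "\<bar>p\<^sup>2 * t\<bar> \<le> c" if "\<bar>t\<bar> \<le> s\<^sup>2 * c" for t c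
    proof -
      have "p\<^sup>2 * \<bar>t\<bar> \<le> p\<^sup>2 * (s\<^sup>2 * c)" using that by (intro mult_left_mono) auto
      also have "\<dots> = c" using p(3) by (simp add: mult.assoc[symmetric])
      finally show ?thesis by (simp add: abs_mult)
    qed
    have 1: "St ?v ?g ?H ?w ?W" using St_scale[OF St, of l p] l by simp
    have 2: "\<forall>i j. continuous_on UNIV (?A i j)"
      by (intro allI continuous_intros continuous_on_compose2[OF A[rule_format]]) auto
    have 3: "\<forall>x. ?A 1 2 x = ?A 2 1 x" using sym by simp
    have 4: "\<forall>i j x. \<bar>?H i j x\<bar> \<le> 1/200"
    proof (intro allI)
      fix i j x
      have "\<bar>?H i j x\<bar> = (p * l) * \<bar>H i j (l *\<^sub>R x)\<bar>" using p l by (simp add: abs_mult)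
      also have "\<dots> \<le> (p * l) * M" using p l H by (intro mult_left_mono) auto
      also have "\<dots> = l * M / s" by (simp add: p_def)
      also have "\<dots> = 1/200" by (rule lM)
      finally show "\<bar>?H i j x\<bar> \<le> 1/200" .
    qed
    have 5: "\<forall>i j x. \<bar>?A i j x - metric_form ?g ?W i j x - kronecker i j\<bar> \<le> 1/24"
    proof (intro allI)
      fix i j x
      have "?A i j x - metric_form ?g ?W i j x - kronecker i j = p\<^sup>2 * (A i j (l *\<^sub>R x) - metric_form g W i j (l *\<^sub>R x) - s\<^sup>2 * kronecker i j)"
        using p(3) unfolding metric_form_scale by (simp add: algebra_simps)
      also have "\<bar>\<dots>\<bar> \<le> 1/24" by (rule sc) (use D0 in simp)
      finally show "\<bar>?A i j x - metric_form ?g ?W i j x - kronecker i j\<bar> \<le> 1/24" .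
    qed
    have 6: "\<forall>i j x. \<forall>y \<in> fwd_box 2 x. \<bar>?A i j y - ?A i j x\<bar> \<le> 1/(48*r)"
    proof (intro allI ballI)
      fix i j x y assume y: "y \<in> fwd_box 2 x"
      have "l * y $ k \<le> l * x $ k + 2 * l" for k
        using y l mult_left_mono[of "y$k" "x$k + 2" l] unfolding fwd_box_def by (simp add: algebra_simps)
      then have "l *\<^sub>R y \<in> fwd_box (2 * l) (l *\<^sub>R x)" using y l unfolding fwd_box_def by auto
      then have "\<bar>A i j (l *\<^sub>R y) - A i j (l *\<^sub>R x)\<bar> \<le> s\<^sup>2 * (1/(48*r))" using AQ unfolding l_def by auto
      from sc[OF this] show "\<bar>?A i j y - ?A i j x\<bar> \<le> 1/(48*r)" by (simp add: algebra_simps)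
    qed
    from unit[THEN spec, THEN mp, OF r, THEN spec, THEN spec, THEN spec, THEN spec, THEN spec, THEN spec,
      THEN mp, OF 1, THEN mp, OF 2, THEN mp, OF 3, THEN mp, OF 4, THEN mp, OF 5, THEN mp, OF 6]
    obtain v1 g1 H1 w1 W1 where o: "St v1 g1 H1 w1 W1 \<and> (\<forall>G. (\<forall>i x. \<bar>?g i x\<bar> \<le> G) \<longrightarrow> (\<forall>x. \<bar>v1 x - ?v x\<bar> \<le> C + 4 * G)) \<and>
      (\<forall>i x. \<bar>g1 i x - ?g i x\<bar> \<le> C) \<and> (\<forall>i j x. \<bar>H1 i j x\<bar> \<le> C * r ^ 3) \<and>
      (\<forall>i j x. \<bar>?A i j x - metric_form g1 W1 i j x - kronecker i j / r\<bar> \<le> 1/(24*r))" by (elim exE) (rule that)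
    have o3: "\<bar>g1 i x - p * g i (l *\<^sub>R x)\<bar> \<le> C" and o4: "\<bar>H1 i j x\<bar> \<le> C * r ^ 3"
      and o5: "\<bar>p\<^sup>2 * A i j (l *\<^sub>R x) - metric_form g1 W1 i j x - kronecker i j / r\<bar> \<le> 1/(24*r)" for i j x
      using o by blast+
    \<comment> \<open>The way back is the same scaling with \<open>1 / l\<close> in place of
      \<open>l\<close> and \<open>s\<close> in place of \<open>p\<close>.\<close>
    define l' where "l' = 1 / l"
    have l': "l' \<noteq> 0" "l' > 0" using l by (auto simp: l'_def)
    have ll: "l *\<^sub>R l' *\<^sub>R x = x" for x :: "real^2" using l by (simp add: l'_def)
    let ?v1 = "\<lambda>x. (s / l') * v1 (l' *\<^sub>R x)"
    let ?g1 = "\<lambda>i x. s * g1 i (l' *\<^sub>R x)"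
    let ?H1 = "\<lambda>i j x. (s * l') * H1 i j (l' *\<^sub>R x)"
    let ?w1 = "\<lambda>i x. (s\<^sup>2 / l') * w1 i (l' *\<^sub>R x)"
    let ?W1 = "\<lambda>i j x. s\<^sup>2 * W1 i j (l' *\<^sub>R x)"
    have S1: "St ?v1 ?g1 ?H1 ?w1 ?W1" using St_scale[OF _ l'(1), of v1 g1 H1 w1 W1 s] o by blast
    show "\<exists>v1 g1 H1 w1 W1. St v1 g1 H1 w1 W1 \<and>
      (\<forall>x. \<forall>G. (\<forall>i x. \<bar>g i x\<bar> \<le> G) \<longrightarrow> \<bar>v1 x - v x\<bar> \<le> (s / (200 * M)) * (C * s + 4 * G)) \<and>
      (\<forall>i x. \<bar>g1 i x - g i x\<bar> \<le> C * s) \<and> (\<forall>i j x. \<bar>H1 i j x\<bar> \<le> 200 * C * r ^ 3 * M) \<and>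
      (\<forall>i j x. \<bar>A i j x - metric_form g1 W1 i j x - s\<^sup>2 / r * kronecker i j\<bar> \<le> s\<^sup>2/(24*r))"
    proof (rule exI[of _ ?v1], rule exI[of _ ?g1], rule exI[of _ ?H1], rule exI[of _ ?w1], rule exI[of _ ?W1],
        intro conjI allI impI S1)
      fix i j x
      show "\<bar>?v1 x - v x\<bar> \<le> (s / (200 * M)) * (C * s + 4 * G)" if G: "\<forall>i x. \<bar>g i x\<bar> \<le> G" for G
      proof -
        have "\<forall>i x. \<bar>?g i x\<bar> \<le> p * G" using G p by (auto simp: abs_mult intro!: mult_left_mono)
        then have "\<bar>v1 (l' *\<^sub>R x) - ?v (l' *\<^sub>R x)\<bar> \<le> C + 4 * (p * G)" using o by blast
        then have "(s * l) * \<bar>v1 (l' *\<^sub>R x) - ?v (l' *\<^sub>R x)\<bar> \<le> (s * l) * (C + 4 * (p * G))"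
          using s l by (intro mult_left_mono) auto
        also have "\<dots> = l * (C * s + 4 * G)" using p(2) by (simp add: algebra_simps)
        finally have "\<bar>(s * l) * (v1 (l' *\<^sub>R x) - ?v (l' *\<^sub>R x))\<bar> \<le> l * (C * s + 4 * G)"
          using s l by (simp add: abs_mult)
        moreover have "(s * l) * (v1 (l' *\<^sub>R x) - ?v (l' *\<^sub>R x)) = ?v1 x - v x"
          using s l unfolding ll by (simp add: l'_def p_def field_simps)
        ultimately have "\<bar>?v1 x - v x\<bar> \<le> l * (C * s + 4 * G)" by (simp only:)
        then show ?thesis unfolding l_def[symmetric] .
      qed
      have "s * \<bar>g1 i (l' *\<^sub>R x) - ?g i (l' *\<^sub>R x)\<bar> \<le> s * C" by (rule mult_left_mono[OF o3]) (use s in simp)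
      then have "\<bar>s * (g1 i (l' *\<^sub>R x) - ?g i (l' *\<^sub>R x))\<bar> \<le> C * s" using s by (simp add: abs_mult mult.commute)
      moreover have "s * (g1 i (l' *\<^sub>R x) - ?g i (l' *\<^sub>R x)) = ?g1 i x - g i x"
        unfolding ll using s by (simp add: p_def field_simps)
      ultimately show "\<bar>?g1 i x - g i x\<bar> \<le> C * s" by simp
      have "\<bar>?H1 i j x\<bar> = (s * l') * \<bar>H1 i j (l' *\<^sub>R x)\<bar>" using s l' by (simp add: abs_mult)
      also have "\<dots> \<le> (s * l') * (C * r ^ 3)" by (rule mult_left_mono[OF o4]) (use s l' in simp)
      also have "\<dots> = 200 * C * r ^ 3 * M" using s M by (simp add: l'_def l_def)
      finally show "\<bar>?H1 i j x\<bar> \<le> 200 * C * r ^ 3 * M" .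
      have "s\<^sup>2 * \<bar>?A i j (l' *\<^sub>R x) - metric_form g1 W1 i j (l' *\<^sub>R x) - kronecker i j / r\<bar> \<le> s\<^sup>2 * (1/(24*r))"
        by (rule mult_left_mono[OF o5]) simp
      then have "\<bar>s\<^sup>2 * (?A i j (l' *\<^sub>R x) - metric_form g1 W1 i j (l' *\<^sub>R x) - kronecker i j / r)\<bar> \<le> s\<^sup>2/(24*r)"
        by (simp add: abs_mult)
      moreover have "s\<^sup>2 * (?A i j (l' *\<^sub>R x) - metric_form g1 W1 i j (l' *\<^sub>R x) - kronecker i j / r)
         = A i j x - metric_form ?g1 ?W1 i j x - s\<^sup>2 / r * kronecker i j"
        unfolding ll metric_form_scale using p(3) by (simp add: algebra_simps)
      ultimately show "\<bar>A i j x - metric_form ?g1 ?W1 i j x - s\<^sup>2 / r * kronecker i j\<bar> \<le> s\<^sup>2/(24*r)" by simp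
    qed
  qed
qed

section \<open>Limits of geometrically convergent sequences and the iteration\<close>

lemma geometric_limit:
  fixes u :: "nat \<Rightarrow> 'a \<Rightarrow> real"
  assumes "\<And>n x. \<bar>u (Suc n) x - u n x\<bar> \<le> a * (1/2)^n"
  shows "\<exists>U. \<forall>n x. \<bar>u n x - U x\<bar> \<le> 2 * a * (1/2)^n"
proof -
  \<comment> \<open>The partial sum factor \<open>1 - (1/2)^k\<close> lets the induction close; it
    is dropped afterwards.\<close>
  have tel: "\<bar>u (n + k) x - u n x\<bar> \<le> 2 * a * (1/2)^n * (1 - (1/2)^k)" for n k x
  proof (induction k)
    case (Suc k)
    have "\<bar>u (n + Suc k) x - u (n + k) x\<bar> \<le> a * (1/2)^(n+k)" using assms[of "n+k" x] by simp
    then have "\<bar>u (n + Suc k) x - u n x\<bar> \<le> 2 * a * (1/2)^n * (1 - (1/2)^k) + a * (1/2)^(n+k)"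
      using Suc by linarith
    then show ?case by (simp add: power_add algebra_simps)
  qed simp
  have a: "a \<ge> 0" using assms[of 0] by (metis abs_ge_zero order_trans power_0 mult.right_neutral)
  have tel': "\<bar>u (n + k) x - u n x\<bar> \<le> 2 * a * (1/2)^n" for n k x
    by (rule order_trans[OF tel]) (use a in \<open>auto simp: mult_left_le\<close>)
  have lim0: "(\<lambda>n. 2 * a * (1/2)^n) \<longlonglongrightarrow> 0" by (auto intro!: tendsto_mult_right_zero LIMSEQ_realpow_zero)
  have "Cauchy (\<lambda>n. u n x)" for x
  proof (rule metric_CauchyI)
    fix e :: real assume e: "e > 0"
    from order_tendstoD(2)[OF lim0, of "e/2"] e obtain N where N: "2 * a * (1/2)^N < e/2"
      unfolding eventually_sequentially by (metis half_gt_zero order_refl)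
    show "\<exists>M. \<forall>m\<ge>M. \<forall>n\<ge>M. dist (u m x) (u n x) < e"
    proof (intro exI[of _ N] allI impI)
      fix m n assume "N \<le> m" "N \<le> n"
      then have "\<bar>u m x - u N x\<bar> \<le> 2 * a * (1/2)^N" "\<bar>u n x - u N x\<bar> \<le> 2 * a * (1/2)^N"
        using tel'[of N "m - N" x] tel'[of N "n - N" x] by auto
      then show "dist (u m x) (u n x) < e" using N by (auto simp: dist_real_def)
    qed
  qed
  then obtain U where U: "\<And>x. (\<lambda>n. u n x) \<longlonglongrightarrow> U x"
    unfolding Cauchy_convergent_iff convergent_def by metis
  have "\<bar>u n x - U x\<bar> \<le> 2 * a * (1/2)^n" for n x
  proof -
    have "(\<lambda>k. \<bar>u (k + n) x - u n x\<bar>) \<longlonglongrightarrow> \<bar>U x - u n x\<bar>"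
      by (intro tendsto_intros LIMSEQ_ignore_initial_segment U)
    then have "\<bar>U x - u n x\<bar> \<le> 2 * a * (1/2)^n"
      by (rule LIMSEQ_le_const2) (use tel'[of n _ x] in \<open>auto simp: add.commute\<close>)
    then show ?thesis by (simp add: abs_minus_commute)
  qed
  then show ?thesis by blast
qed

lemma uniform_bound_continuous:
  fixes u :: "nat \<Rightarrow> real^2 \<Rightarrow> real"
  assumes "\<And>n. continuous_on UNIV (u n)" "\<And>n x. \<bar>u n x - U x\<bar> \<le> b n" "b \<longlonglongrightarrow> 0"
  shows "continuous_on UNIV U"
proof (rule uniform_limit_theorem[of _ u])
  show "uniform_limit UNIV u U sequentially"
    unfolding uniform_limit_iff
  proof (intro allI impI)
    fix e :: real assume "e > 0"
    from order_tendstoD(2)[OF assms(3) this] show "\<forall>\<^sub>F n in sequentially. \<forall>x\<in>UNIV. dist (u n x) (U x) < e"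
      by (rule eventually_mono) (use assms(2) in \<open>auto simp: dist_real_def intro: le_less_trans\<close>)
  qed
qed (use assms in auto)

text \<open>Along each coordinate line this is the one-dimensional theorem on uniformly convergent
  derivatives.\<close>

lemma C1_limit:
  assumes C: "\<And>n. C1 (u n) (u' n)" and u: "\<And>n x. \<bar>u n x - U x\<bar> \<le> b n" and u': "\<And>n i x. \<bar>u' n i x - U' i x\<bar> \<le> b n"
    and b: "b \<longlonglongrightarrow> 0"
  shows "C1 U U'"
  unfolding C1_def
proof (intro conjI allI)
  show "continuous_on UNIV U" using uniform_bound_continuous[of u U b] C1_cont[OF C] u b by blast
  fix i
  show "continuous_on UNIV (U' i)" using uniform_bound_continuous[of "\<lambda>n. u' n i" "U' i" b] C1_cont'[OF C] u' b by blast
  have lim: "(\<lambda>n. u n x) \<longlonglongrightarrow> U x" for x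
    using u b Lim_null_comparison[of "\<lambda>n. u n x - U x" b sequentially] 
    by (subst Lim_null) auto
  show "pd i U (U' i)"
    unfolding pd_def
  proof
    fix x
    have "\<exists>g. \<forall>t\<in>UNIV. (\<lambda>n. u n (x + t *\<^sub>R ax i)) \<longlonglongrightarrow> g t \<and> (g has_derivative (\<lambda>h. U' i (x + t *\<^sub>R ax i) * h)) (at t within UNIV)"
    proof (rule has_derivative_sequence[where f = "\<lambda>n t. u n (x + t *\<^sub>R ax i)" and f' = "\<lambda>n t h. u' n i (x + t *\<^sub>R ax i) * h" and ?x0.0 = 0 and l = "U x"])
      show "((\<lambda>t. u n (x + t *\<^sub>R ax i)) has_derivative (\<lambda>h. u' n i (x + t *\<^sub>R ax i) * h)) (at t within UNIV)" for n t
        using pd_at[OF C1_pd[OF C], of n x i t UNIV] by (simp add: has_field_derivative_def)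
      show "(\<lambda>n. u n (x + 0 *\<^sub>R ax i)) \<longlonglongrightarrow> U x" using lim by simp
      fix e :: real assume "e > 0"
      from order_tendstoD(2)[OF b this]
      show "\<forall>\<^sub>F n in sequentially. \<forall>t\<in>UNIV. \<forall>h. norm (u' n i (x + t *\<^sub>R ax i) * h - U' i (x + t *\<^sub>R ax i) * h) \<le> e * norm h"
      proof (rule eventually_mono, intro ballI allI)
        fix n t and h :: real assume "b n < e"
        have "\<bar>u' n i (x + t *\<^sub>R ax i) - U' i (x + t *\<^sub>R ax i)\<bar> \<le> e"
          using u'[of n i "x + t *\<^sub>R ax i"] \<open>b n < e\<close> by linarith
        then have "\<bar>(u' n i (x + t *\<^sub>R ax i) - U' i (x + t *\<^sub>R ax i)) * h\<bar> \<le> e * \<bar>h\<bar>"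
          unfolding abs_mult by (intro mult_right_mono) auto
        then show "norm (u' n i (x + t *\<^sub>R ax i) * h - U' i (x + t *\<^sub>R ax i) * h) \<le> e * norm h"
          by (simp add: algebra_simps)
      qed
    qed auto
    then obtain g where g: "\<And>t. (\<lambda>n. u n (x + t *\<^sub>R ax i)) \<longlonglongrightarrow> g t" 
      "\<And>t. (g has_derivative (\<lambda>h. U' i (x + t *\<^sub>R ax i) * h)) (at t)" by auto
    have "g = (\<lambda>t. U (x + t *\<^sub>R ax i))" using g(1) lim LIMSEQ_unique by blast
    then show "((\<lambda>t. U (x + t *\<^sub>R ax i)) has_real_derivative U' i x) (at 0)"
      using g(2)[of 0] by (simp add: has_field_derivative_def)
  qed
qed

text \<open>Taking for \<open>a\<close> a bound on the size of an increment and for \<open>b\<close>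
  its Lipschitz bound yields a Hoelder bound; this serves both the limit gradient and the cone
  kernel.\<close>

lemma interpolation:
  fixes t a b \<alpha> :: real
  assumes "0 \<le> t" "t \<le> a" "t \<le> b" "0 < \<alpha>" "\<alpha> < 1"
  shows "t \<le> a powr (1 - \<alpha>) * b powr \<alpha>"
proof (cases "t = 0")
  case False
  then have "t = t powr (1 - \<alpha>) * t powr \<alpha>" using assms by (simp add: powr_add[symmetric])
  also have "\<dots> \<le> a powr (1 - \<alpha>) * b powr \<alpha>" using assms by (intro mult_mono powr_mono2) auto
  finally show ?thesis .
qed simp

text \<open>In the \<open>n\<close>-th stage the defect is about \<open>(s0 / \<rho> ^ n)\<^sup>2\<close> and the Hessian is bounded by \<open>M0 * \<kappa> ^ n\<close>;
  the lower bound on \<open>\<kappa>\<close> is the cost of the three successive corrugations.\<close>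

definition iteration_constant :: "real \<Rightarrow> bool" where
  "iteration_constant C \<longleftrightarrow> (\<forall>\<rho>\<ge>5. \<forall>\<kappa>\<ge>200 * C * \<rho> ^ 6. \<forall>s0>0. \<forall>M0>0. \<forall>G0 A v0 g0 H0 w0 W0.
    St v0 g0 H0 w0 W0 \<longrightarrow> (\<forall>i j. continuous_on UNIV (A i j)) \<longrightarrow>
    (\<forall>x. A 1 2 x = A 2 1 x) \<longrightarrow> (\<forall>i j x. \<bar>H0 i j x\<bar> \<le> M0) \<longrightarrow> (\<forall>i x. \<bar>g0 i x\<bar> \<le> G0) \<longrightarrow>
    (\<forall>i j x. \<bar>A i j x - metric_form g0 W0 i j x - s0\<^sup>2 * kronecker i j\<bar> \<le> s0\<^sup>2/24) \<longrightarrow>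
    (\<forall>n i j x. \<forall>y \<in> fwd_box (2 * (s0 / \<rho> ^ n / (200 * (M0 * \<kappa> ^ n)))) x. \<bar>A i j y - A i j x\<bar> \<le> (s0 / \<rho> ^ n)\<^sup>2 / (48*\<rho>\<^sup>2)) \<longrightarrow>
    (\<exists>v g. C1 v g \<and> (\<forall>x. \<bar>v x - v0 x\<bar> \<le> (s0 / (100 * M0)) * (9 * C * s0 + 4 * G0)) \<and>
      (\<forall>\<alpha>. 0 < \<alpha> \<longrightarrow> \<alpha> < 1 \<longrightarrow> \<rho> powr (\<alpha> - 1) * \<kappa> powr \<alpha> < 1 \<longrightarrow>
         (\<exists>L. \<forall>i x y. \<bar>g i x - g i y\<bar> \<le> L * dist x y powr \<alpha>)) \<and>
      (\<exists>G. \<forall>i x. \<bar>g i x\<bar> \<le> G) \<and>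
      (\<exists>ws Ws b. b \<longlonglongrightarrow> 0 \<and> (\<forall>n i. C1 (ws n i) (Ws n i)) \<and>
         (\<forall>n i j x. \<bar>A i j x - metric_form g (Ws n) i j x\<bar> \<le> b n))))"

text \<open>Stages with \<open>r = \<rho>\<^sup>2\<close> are chained by dependent choice. Only
  \<open>v\<close> and its gradient pass to the limit; of the companion fields just their existence
  and the vanishing defect are recorded.\<close>

lemma convex_integration: "\<exists>C\<ge>1. iteration_constant C"
proof -
  obtain C where C: "C \<ge> 1" and "stage_constant C" using stage by blast
  note stage = this(2)[unfolded stage_constant_def]
  show ?thesis unfolding iteration_constant_def
  proof (rule exI[of _ C], intro conjI allI impI C)
    fix \<rho> \<kappa> s0 M0 G0 :: real and A v0 g0 H0 w0 W0
    assume \<rho>: "5 \<le> \<rho>" and \<kappa>: "200 * C * \<rho> ^ 6 \<le> \<kappa>" and s0: "0 < s0" and M0: "0 < M0"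
      and St0: "St v0 g0 H0 w0 W0" and A: "\<forall>i j. continuous_on UNIV (A i j)" and sym: "\<forall>x. A 1 2 x = A 2 1 x"
      and H0: "\<forall>i j x. \<bar>H0 i j x\<bar> \<le> M0" and g0: "\<forall>i x. \<bar>g0 i x\<bar> \<le> G0"
      and D0: "\<forall>i j x. \<bar>A i j x - metric_form g0 W0 i j x - s0\<^sup>2 * kronecker i j\<bar> \<le> s0\<^sup>2/24"
      and AQ: "\<forall>n i j x. \<forall>y \<in> fwd_box (2 * (s0 / \<rho> ^ n / (200 * (M0 * \<kappa> ^ n)))) x. \<bar>A i j y - A i j x\<bar> \<le> (s0 / \<rho> ^ n)\<^sup>2 / (48*\<rho>\<^sup>2)"
    define s where "s = (\<lambda>n. s0 / \<rho> ^ n)"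
    define M where "M = (\<lambda>n. M0 * \<kappa> ^ n)"
    define l where "l = s0 / (200 * M0)"
    \<comment> \<open>A stage moves \<open>v\<close> by the length unit times at most
      \<open>C * s0 + 4 * G\<close> with \<open>G = G0 + 2 * C * s0\<close>, the gradient bound
      valid for all stages; this is where 9 comes from.\<close>
    define B where "B = 9 * C * s0 + 4 * G0"
    have "1 * 1 \<le> C * \<rho> ^ 6" using C \<rho> by (intro mult_mono one_le_power) auto
    then have \<kappa>1: "\<kappa> \<ge> 1" using \<kappa> by linarith
    have s: "s n > 0" and M: "M n > 0" for n using s0 \<rho> M0 \<kappa>1 by (simp_all add: s_def M_def)
    have s2: "s n \<le> s0 * (1/2)^n" for n
    proof -
      have "2 ^ n \<le> \<rho> ^ n" using \<rho> by (intro power_mono) auto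
      then have "s0 / \<rho> ^ n \<le> s0 / 2 ^ n" using s0 by (intro divide_left_mono mult_pos_pos) (auto intro: less_le_trans[of 0 "2^n"])
      then show ?thesis by (simp add: s_def power_divide)
    qed
    have s2': "s n \<le> s0" for n
    proof -
      have "s0 * (1/2)^n \<le> s0 * 1" using s0 by (intro mult_left_mono power_le_one) auto
      then show ?thesis using s2[of n] by simp
    qed
    have l2: "s n / (200 * M n) \<le> l * (1/2)^n" for n
    proof -
      have "M0 * 1 \<le> M n" unfolding M_def using M0 \<kappa>1 by (intro mult_left_mono one_le_power) auto
      then have "s n / (200 * M n) \<le> (s0 * (1/2)^n) / (200 * M0)" using s2[of n] M0 s[of n] M[of n] by (intro frac_le) auto
      then show ?thesis by (simp add: l_def)
    qed
    have sS: "s (Suc n) = s n / \<rho>" "M (Suc n) = \<kappa> * M n" for n by (simp_all add: s_def M_def)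
    have G0: "G0 \<ge> 0" using g0[rule_format, of 1 0] by simp
    \<comment> \<open>The gradient bound carries the partial sum of a geometric series, so that it
      survives the induction. The clause for \<open>n = 0\<close> ties the start of the sequence to
      the given data, which dependent choice would otherwise forget.\<close>
    define P where "P = (\<lambda>n (v, g, H, w, W). St v g H w W \<and> (\<forall>i j x. \<bar>H i j x\<bar> \<le> M n) \<and>
       (\<forall>i x. \<bar>g i x\<bar> \<le> G0 + 2 * C * s0 * (1 - (1/2)^n)) \<and>
       (\<forall>i j x. \<bar>A i j x - metric_form g W i j x - (s n)\<^sup>2 * kronecker i j\<bar> \<le> (s n)\<^sup>2/24) \<and> (n = 0 \<longrightarrow> v = v0 \<and> g = g0))"
    define R where "R = (\<lambda>n (v :: real^2 \<Rightarrow> real, g :: 2 \<Rightarrow> real^2 \<Rightarrow> real, H :: 2 \<Rightarrow> 2 \<Rightarrow> real^2 \<Rightarrow> real,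
         w :: 2 \<Rightarrow> real^2 \<Rightarrow> real, W :: 2 \<Rightarrow> 2 \<Rightarrow> real^2 \<Rightarrow> real) (v1 :: real^2 \<Rightarrow> real, g1 :: 2 \<Rightarrow> real^2 \<Rightarrow> real, H1 :: 2 \<Rightarrow> 2 \<Rightarrow> real^2 \<Rightarrow> real,
         w1 :: 2 \<Rightarrow> real^2 \<Rightarrow> real, W1 :: 2 \<Rightarrow> 2 \<Rightarrow> real^2 \<Rightarrow> real). 
       (\<forall>x. \<bar>v1 x - v x\<bar> \<le> l * B * (1/2)^n) \<and> (\<forall>i x. \<bar>g1 i x - g i x\<bar> \<le> C * s n))"
    have "\<exists>f. \<forall>n. P n (f n) \<and> R n (f n) (f (Suc n))"
    proof (rule dependent_nat_choice)
      show "\<exists>x. P 0 x"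
        by (rule exI[of _ "(v0, g0, H0, w0, W0)"]) (use St0 H0 g0 D0 in \<open>simp add: P_def s_def M_def\<close>)
    next
      fix st n assume Pst: "P n st"
      obtain v g H w W where st: "st = (v, g, H, w, W)" by (cases st) auto
      have 0: "St v g H w W" "\<forall>i j x. \<bar>H i j x\<bar> \<le> M n" "\<forall>i x. \<bar>g i x\<bar> \<le> G0 + 2 * C * s0 * (1 - (1/2)^n)"
        "\<forall>i j x. \<bar>A i j x - metric_form g W i j x - (s n)\<^sup>2 * kronecker i j\<bar> \<le> (s n)\<^sup>2/24"
        using Pst unfolding st P_def split by blast+
      have "5 * 5 \<le> \<rho> * \<rho>" using \<rho> by (intro mult_mono) auto
      then have r: "24 \<le> \<rho>\<^sup>2" by (simp add: power2_eq_square)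
      have AQ': "\<forall>i j x. \<forall>y \<in> fwd_box (2 * (s n / (200 * M n))) x. \<bar>A i j y - A i j x\<bar> \<le> (s n)\<^sup>2/(48*\<rho>\<^sup>2)"
        using AQ unfolding s_def M_def by blast
      from stage[THEN spec, THEN mp, OF r, THEN spec, THEN mp, OF s, THEN spec, THEN mp, OF M,
        THEN spec, THEN spec, THEN spec, THEN spec, THEN spec, THEN spec,
        THEN mp, OF 0(1), THEN mp, OF A, THEN mp, OF sym, THEN mp, OF 0(2), THEN mp, OF 0(4), THEN mp, OF AQ']
      obtain v1 g1 H1 w1 W1 where o: "St v1 g1 H1 w1 W1 \<and>
      (\<forall>x. \<forall>G. (\<forall>i x. \<bar>g i x\<bar> \<le> G) \<longrightarrow> \<bar>v1 x - v x\<bar> \<le> (s n / (200 * M n)) * (C * s n + 4 * G)) \<and>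
      (\<forall>i x. \<bar>g1 i x - g i x\<bar> \<le> C * s n) \<and> (\<forall>i j x. \<bar>H1 i j x\<bar> \<le> 200 * C * (\<rho>\<^sup>2) ^ 3 * M n) \<and>
      (\<forall>i j x. \<bar>A i j x - metric_form g1 W1 i j x - (s n)\<^sup>2 / \<rho>\<^sup>2 * kronecker i j\<bar> \<le> (s n)\<^sup>2/(24*\<rho>\<^sup>2))"
        by (elim exE) (rule that)
      have gS: "G0 + 2 * C * s0 * (1 - (1/2)^n) \<le> G0 + 2 * C * s0"
        using C s0 by (simp add: mult_left_le)
      have "P (Suc n) (v1, g1, H1, w1, W1)"
        unfolding P_def split
      proof (intro conjI allI)
        fix i j x
        have "\<bar>H1 i j x\<bar> \<le> 200 * C * (\<rho>\<^sup>2) ^ 3 * M n" using o by blast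
        also have "\<dots> = (200 * C * \<rho> ^ 6) * M n" by (simp add: power_mult[symmetric])
        also have "\<dots> \<le> \<kappa> * M n" using \<kappa> M[of n] by (intro mult_right_mono) auto
        finally show "\<bar>H1 i j x\<bar> \<le> M (Suc n)" by (simp add: sS)
        have "\<bar>g1 i x - g i x\<bar> \<le> C * s n" using o by blast
        then have "\<bar>g1 i x\<bar> \<le> \<bar>g i x\<bar> + C * s n" by linarith
        also have "\<dots> \<le> (G0 + 2 * C * s0 * (1 - (1/2)^n)) + C * (s0 * (1/2)^n)"
          using 0(3) s2[of n] C by (intro add_mono mult_left_mono) auto
        finally show "\<bar>g1 i x\<bar> \<le> G0 + 2 * C * s0 * (1 - (1/2)^(Suc n))" by (simp add: algebra_simps)
        show "\<bar>A i j x - metric_form g1 W1 i j x - (s (Suc n))\<^sup>2 * kronecker i j\<bar> \<le> (s (Suc n))\<^sup>2/24"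
          using o by (simp add: sS power_divide mult.commute)
      qed (use o in auto)
      moreover have "R n st (v1, g1, H1, w1, W1)"
        unfolding R_def st split
      proof (intro conjI allI)
        fix i x
        show "\<bar>g1 i x - g i x\<bar> \<le> C * s n" using o by blast
        have "\<bar>v1 x - v x\<bar> \<le> (s n / (200 * M n)) * (C * s n + 4 * (G0 + 2 * C * s0))"
          using o 0(3) gS by (meson order_trans)
        also have "\<dots> \<le> (l * (1/2)^n) * B"
        proof (intro mult_mono l2)
          have "C * s n \<le> C * s0" using s2' C by (intro mult_left_mono) auto
          then show "C * s n + 4 * (G0 + 2 * C * s0) \<le> B" by (simp add: B_def)
          show "0 \<le> l * (1/2)^n" using s0 M0 by (simp add: l_def)
          show "0 \<le> C * s n + 4 * (G0 + 2 * C * s0)" using C s[of n] G0 s0 by simp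
        qed
        finally show "\<bar>v1 x - v x\<bar> \<le> l * B * (1/2)^n" by (simp add: algebra_simps)
      qed
      ultimately show "\<exists>y. P (Suc n) y \<and> R n st y" by blast
    qed
    then obtain f where f: "\<And>n. P n (f n)" "\<And>n. R n (f n) (f (Suc n))" by blast
    define vs gs Hs ws Ws where "vs = (\<lambda>n. fst (f n))" and "gs = (\<lambda>n. fst (snd (f n)))" 
      and "Hs = (\<lambda>n. fst (snd (snd (f n))))" and "ws = (\<lambda>n. fst (snd (snd (snd (f n)))))"
      and "Ws = (\<lambda>n. snd (snd (snd (snd (f n)))))"
    have fn: "f n = (vs n, gs n, Hs n, ws n, Ws n)" for n by (simp add: vs_def gs_def Hs_def ws_def Ws_def)
    have St: "St (vs n) (gs n) (Hs n) (ws n) (Ws n)" and H: "\<bar>Hs n i j x\<bar> \<le> M n"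
      and Gn: "\<bar>gs n i x\<bar> \<le> G0 + 2 * C * s0 * (1 - (1/2)^n)"
      and D: "\<bar>A i j x - metric_form (gs n) (Ws n) i j x - (s n)\<^sup>2 * kronecker i j\<bar> \<le> (s n)\<^sup>2/24" for n i j x
      using f(1)[of n] unfolding fn P_def by auto
    have v0: "vs 0 = v0" and g00: "gs 0 = g0" using f(1)[of 0] unfolding fn P_def by auto
    have dv: "\<bar>vs (Suc n) x - vs n x\<bar> \<le> l * B * (1/2)^n" and dg: "\<bar>gs (Suc n) i x - gs n i x\<bar> \<le> C * s n" for n i x
      using f(2)[of n] unfolding fn R_def by auto
    have Cv: "C1 (vs n) (gs n)" and Cg: "C1 (gs n i) (Hs n i)" and Cw: "C1 (ws n i) (Ws n i)" for n i
      using St[of n] unfolding St_def by auto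
    define G where "G = G0 + 2 * C * s0"
    have G: "\<bar>gs n i x\<bar> \<le> G" for n i x
    proof -
      have "G0 + 2 * C * s0 * (1 - (1/2)^n) \<le> G" using C s0 by (simp add: mult_left_le G_def)
      then show ?thesis using Gn[of n i x] by linarith
    qed
    obtain v where v: "\<And>n x. \<bar>vs n x - v x\<bar> \<le> 2 * (l * B) * (1/2)^n"
      using geometric_limit[of vs, OF dv] by blast
    \<comment> \<open>Component and point are paired so that a single application of
      \<open>geometric_limit\<close> treats both components of the gradient.\<close>
    have dg': "\<bar>(\<lambda>(i,x). gs (Suc n) i x) ix - (\<lambda>(i,x). gs n i x) ix\<bar> \<le> (C * s0) * (1/2)^n" for n ix
    proof -
      have "C * s n \<le> C * (s0 * (1/2)^n)" using C s2 by (intro mult_left_mono) auto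
      then show ?thesis using dg[of n "fst ix" "snd ix"] by (simp add: split_def)
    qed
    obtain g' where g': "\<And>n ix. \<bar>(\<lambda>(i,x). gs n i x) ix - g' ix\<bar> \<le> 2 * (C * s0) * (1/2)^n"
      using geometric_limit[where u = "\<lambda>n (i,x). gs n i x", OF dg'] by blast
    define g where "g = (\<lambda>i x. g' (i, x))"
    have g: "\<bar>gs n i x - g i x\<bar> \<le> 2 * (C * s0) * (1/2)^n" for n i x
      using g'[of n "(i,x)"] by (simp add: g_def)
    have lim0: "(\<lambda>n. c * (1/2)^n) \<longlonglongrightarrow> 0" for c :: real by (auto intro!: tendsto_mult_right_zero LIMSEQ_realpow_zero)
    have glim: "(\<lambda>n. gs n i x) \<longlonglongrightarrow> g i x" for i x
      using g[of _ i x] Lim_null_comparison[OF _ lim0[of "2 * (C * s0)"], of "\<lambda>n. gs n i x - g i x"]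
      by (subst Lim_null) auto
    have Gl: "\<bar>g i x\<bar> \<le> G" for i x
      by (rule LIMSEQ_le_const2[OF tendsto_rabs[OF glim]]) (use G in auto)
    show "\<exists>v g. C1 v g \<and> (\<forall>x. \<bar>v x - v0 x\<bar> \<le> (s0 / (100 * M0)) * (9 * C * s0 + 4 * G0)) \<and>
      (\<forall>\<alpha>. 0 < \<alpha> \<longrightarrow> \<alpha> < 1 \<longrightarrow> \<rho> powr (\<alpha> - 1) * \<kappa> powr \<alpha> < 1 \<longrightarrow>
         (\<exists>L. \<forall>i x y. \<bar>g i x - g i y\<bar> \<le> L * dist x y powr \<alpha>)) \<and>
      (\<exists>G. \<forall>i x. \<bar>g i x\<bar> \<le> G) \<and>
      (\<exists>ws Ws b. b \<longlonglongrightarrow> 0 \<and> (\<forall>n i. C1 (ws n i) (Ws n i)) \<and>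
         (\<forall>n i j x. \<bar>A i j x - metric_form g (Ws n) i j x\<bar> \<le> b n))"
    proof (rule exI[of _ v], rule exI[of _ g], intro conjI)
      let ?b = "\<lambda>n. max (2 * (l * B)) (2 * (C * s0)) * (1/2)^n"
      show "C1 v g"
      proof (rule C1_limit[where u = vs and u' = gs and U = v and b = ?b and U' = g])
        show "C1 (vs n) (gs n)" for n by (rule Cv)
        show "\<bar>vs n x - v x\<bar> \<le> ?b n" for n x
          by (rule order_trans[OF v]) (intro mult_right_mono, auto)
        show "\<bar>gs n i x - g i x\<bar> \<le> ?b n" for n i x
          by (rule order_trans[OF g]) (intro mult_right_mono, auto)
      qed (rule lim0)
      show "\<forall>x. \<bar>v x - v0 x\<bar> \<le> (s0 / (100 * M0)) * (9 * C * s0 + 4 * G0)"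
        using v[of 0] unfolding v0 by (simp add: l_def B_def abs_minus_commute)
      show "\<exists>G. \<forall>i x. \<bar>g i x\<bar> \<le> G" using Gl by blast
      show "\<exists>ws Ws b. b \<longlonglongrightarrow> 0 \<and> (\<forall>n i. C1 (ws n i) (Ws n i)) \<and>
         (\<forall>n i j x. \<bar>A i j x - metric_form g (Ws n) i j x\<bar> \<le> b n)"
      proof (intro exI conjI allI)
        \<comment> \<open>The defect is at most \<open>2 * (s n)\<^sup>2\<close>, counting the
          multiple of the identity and its tolerance. The second summand is the price for replacing
          \<open>gs n\<close> by its limit in the quadratic term.\<close>
        show "(\<lambda>n. (2 * s0\<^sup>2 + 2 * G * C * s0) * (1/2)^n) \<longlonglongrightarrow> 0" by (rule lim0)
        show "C1 (ws n i) (Ws n i)" for n i by (rule Cw)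
        fix n i j x
        have sn: "(s n)\<^sup>2 \<le> s0\<^sup>2 * (1/2)^n"
          using mult_mono[OF s2' s2, of n n] s[of n] s0 by (simp add: power2_eq_square algebra_simps)
        have kronecker: "\<bar>(s n)\<^sup>2 * kronecker i j\<bar> \<le> (s n)\<^sup>2" by (simp add: kronecker_def)
        have "\<bar>metric_form (gs n) (Ws n) i j x - metric_form g (Ws n) i j x\<bar> = \<bar>gs n i x * (gs n j x - g j x) + (gs n i x - g i x) * g j x\<bar> / 2"
          by (simp add: metric_form_def algebra_simps diff_divide_distrib[symmetric])
        also have "\<dots> \<le> (G * (2 * (C * s0) * (1/2)^n) + (2 * (C * s0) * (1/2)^n) * G) / 2"
          by (intro divide_right_mono abs_triangle_ineq[THEN order_trans] add_mono)
             (use C s0 in \<open>auto simp: abs_mult intro!: mult_mono G g Gl order_trans[OF abs_ge_zero G]\<close>)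
        finally have "\<bar>metric_form (gs n) (Ws n) i j x - metric_form g (Ws n) i j x\<bar> \<le> 2 * G * C * s0 * (1/2)^n" by (simp add: algebra_simps)
        then have "\<bar>A i j x - metric_form g (Ws n) i j x\<bar> \<le> 2 * (s0\<^sup>2 * (1/2)^n) + 2 * G * C * s0 * (1/2)^n"
          using D[of i j x n] kronecker sn by linarith
        then show "\<bar>A i j x - metric_form g (Ws n) i j x\<bar> \<le> (2 * s0\<^sup>2 + 2 * G * C * s0) * (1/2)^n"
          by (simp add: algebra_simps)
      qed
      show "\<forall>\<alpha>. 0 < \<alpha> \<longrightarrow> \<alpha> < 1 \<longrightarrow> \<rho> powr (\<alpha> - 1) * \<kappa> powr \<alpha> < 1 \<longrightarrow>
         (\<exists>L. \<forall>i x y. \<bar>g i x - g i y\<bar> \<le> L * dist x y powr \<alpha>)"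
      proof (intro allI impI)
        fix \<alpha> :: real assume \<alpha>: "0 < \<alpha>" "\<alpha> < 1" and th: "\<rho> powr (\<alpha> - 1) * \<kappa> powr \<alpha> < 1"
        \<comment> \<open>The ratio of successive Hoelder bounds: the increments of the gradient
          have size of order \<open>(1 / \<rho>) ^ n\<close> and Lipschitz constants of order
          \<open>\<kappa> ^ n\<close>, which enter with the powers \<open>1 - \<alpha>\<close> and
          \<open>\<alpha>\<close>.\<close>
        define \<theta> where "\<theta> = \<rho> powr (\<alpha> - 1) * \<kappa> powr \<alpha>"
        have \<theta>: "0 < \<theta>" "\<theta> < 1" using th \<rho> \<kappa>1 by (auto simp: \<theta>_def)
        have lip: "\<bar>u y - u x\<bar> \<le> K * 2 * dist x y" if "C1 u u'" "\<And>i x. \<bar>u' i x\<bar> \<le> K" for u u' K and x y :: "real^2"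
        proof -
          have "K \<ge> 0" using that(2)[of 1 0] by simp
          have "\<bar>y$1 - x$1\<bar> \<le> dist x y" "\<bar>y$2 - x$2\<bar> \<le> dist x y"
            using component_le_norm_cart[of "y - x"] by (simp_all add: dist_norm norm_minus_commute)
          then have "\<bar>y$1 - x$1\<bar> + \<bar>y$2 - x$2\<bar> \<le> 2 * dist x y" by linarith
          from mult_left_mono[OF this \<open>K \<ge> 0\<close>] show ?thesis
            using C1_lipschitz[OF that(1,2), of y x] by simp
        qed
        define Ka where "Ka = (2 * (C * s0)) powr (1-\<alpha>) * (4 * (M0 * \<kappa>)) powr \<alpha>"
        have step: "\<bar>(gs (Suc n) i x - gs n i x) - (gs (Suc n) i y - gs n i y)\<bar> \<le> Ka * dist x y powr \<alpha> * \<theta>^n" for n i x y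
        proof -
          let ?t = "\<bar>(gs (Suc n) i x - gs n i x) - (gs (Suc n) i y - gs n i y)\<bar>"
          have 1: "?t \<le> 2 * (C * s0) * (1/\<rho>)^n"
            using dg[of n i x] dg[of n i y] by (simp add: s_def power_divide)
          have "M n \<le> M (Suc n)" using \<kappa>1 M[of n] by (simp add: sS)
          then have b: "\<bar>Hs (Suc n) i j x - Hs n i j x\<bar> \<le> 2 * M (Suc n)" for j x
            using H[of "Suc n" i j x] H[of n i j x] by linarith
          have 2: "?t \<le> (2 * M (Suc n)) * 2 * dist y x"
            by (rule lip[OF C1_diff[OF Cg Cg] b])
          have "?t \<le> (2 * (C * s0) * (1/\<rho>)^n) powr (1-\<alpha>) * ((2 * M (Suc n)) * 2 * dist y x) powr \<alpha>"
            by (rule interpolation[OF _ 1 2 \<alpha>]) simp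
          also have "(2 * (C * s0) * (1/\<rho>)^n) powr (1-\<alpha>) = (2 * (C * s0)) powr (1-\<alpha>) * (\<rho> powr (\<alpha> - 1))^n"
          proof -
            have "((1/\<rho>)^n) powr (1-\<alpha>) = (\<rho> powr (\<alpha> - 1))^n"
              using \<rho> by (simp add: powr_realpow[symmetric] powr_powr powr_divide powr_minus_divide[symmetric] algebra_simps)
            then show ?thesis using \<rho> C s0 by (simp add: powr_mult)
          qed
          also have "((2 * M (Suc n)) * 2 * dist y x) powr \<alpha> = (4 * (M0 * \<kappa>)) powr \<alpha> * (\<kappa> powr \<alpha>)^n * dist x y powr \<alpha>"
          proof -
            have e: "(2 * M (Suc n)) * 2 * dist y x = (4 * (M0 * \<kappa>)) * \<kappa> ^ n * dist x y"
              by (simp add: M_def dist_commute)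
            have "(\<kappa>^n) powr \<alpha> = (\<kappa> powr \<alpha>)^n" using \<kappa>1
              by (simp add: powr_realpow[symmetric] powr_powr algebra_simps)
            then show ?thesis unfolding e using \<kappa>1 M0 by (simp add: powr_mult)
          qed
          finally show ?thesis by (simp add: Ka_def \<theta>_def power_mult_distrib algebra_simps)
        qed
        have Ka: "Ka \<ge> 0" by (simp add: Ka_def)
        define K0 where "K0 = (2 * G0) powr (1-\<alpha>) * (M0 * 2) powr \<alpha>"
        have base: "\<bar>gs 0 i x - gs 0 i y\<bar> \<le> K0 * dist x y powr \<alpha>" for i x y
        proof -
          have 1: "\<bar>gs 0 i x - gs 0 i y\<bar> \<le> 2 * G0" using g0[rule_format, of i x] g0[rule_format, of i y] unfolding g00 by linarith
          have 2: "\<bar>gs 0 i x - gs 0 i y\<bar> \<le> M0 * 2 * dist y x"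
            by (rule lip[OF Cg]) (use H[of 0] in \<open>simp add: M_def\<close>)
          have "\<bar>gs 0 i x - gs 0 i y\<bar> \<le> (2 * G0) powr (1-\<alpha>) * (M0 * 2 * dist y x) powr \<alpha>"
            by (rule interpolation[OF _ 1 2 \<alpha>]) simp
          then show ?thesis using M0 by (simp add: K0_def powr_mult dist_commute)
        qed
        have sum: "\<bar>gs n i x - gs n i y\<bar> \<le> (K0 + Ka * (\<Sum>k<n. \<theta>^k)) * dist x y powr \<alpha>" for n i x y
        proof (induction n)
          case (Suc n)
          then show ?case using step[of n i x y] by (simp add: algebra_simps)
        qed (use base in simp)
        have "\<bar>gs n i x - gs n i y\<bar> \<le> (K0 + Ka * (1 / (1 - \<theta>))) * dist x y powr \<alpha>" for n i x y
        proof (rule order_trans[OF sum], intro mult_right_mono add_left_mono mult_left_mono Ka)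
          have "(\<Sum>k<n. \<theta>^k) = (1 - \<theta>^n) / (1 - \<theta>)" using \<theta> by (simp add: sum_gp_strict)
          also have "\<dots> \<le> 1 / (1 - \<theta>)" using \<theta> by (intro divide_right_mono) auto
          finally show "(\<Sum>k<n. \<theta>^k) \<le> 1 / (1 - \<theta>)" .
        qed auto
        then have "\<bar>g i x - g i y\<bar> \<le> (K0 + Ka * (1 / (1 - \<theta>))) * dist x y powr \<alpha>" for i x y
          by (intro LIMSEQ_le_const2[OF tendsto_rabs[OF tendsto_diff[OF glim[of i x] glim[of i y]]]]) auto
        then show "\<exists>L. \<forall>i x y. \<bar>g i x - g i y\<bar> \<le> L * dist x y powr \<alpha>" by blast
      qed
    qed
  qed
qed

section \<open>Distributions\<close>

lemma axis_avg_of_pd: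
  assumes "C1 u u'" shows "axis_avg i (u' i) x = u (x + ax i) - u x"
proof -
  have "pd i (axis_avg i u) (axis_avg i (u' i))" by (rule axis_avg_pd_param[OF C1_cont[OF assms] C1_pd[OF assms] C1_cont'[OF assms]])
  from pd_unique[OF this axis_avg_pd[OF C1_cont[OF assms]]] show ?thesis by metis
qed

text \<open>Averaging either mixed derivative over a small square gives the same second difference of \<open>u\<close>.\<close>

lemma mixed_partials:
  assumes u: "C1 u u'" and u': "\<And>i. C1 (u' i) (u'' i)"
  shows "u'' 1 2 = u'' 2 1"
proof (rule ccontr)
  assume "u'' 1 2 \<noteq> u'' 2 1"
  then obtain x where x: "u'' 1 2 x \<noteq> u'' 2 1 x" by auto
  define e where "e = \<bar>u'' 1 2 x - u'' 2 1 x\<bar> / 3"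
  have e: "e > 0" using x by (simp add: e_def)
  have c: "continuous_on UNIV (u'' i j)" for i j using C1_cont'[OF u'] .
  have "\<forall>i j. \<exists>d>0. \<forall>y. dist y x < d \<longrightarrow> \<bar>u'' i j y - u'' i j x\<bar> < e"
    using c e unfolding continuous_on_eq_continuous_at[OF open_UNIV] continuous_at_eps_delta dist_real_def by blast
  then obtain d where d: "\<And>i j. d i j > 0" "\<And>i j y. dist y x < d i j \<Longrightarrow> \<bar>u'' i j y - u'' i j x\<bar> < e" by metis
  define r where "r = min (d 1 2) (d 2 1) / 3"
  have r: "r > 0" "2 * r < d 1 2" "2 * r < d 2 1" using d(1)[of 1 2] d(1)[of 2 1] by (auto simp: r_def)
  \<comment> \<open>In coordinates scaled by \<open>r\<close> the unit intervals of
    \<open>axis_avg\<close> become a square of side \<open>r\<close> with corner \<open>x\<close>,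
    all of whose points are within \<open>2 * r\<close> of \<open>x\<close>.\<close>
  define z where "z = (1/r) *\<^sub>R x"
  have C1: "C1 (\<lambda>y. u (r *\<^sub>R y)) (\<lambda>i y. r * u' i (r *\<^sub>R y))" by (rule C1_scaled[OF u])
  have C2: "C1 (\<lambda>y. r * u' i (r *\<^sub>R y)) (\<lambda>j y. r * (r * u'' i j (r *\<^sub>R y)))" for i
    by (rule C1_cmult[OF C1_scaled[OF u']])
  let ?U = "\<lambda>i j y. r * (r * u'' i j (r *\<^sub>R y))"
  have cU: "continuous_on UNIV (?U i j)" for i j using C1_cont'[OF C2] .
  have "axis_avg 1 (axis_avg 2 (?U 1 2)) z = axis_avg 1 (\<lambda>y. r * u' 1 (r *\<^sub>R (y + ax 2)) - r * u' 1 (r *\<^sub>R y)) z"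
    using axis_avg_of_pd[OF C2, of 2 1] by presburger
  also have "\<dots> = u (r *\<^sub>R (z + ax 1 + ax 2)) - u (r *\<^sub>R (z + ax 2)) - (u (r *\<^sub>R (z + ax 1)) - u (r *\<^sub>R z))"
  proof -
    have s: "continuous_on UNIV (\<lambda>y. r * u' 1 (r *\<^sub>R y))" using C1_cont'[OF C1] .
    have "axis_avg 1 (\<lambda>y. r * u' 1 (r *\<^sub>R (y + ax 2)) - r * u' 1 (r *\<^sub>R y)) z
      = axis_avg 1 (\<lambda>y. r * u' 1 (r *\<^sub>R (y + ax 2))) z - axis_avg 1 (\<lambda>y. r * u' 1 (r *\<^sub>R y)) z"
      by (rule axis_avg_diff[OF cont_shift[OF s] s])
    also have "axis_avg 1 (\<lambda>y. r * u' 1 (r *\<^sub>R (y + ax 2))) z = axis_avg 1 (\<lambda>y. r * u' 1 (r *\<^sub>R y)) (z + ax 2)"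
      unfolding axis_avg_def by (simp add: algebra_simps)
    finally show ?thesis using axis_avg_of_pd[OF C1, of 1] by (simp add: algebra_simps)
  qed
  also have "\<dots> = axis_avg 2 (\<lambda>y. r * u' 2 (r *\<^sub>R (y + ax 1)) - r * u' 2 (r *\<^sub>R y)) z"
  proof -
    have s: "continuous_on UNIV (\<lambda>y. r * u' 2 (r *\<^sub>R y))" using C1_cont'[OF C1] .
    have "axis_avg 2 (\<lambda>y. r * u' 2 (r *\<^sub>R (y + ax 1)) - r * u' 2 (r *\<^sub>R y)) z
      = axis_avg 2 (\<lambda>y. r * u' 2 (r *\<^sub>R (y + ax 1))) z - axis_avg 2 (\<lambda>y. r * u' 2 (r *\<^sub>R y)) z"
      by (rule axis_avg_diff[OF cont_shift[OF s] s])
    also have "axis_avg 2 (\<lambda>y. r * u' 2 (r *\<^sub>R (y + ax 1))) z = axis_avg 2 (\<lambda>y. r * u' 2 (r *\<^sub>R y)) (z + ax 1)"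
      unfolding axis_avg_def by (simp add: algebra_simps)
    finally show ?thesis using axis_avg_of_pd[OF C1, of 2] by (simp add: algebra_simps)
  qed
  also have "\<dots> = axis_avg 2 (axis_avg 1 (?U 2 1)) z"
    using axis_avg_of_pd[OF C2, of 1 2] by presburger
  finally have eq: "axis_avg 1 (axis_avg 2 (?U 1 2)) z = axis_avg 2 (axis_avg 1 (?U 2 1)) z" .
  have b: "\<bar>?U i j (z + t *\<^sub>R ax k + s *\<^sub>R ax k') - r * (r * u'' i j x)\<bar> \<le> r * (r * e)"
    if "t \<in> {0..1}" "s \<in> {0..1}" "2 * r < d i j" for i j k k' t s
  proof -
    have zx: "r *\<^sub>R (z + t *\<^sub>R ax k + s *\<^sub>R ax k') = x + (r * t) *\<^sub>R ax k + (r * s) *\<^sub>R ax k'"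
      using r by (simp add: z_def algebra_simps)
    have "norm ((r * t) *\<^sub>R ax k + (r * s) *\<^sub>R ax k') \<le> r * t + r * s"
      using norm_triangle_ineq[of "(r * t) *\<^sub>R ax k" "(r * s) *\<^sub>R ax k'"] that r by simp
    also have "\<dots> \<le> 2 * r"
    proof -
      have "r * t \<le> r * 1" "r * s \<le> r * 1" using that r by (auto intro!: mult_left_mono)
      then show ?thesis by linarith
    qed
    finally have "dist (r *\<^sub>R (z + t *\<^sub>R ax k + s *\<^sub>R ax k')) x < d i j"
      using that unfolding zx by (simp add: dist_norm add.assoc)
    from d(2)[OF this] show ?thesis using r
      by (simp add: right_diff_distrib[symmetric] abs_mult)
  qed
  have cA: "continuous_on UNIV (axis_avg i (?U j k))" for i j k by (rule axis_avg_cont[OF cU])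
  have 1: "\<bar>axis_avg 1 (axis_avg 2 (?U 1 2)) z - r * (r * u'' 1 2 x)\<bar> \<le> r * (r * e)"
    by (rule axis_avg_bound[OF cA], rule axis_avg_bound[OF cU]) (rule b, auto simp: r)
  have 2: "\<bar>axis_avg 2 (axis_avg 1 (?U 2 1)) z - r * (r * u'' 2 1 x)\<bar> \<le> r * (r * e)"
    by (rule axis_avg_bound[OF cA], rule axis_avg_bound[OF cU]) (rule b, auto simp: r)
  have "\<bar>r * (r * u'' 1 2 x) - r * (r * u'' 2 1 x)\<bar> \<le> 2 * (r * (r * e))" using 1 2 eq by linarith
  moreover have "\<bar>r * (r * u'' 1 2 x) - r * (r * u'' 2 1 x)\<bar> = r * (r * (3 * e))"
    unfolding right_diff_distrib[symmetric] abs_mult using r by (simp add: e_def)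
  ultimately show False using r e by simp
qed

section \<open>Test functions and integration by parts\<close>

lemma C1_partial:
  assumes "C1 u u'" shows "partial i u = u' i"
proof
  fix x
  have "frechet_derivative u (at x) = (\<lambda>h. \<Sum>i\<in>UNIV. u' i x * h $ i)"
    using frechet_derivative_at[OF C1_has_derivative[OF assms]] by simp
  then show "partial i u x = u' i x" 
    using exhaust_2[of i] by (auto simp: partial_def sum_2 axis_nth)
qed

lemma C_k_C1:
  assumes "\<forall>k. \<phi> \<in> C_k k" shows "C1 (iter_partial is \<phi>) (\<lambda>i. iter_partial (i # is) \<phi>)"
proof -
  have d: "iter_partial is \<phi> differentiable (at x)" for x using assms unfolding C_k_def by auto
  have c: "continuous_on UNIV (iter_partial js \<phi>)" for js using assms unfolding C_k_def by blast
  have "((\<lambda>t. iter_partial is \<phi> (x + t *\<^sub>R ax i)) has_real_derivative iter_partial (i # is) \<phi> x) (at 0)" for x i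
  proof -
    let ?u = "iter_partial is \<phi>"
    have D: "(?u has_derivative frechet_derivative ?u (at x)) (at (x + 0 *\<^sub>R ax i))"
      using d[of x] by (simp add: frechet_derivative_works)
    have "((\<lambda>t. x + t *\<^sub>R ax i) has_derivative (\<lambda>t. t *\<^sub>R ax i)) (at 0)"
      by (auto intro!: derivative_eq_intros)
    from has_derivative_compose[OF this D]
    have "((\<lambda>t. ?u (x + t *\<^sub>R ax i)) has_derivative (\<lambda>t. frechet_derivative ?u (at x) (t *\<^sub>R ax i))) (at 0)" .
    moreover have "frechet_derivative ?u (at x) (t *\<^sub>R ax i) = partial i ?u x * t" for t
      using linear_frechet_derivative[OF d[of x]] by (simp add: linear_cmul partial_def)
    ultimately show ?thesis by (simp add: has_field_derivative_def)
  qed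
  then show ?thesis unfolding C1_def pd_def using c[of "is"] c[of "_ # is"] by auto
qed

text \<open>A ball instead of the closed support: the condition passes to derivatives and products
  at once, and all integrals may then run over the whole plane.\<close>

definition csupp :: "(real^2 \<Rightarrow> real) \<Rightarrow> bool" where
  "csupp \<phi> \<longleftrightarrow> (\<exists>R>0. \<forall>x. norm x > R \<longrightarrow> \<phi> x = 0)"

lemma csupp_integrable:
  assumes "continuous_on UNIV u" "csupp u" shows "integrable lborel u"
proof -
  obtain R where R: "\<And>x. norm x > R \<Longrightarrow> u x = 0" using assms csupp_def by auto
  have "integrable lborel (\<lambda>x. indicator (cball 0 R) x *\<^sub>R u x)"
    by (rule borel_integrable_compact) (auto intro: continuous_on_subset[OF assms(1)])
  moreover have "(\<lambda>x. indicator (cball 0 R) x *\<^sub>R u x) = u"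
    by (rule ext) (use R in \<open>auto simp: indicator_def\<close>)
  ultimately show ?thesis by simp
qed

lemma csupp_bounded:
  assumes "continuous_on UNIV u" "csupp u" shows "\<exists>K\<ge>0. \<forall>x. \<bar>u x\<bar> \<le> K"
proof -
  obtain R where R: "\<And>x. norm x > R \<Longrightarrow> u x = 0" using assms csupp_def by auto
  have "compact (u ` cball 0 R)" by (intro compact_continuous_image continuous_on_subset[OF assms(1)]) auto
  then obtain K where K: "\<And>x. x \<in> cball 0 R \<Longrightarrow> \<bar>u x\<bar> \<le> K" using compact_imp_bounded bounded_iff by (metis imageI real_norm_def)
  show ?thesis
  proof (intro exI[of _ "max K 0"] conjI allI)
    show "\<bar>u x\<bar> \<le> max K 0" for x using K[of x] R[of x] by (cases "norm x > R") auto
  qed simp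
qed

lemma csupp_mult: "csupp \<phi> \<Longrightarrow> csupp (\<lambda>x. u x * \<phi> x)" unfolding csupp_def by auto

lemma csupp_pd:
  assumes "C1 u u'" "csupp u" shows "csupp (u' i)"
proof -
  obtain R where R: "R > 0" "\<And>x. norm x > R \<Longrightarrow> u x = 0" using assms csupp_def by auto
  have "u' i x = 0" if x: "norm x > R" for x
  proof -
    have o: "open {t. norm (x + t *\<^sub>R ax i) > R}"
      by (intro open_Collect_less continuous_intros)
    have "((\<lambda>t. u (x + t *\<^sub>R ax i)) has_real_derivative u' i x) (at 0)" using C1_pd[OF assms(1)] pd_def by auto
    moreover have "((\<lambda>t. u (x + t *\<^sub>R ax i)) has_real_derivative 0) (at 0)"
      by (rule has_field_derivative_transform_within_open[OF DERIV_const o]) (use x R in auto)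
    ultimately show ?thesis by (rule DERIV_unique)
  qed
  then show ?thesis using R unfolding csupp_def by auto
qed

text \<open>Translation invariance makes the integral of each difference quotient vanish. The
  quotients converge to the derivative and, with step at most 1, are dominated by a constant on the
  ball of radius \<open>R + 1\<close>.\<close>

lemma integral_pd_zero:
  assumes u: "C1 u u'" and csupp: "csupp u" shows "integral\<^sup>L lborel (u' i) = 0"
proof -
  obtain R where R: "R > 0" "\<And>x. norm x > R \<Longrightarrow> u x = 0" using csupp csupp_def by auto
  obtain K where K: "K \<ge> 0" "\<And>x. \<bar>u' i x\<bar> \<le> K" using csupp_bounded[OF C1_cont'[OF u] csupp_pd[OF u csupp]] by blast
  define F where "F = (\<lambda>n::nat. \<lambda>x. real (Suc n) * (u (x + (1 / real (Suc n)) *\<^sub>R ax i) - u x))"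
  have cu: "continuous_on UNIV u" using C1_cont[OF u] .
  have [measurable]: "u \<in> borel_measurable borel" using cu by (rule borel_measurable_continuous_onI)
  have iu: "integrable lborel u" by (rule csupp_integrable[OF cu csupp])
  have sh: "integral\<^sup>L lborel (\<lambda>x. u (x + c)) = integral\<^sup>L lborel u" "integrable lborel (\<lambda>x. u (x + c))" for c
  proof -
    have "integral\<^sup>L lborel u = integral\<^sup>L (distr lborel borel ((+) c)) u" by (simp add: lborel_distr_plus)
    also have "\<dots> = integral\<^sup>L lborel (\<lambda>x. u (c + x))" by (rule integral_distr) auto
    finally show "integral\<^sup>L lborel (\<lambda>x. u (x + c)) = integral\<^sup>L lborel u" by (simp add: add.commute)
    have "integrable (distr lborel borel ((+) c)) u" using iu by (simp add: lborel_distr_plus)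
    then show "integrable lborel (\<lambda>x. u (x + c))" by (simp add: integrable_distr_eq add.commute)
  qed
  have F0: "integral\<^sup>L lborel (F n) = 0" for n
    unfolding F_def using sh iu by simp
  have "(\<lambda>n. integral\<^sup>L lborel (F n)) \<longlonglongrightarrow> integral\<^sup>L lborel (u' i)"
  proof (rule integral_dominated_convergence[where w = "\<lambda>x. K * indicator (cball 0 (R + 1)) x"])
    show "u' i \<in> borel_measurable lborel" using borel_measurable_continuous_onI[OF C1_cont'[OF u]] by simp
    show "F n \<in> borel_measurable lborel" for n unfolding F_def by measurable
    show "integrable lborel (\<lambda>x :: real^2. K * indicator (cball 0 (R + 1)) x :: real)"
      using borel_integrable_compact[of "cball 0 (R+1) :: (real^2) set" "\<lambda>x. K"] by (simp only: mult.commute real_scaleR_def) auto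
    show "AE x in lborel. (\<lambda>n. F n x) \<longlonglongrightarrow> u' i x"
    proof (rule AE_I2)
      fix x
      have "((\<lambda>t. u (x + t *\<^sub>R ax i)) has_real_derivative u' i x) (at 0)" using C1_pd[OF u] pd_def by auto
      then have l: "((\<lambda>h. (u (x + h *\<^sub>R ax i) - u x) / h) \<longlongrightarrow> u' i x) (at 0)" unfolding DERIV_def by simp
      have f: "filterlim (\<lambda>n. 1 / real (Suc n)) (at 0) sequentially"
        unfolding filterlim_at using lim_inverse_n' LIMSEQ_Suc[OF lim_inverse_n'] by auto
      show "(\<lambda>n. F n x) \<longlonglongrightarrow> u' i x"
        using filterlim_compose[OF l f] by (simp add: F_def mult.commute)
    qed
    show "AE x in lborel. norm (F n x) \<le> K * indicator (cball 0 (R + 1)) x" for n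
    proof (rule AE_I2)
      fix x
      let ?h = "1 / real (Suc n)"
      obtain s where s: "u (x + ?h *\<^sub>R ax i) - u x = ?h * u' i (x + s *\<^sub>R ax i)"
        using C1_mvt_axis[OF u, of ?h x i] by blast
      have "norm (F n x) = \<bar>u' i (x + s *\<^sub>R ax i)\<bar>" unfolding F_def s by simp
      then have 1: "norm (F n x) \<le> K" using K by simp
      show "norm (F n x) \<le> K * indicator (cball 0 (R + 1)) x"
      proof (cases "x \<in> cball 0 (R+1)")
        case False
        then have "norm x > R + 1" by simp
        moreover have "norm x \<le> norm (x + ?h *\<^sub>R ax i) + norm (?h *\<^sub>R ax i)"
          using norm_triangle_ineq4[of "x + ?h *\<^sub>R ax i" "?h *\<^sub>R ax i"] by simp
        moreover have "norm (?h *\<^sub>R ax i) \<le> 1" by simp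
        ultimately have "norm (x + ?h *\<^sub>R ax i) > R" "norm x > R" by linarith+
        then show ?thesis using R False by (simp add: F_def)
      qed (use 1 in simp)
    qed
  qed
  then show ?thesis unfolding F0 by (simp add: LIMSEQ_const_iff)
qed

lemma integration_by_parts:
  assumes u: "C1 u u'" and f: "C1 \<phi> \<phi>'" and csupp: "csupp \<phi>"
  shows "integral\<^sup>L lborel (\<lambda>x. u' i x * \<phi> x) = - integral\<^sup>L lborel (\<lambda>x. u x * \<phi>' i x)"
proof -
  have "integral\<^sup>L lborel (\<lambda>x. u' i x * \<phi> x + u x * \<phi>' i x) = 0"
    by (rule integral_pd_zero[OF C1_mult[OF u f] csupp_mult[OF csupp]])
  moreover have "integrable lborel (\<lambda>x. u' i x * \<phi> x)" "integrable lborel (\<lambda>x. u x * \<phi>' i x)"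
    using csupp_mult[OF csupp] csupp_mult[OF csupp_pd[OF f csupp]] C1_cont[OF u] C1_cont'[OF u] C1_cont[OF f] C1_cont'[OF f]
    by (auto intro!: csupp_integrable continuous_intros)
  ultimately show ?thesis by simp
qed

text \<open>Symmetric gradients lie in the kernel of \<open>curl curl\<close>. As \<open>w\<close>
  is only C1, a single derivative is moved; the third derivatives of \<open>\<phi>\<close> that
  arise cancel in pairs by symmetry of mixed derivatives. This is what removes \<open>w\<close> from
  the final equation.\<close>

lemma symmetric_gradient_curl_curl:
  assumes w: "\<And>i. C1 (w i) (W i)" and f: "\<forall>k. \<phi> \<in> C_k k" and csupp: "csupp \<phi>"
  shows "integral\<^sup>L lborel (\<lambda>x. W 1 1 x * iter_partial [2,2] \<phi> x + W 2 2 x * iter_partial [1,1] \<phi> x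
     - (W 1 2 x + W 2 1 x) * iter_partial [2,1] \<phi> x) = 0"
proof -
  note C = C_k_C1[OF f]
  have cp: "csupp (iter_partial is \<phi>)" for "is"
    by (induction "is") (use csupp csupp_pd[OF C] in auto)
  have sym: "iter_partial [1,2] \<psi> = iter_partial [2,1] \<psi>" if "\<forall>k. \<psi> \<in> C_k k" for \<psi>
    using mixed_partials[OF C_k_C1[OF that, of "[]"] C_k_C1[OF that, of "[_]"]] by simp
  have sym': "iter_partial [1,2,i] \<phi> = iter_partial [2,1,i] \<phi>" for i
    using mixed_partials[OF C[of "[i]"] C[of "[_,i]"]] by simp
  have p: "integral\<^sup>L lborel (\<lambda>x. W i j x * iter_partial js \<phi> x) = - integral\<^sup>L lborel (\<lambda>x. w i x * iter_partial (j # js) \<phi> x)" for i j js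
    by (rule integration_by_parts[OF w C cp])
  have i: "integrable lborel (\<lambda>x. W i j x * iter_partial js \<phi> x)" for i j js
    using csupp_mult[OF cp] C1_cont'[OF w] C1_cont[OF C] by (auto intro!: csupp_integrable continuous_intros)
  have "iter_partial [1,2,2] \<phi> = iter_partial [2,2,1] \<phi>" 
  proof -
    have "iter_partial [1,2,2] \<phi> = iter_partial [2,1,2] \<phi>" by (rule sym')
    also have "\<dots> = iter_partial [2,2,1] \<phi>" using sym[OF f] by simp
    finally show ?thesis .
  qed
  moreover have "iter_partial [2,1,1] \<phi> = iter_partial [1,2,1] \<phi>" using sym'[of 1] by simp
  ultimately show ?thesis
    using p[of 1 1 "[2,2]"] p[of 2 2 "[1,1]"] p[of 1 2 "[2,1]"] p[of 2 1 "[2,1]"] i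
    by (simp add: distrib_right del: iter_partial.simps)
qed

text \<open>A family closed under differentiation that contains the standard flat function \<open>exp (- 1 / t)\<close>.\<close>

definition psi :: "nat \<Rightarrow> real \<Rightarrow> real" where
  "psi k t = (if t > 0 then exp (- (1 / t)) * (1 / t) ^ k else 0)"

lemma power_le_fact_exp: assumes "x \<ge> 0" shows "x ^ m / fact m \<le> exp (x::real)"
proof -
  have "(\<lambda>n. x ^ n /\<^sub>R fact n) sums exp x" by (rule exp_converges)
  then have e: "summable (\<lambda>n. x ^ n /\<^sub>R fact n)" "exp x = (\<Sum>n. x ^ n /\<^sub>R fact n)"
    by (auto simp: sums_iff)
  have "(\<Sum>n\<in>{m}. x ^ n /\<^sub>R fact n) \<le> exp x"
    unfolding e(2) by (rule sum_le_suminf[OF e(1)]) (use assms in auto)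
  then show ?thesis by (simp add: field_simps)
qed

text \<open>One term of the exponential series already beats the power \<open>k + 2\<close>. The two
  spare powers of \<open>t\<close> make the difference quotient at 0 tend to 0.\<close>

lemma psi_small: assumes "t > 0" shows "psi k t \<le> fact (k + 2) * t\<^sup>2"
proof -
  define y where "y = 1 / t"
  have y: "y > 0" "t = 1 / y" using assms by (auto simp: y_def)
  have "y ^ (k + 2) \<le> fact (k + 2) * exp y"
    using power_le_fact_exp[of y "k + 2"] y by (simp only: pos_divide_le_eq fact_gt_zero mult.commute less_imp_le)
  then have "y ^ (k + 2) * exp (- y) \<le> (fact (k + 2) * exp y) * exp (- y)"
    by (rule mult_right_mono) simp
  also have "\<dots> = fact (k + 2) * (exp y * exp (- y))" by (rule mult.assoc)
  also have "exp y * exp (- y) = 1" by (simp add: exp_minus)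
  finally have "(exp (- y) * y ^ k) * y\<^sup>2 \<le> fact (k + 2)" by (simp only: power_add mult_1_right mult_ac)
  then have "exp (- y) * y ^ k \<le> fact (k + 2) / y\<^sup>2" using y by (simp only: pos_le_divide_eq zero_less_power)
  then show ?thesis using assms by (simp add: psi_def y_def power_one_over)
qed

lemma psi_deriv: "(psi k has_real_derivative psi (k + 2) t - real k * psi (k + 1) t) (at t)"
proof -
  consider "t > 0" | "t < 0" | "t = 0" by linarith
  then show ?thesis
  proof cases
    case 1
    have d: "((\<lambda>t. 1 / t) has_real_derivative - ((1 / t)\<^sup>2)) (at t)"
      using 1 by (auto intro!: derivative_eq_intros simp: power2_eq_square)
    have "((\<lambda>t. exp (- (1 / t)) * (1 / t) ^ k) has_real_derivative 
       (exp (- (1 / t)) * - (- ((1 / t)\<^sup>2))) * (1 / t) ^ k + (real k * (- ((1 / t)\<^sup>2) * (1 / t) ^ (k - Suc 0))) * exp (- (1 / t))) (at t)"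
      by (rule DERIV_mult[OF DERIV_chain2[OF DERIV_exp DERIV_minus[OF d]] DERIV_power[OF d]])
    also have "(exp (- (1 / t)) * - (- ((1 / t)\<^sup>2))) * (1 / t) ^ k + (real k * (- ((1 / t)\<^sup>2) * (1 / t) ^ (k - Suc 0))) * exp (- (1 / t))
      = psi (k + 2) t - real k * psi (k + 1) t"
      using 1 by (cases k) (simp_all add: psi_def power2_eq_square algebra_simps)
    finally show ?thesis
      by (rule has_field_derivative_transform_within_open[where S = "{0<..}"]) (use 1 in \<open>auto simp: psi_def\<close>)
  next
    case 2
    have "((\<lambda>t. 0) has_real_derivative psi (k + 2) t - real k * psi (k + 1) t) (at t)"
      using 2 by (simp add: psi_def)
    then show ?thesis
      by (rule has_field_derivative_transform_within_open[where S = "{..<0}"]) (use 2 in \<open>auto simp: psi_def\<close>)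
  next
    case 3
    have "((\<lambda>h. psi k h / h) \<longlongrightarrow> 0) (at 0)"
    proof (rule Lim_null_comparison)
      have "\<bar>psi k h / h\<bar> \<le> fact (k + 2) * \<bar>h\<bar>" for h
      proof (cases "h > 0")
        case True
        then have "psi k h / h \<le> fact (k + 2) * h\<^sup>2 / h" using psi_small by (intro divide_right_mono) auto
        moreover have "psi k h \<ge> 0" using True by (simp add: psi_def)
        ultimately show ?thesis using True by (simp add: power2_eq_square)
      next
        case False
        then have "\<bar>psi k h / h\<bar> = 0" by (simp add: psi_def)
        also have "0 \<le> fact (k + 2) * \<bar>h\<bar>" by (intro mult_nonneg_nonneg) (auto simp del: fact_Suc)
        finally show ?thesis .
      qed
      then show "\<forall>\<^sub>F h in at 0. norm (psi k h / h) \<le> fact (k + 2) * \<bar>h\<bar>" by simp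
      show "((\<lambda>h. fact (k + 2) * \<bar>h\<bar> :: real) \<longlongrightarrow> 0) (at 0)" by (auto intro!: tendsto_eq_intros)
    qed
    then show ?thesis using 3 by (simp add: DERIV_def psi_def)
  qed
qed

text \<open>A syntactic class that is closed under partial derivatives. Continuous differentiability
  of its members thus spreads to all iterated derivatives by induction on the list of
  indices.\<close>

inductive smooth :: "(real^2 \<Rightarrow> real) \<Rightarrow> bool" where
  "smooth (\<lambda>x. c)"
| "smooth (\<lambda>x. x $ i)"
| "smooth u \<Longrightarrow> smooth v \<Longrightarrow> smooth (\<lambda>x. u x + v x)"
| "smooth u \<Longrightarrow> smooth v \<Longrightarrow> smooth (\<lambda>x. u x * v x)"
| "smooth u \<Longrightarrow> smooth (\<lambda>x. psi k (u x))"

lemma smooth_C1: "smooth u \<Longrightarrow> \<exists>u'. C1 u u' \<and> (\<forall>i. smooth (u' i))"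
proof (induction rule: smooth.induct)
  case (1 c)
  show ?case using C1_const[of c] smooth.intros(1)[of 0] by (intro exI conjI allI)
next
  case (2 i)
  show ?case by (rule exI, rule conjI, rule C1_nth) (auto intro: smooth.intros)
next
  case (3 u v)
  then obtain u' v' where *: "C1 u u'" "C1 v v'" "\<And>i. smooth (u' i)" "\<And>i. smooth (v' i)" by blast
  show ?case by (intro exI conjI allI, rule C1_add[OF *(1,2)]) (intro smooth.intros *)
next
  case (4 u v)
  then obtain u' v' where *: "C1 u u'" "C1 v v'" "\<And>i. smooth (u' i)" "\<And>i. smooth (v' i)" by blast
  show ?case by (intro exI conjI allI, rule C1_mult[OF *(1,2)]) (intro smooth.intros * 4)
next
  case (5 u k)
  then obtain u' where *: "C1 u u'" "\<And>i. smooth (u' i)" by blast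
  have c: "continuous_on S (psi k)" for S k
    using psi_deriv[of k] by (intro DERIV_continuous_on) (auto intro: has_field_derivative_at_within)
  have "C1 (\<lambda>x. psi k (u x)) (\<lambda>i x. (psi (k + 2) (u x) - real k * psi (k + 1) (u x)) * u' i x)"
    by (rule C1_compose[OF *(1) psi_deriv]) (intro continuous_intros c)
  moreover have "smooth (\<lambda>x. (psi (k + 2) (u x) + (- real k) * psi (k + 1) (u x)) * u' i x)" for i
    by (intro smooth.intros * 5)
  ultimately show ?case by (intro exI conjI allI) (assumption, simp)
qed

lemma smooth_iter_partial: "smooth u \<Longrightarrow> smooth (iter_partial is u)"
proof (induction "is")
  case (Cons i "is")
  then obtain u' where "C1 (iter_partial is u) u'" "\<forall>i. smooth (u' i)" using smooth_C1 by blast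
  then show ?case using C1_partial by simp
qed simp

lemma smooth_C_k: assumes "smooth u" shows "u \<in> C_k k"
proof -
  have "\<exists>u'. C1 (iter_partial is u) u'" for "is" using smooth_C1[OF smooth_iter_partial[OF assms]] by blast
  then have "iter_partial is u differentiable (at x)" "continuous_on UNIV (iter_partial is u)" for "is" x
    using C1_has_derivative C1_cont unfolding differentiable_def by blast+
  then show ?thesis unfolding C_k_def by auto
qed

text \<open>Each argument of \<open>psi 0\<close> is positive exactly between the two sides of the
  box. Since \<open>psi 0\<close> tends to 1 at infinity, the factor \<open>Suc n\<close> makes the
  bumps converge to the indicator of the open box while their supports stay in the closed
  one.\<close>

definition bump :: "real^2 \<Rightarrow> real^2 \<Rightarrow> nat \<Rightarrow> real^2 \<Rightarrow> real" where
  "bump a b n x = psi 0 ((x$1 - a$1) * (b$1 - x$1) * real (Suc n)) * psi 0 ((x$2 - a$2) * (b$2 - x$2) * real (Suc n))"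

lemma psi0: "psi 0 t = (if t > 0 then exp (- (1 / t)) else 0)" by (simp add: psi_def)

lemma bump_smooth: "smooth (bump a b n)"
proof -
  have "smooth (\<lambda>x. psi 0 ((x$1 + (- a$1)) * (b$1 + (-1) * x$1) * real (Suc n)) * psi 0 ((x$2 + (- a$2)) * (b$2 + (-1) * x$2) * real (Suc n)))"
    by (intro smooth.intros)
  then show ?thesis by (simp add: bump_def[abs_def])
qed

lemma bump_bounds: "0 \<le> bump a b n x" "bump a b n x \<le> 1"
  unfolding bump_def by (auto simp: psi0 intro!: mult_le_one)

lemma box2: "x \<in> box a b \<longleftrightarrow> a$1 < x$1 \<and> x$1 < b$1 \<and> a$2 < x$2 \<and> x$2 < b$2" for x :: "real^2"
  by (auto simp: mem_box_cart forall_2)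

lemma bump_zero:
  assumes "a$1 \<le> b$1" "a$2 \<le> b$2" "x \<notin> box a b" shows "bump a b n x = 0"
proof -
  have "(x$1 - a$1) * (b$1 - x$1) \<le> 0 \<or> (x$2 - a$2) * (b$2 - x$2) \<le> 0"
    using assms unfolding box2 by (auto simp: mult_le_0_iff)
  then show ?thesis unfolding bump_def psi0
    by (auto simp: zero_less_mult_iff not_less mult_le_0_iff)
qed

lemma bump_limit:
  assumes "a$1 \<le> b$1" "a$2 \<le> b$2"
  shows "(\<lambda>n. bump a b n x) \<longlonglongrightarrow> indicator (box a b) x"
proof (cases "x \<in> box a b")
  case True
  have l: "(\<lambda>n. psi 0 (c * real (Suc n))) \<longlonglongrightarrow> 1" if "c > 0" for c
  proof -
    have "(\<lambda>n. (1 / c) * (1 / real (Suc n))) \<longlonglongrightarrow> (1/c) * 0"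
      by (rule tendsto_mult_left[OF LIMSEQ_Suc[OF lim_inverse_n']])
    then have "(\<lambda>n. exp (- ((1 / c) * (1 / real (Suc n))))) \<longlonglongrightarrow> exp (- ((1/c) * 0))"
      by (rule tendsto_exp[OF tendsto_minus])
    then show ?thesis using that by (simp add: psi0)
  qed
  have "(\<lambda>n. bump a b n x) \<longlonglongrightarrow> 1 * 1"
    unfolding bump_def by (intro tendsto_mult l) (use True in \<open>auto simp: box2\<close>)
  then show ?thesis using True by simp
qed (use assms in \<open>simp add: bump_zero\<close>)

lemma bump_test:
  assumes "a$1 \<le> b$1" "a$2 \<le> b$2" "cbox a b \<subseteq> \<Omega>" shows "bump a b n \<in> test_functions \<Omega>"
proof -
  have s0: "{x. bump a b n x \<noteq> 0} \<subseteq> cbox a b" using bump_zero[OF assms(1,2)] box_subset_cbox[of a b] by blast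
  then have s: "closure {x. bump a b n x \<noteq> 0} \<subseteq> cbox a b" by (rule closure_minimal) (rule closed_cbox)
  have "compact (closure {x. bump a b n x \<noteq> 0})"
    unfolding compact_closure using bounded_subset[OF bounded_cbox s0] by blast
  then show ?thesis using smooth_C_k[OF bump_smooth] s assms(3) unfolding test_functions_def by auto
qed

section \<open>The fundamental lemma of the calculus of variations\<close>

lemma AE_zero_if_box_integrals_zero:
  fixes f :: "real^2 \<Rightarrow> real"
  assumes f: "integrable lborel f" and z: "\<And>a b. (LINT x:box a b|lborel. f x) = 0"
  shows "AE x in lborel. f x = 0"
proof -
  have si: "set_integrable lborel A f" if "A \<in> sets lborel" for A
    unfolding set_integrable_def by (rule integrable_mult_indicator[OF that f])
  \<comment> \<open>The complement step of the induction below subtracts from the integral over the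
    whole plane, so this value is needed beforehand.\<close>
  have U: "(LINT x:UNIV|lborel. f x) = 0"
  proof -
    define A where "A = (\<lambda>n::nat. box (- (real n *\<^sub>R One)) (real n *\<^sub>R One) :: (real^2) set)"
    have inc: "incseq A"
      unfolding A_def by (rule incseq_SucI) (rule subset_box_imp(4), simp)
    have "(\<lambda>n. LINT x:A n|lborel. f x) \<longlonglongrightarrow> (LINT x:(\<Union>n. A n)|lborel. f x)"
      by (rule set_integral_cont_up[OF _ inc si]) (auto simp: A_def)
    moreover have "(LINT x:A n|lborel. f x) = 0" for n unfolding A_def by (rule z)
    moreover have "(\<Union>n. A n) = UNIV" unfolding A_def by (rule UN_box_eq_UNIV)
    ultimately show ?thesis by (simp add: LIMSEQ_const_iff)
  qed
  have sb: "sets lborel = sigma_sets UNIV (range (\<lambda>(a, b). box a b :: (real^2) set))"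
    by (simp add: borel_eq_box)
  \<comment> \<open>Boxes generate the Borel sets and are stable under intersection, so induction
    over disjoint unions and complements reaches every Borel set.\<close>
  have z0: "(LINT x:A|lborel. f x) = 0" if "A \<in> sigma_sets UNIV (range (\<lambda>(a, b). box a b :: (real^2) set))" for A
  proof (rule sigma_sets_induct_disjoint[OF _ _ that])
    show "Int_stable (range (\<lambda>(a, b). box a b :: (real^2) set))"
      by (auto simp: Int_stable_def box_Int_box)
    show "range (\<lambda>(a, b). box a b :: (real^2) set) \<subseteq> Pow UNIV" by simp
  next
    fix A assume "A \<in> range (\<lambda>(a, b). box a b :: (real^2) set)"
    then obtain a b where "A = box a b" by auto
    then show "(LINT x:A|lborel. f x) = 0" using z by simp
  next
    show "(LINT x:{}|lborel. f x) = 0" by (simp add: set_lebesgue_integral_def)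
  next
    fix A assume "A \<in> sigma_sets UNIV (range (\<lambda>(a, b). box a b :: (real^2) set))" and zA: "(LINT x:A|lborel. f x) = 0"
    then have A: "A \<in> sets lborel" unfolding sb by simp
    then have A': "UNIV - A \<in> sets lborel" using sets.Diff[OF sets.top[of lborel] A] by simp
    have "(LINT x:A \<union> (UNIV - A)|lborel. f x) = (LINT x:A|lborel. f x) + (LINT x:UNIV - A|lborel. f x)"
      by (rule set_integral_Un[OF _ si[OF A] si[OF A']]) auto
    moreover have "A \<union> (UNIV - A) = UNIV" by auto
    ultimately show "(LINT x:UNIV - A|lborel. f x) = 0" using zA U by simp
  next
    fix A :: "nat \<Rightarrow> (real^2) set"
    assume d: "disjoint_family A" and "range A \<subseteq> sigma_sets UNIV (range (\<lambda>(a, b). box a b :: (real^2) set))"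
      and zA: "\<And>i. (LINT x:A i|lborel. f x) = 0"
    then have A: "A i \<in> sets lborel" for i unfolding sb by auto
    have "(LINT x:(\<Union>i. A i)|lborel. f x) = (\<Sum>i. LINT x:A i|lborel. f x)"
    proof (rule lebesgue_integral_countable_add[OF A])
      show "A i \<inter> A j = {}" if "i \<noteq> j" for i j using d that by (auto simp: disjoint_family_on_def)
      show "set_integrable lborel (\<Union>i. A i) f" by (rule si) (use A in auto)
    qed
    then show "(LINT x:\<Union>(range A)|lborel. f x) = 0" using zA by simp
  qed
  have "(LINT x:A|lborel. f x) = (LINT x:A|lborel. 0)" if "A \<in> sets lborel" for A
    using z0[OF that[unfolded sb]] by (simp add: set_lebesgue_integral_def)
  then show ?thesis by (rule density_unique_real[OF f integrable_zero])
qed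

lemma test_functionsD:
  assumes "\<phi> \<in> test_functions \<Omega>"
  shows "\<forall>k. \<phi> \<in> C_k k" "csupp \<phi>" "\<And>x. x \<notin> \<Omega> \<Longrightarrow> \<phi> x = 0" "C1 \<phi> (\<lambda>i. partial i \<phi>)"
    "compact (closure {x. \<phi> x \<noteq> 0})" "closure {x. \<phi> x \<noteq> 0} \<subseteq> \<Omega>"
proof -
  show 1: "\<forall>k. \<phi> \<in> C_k k" and 2: "compact (closure {x. \<phi> x \<noteq> 0})" "closure {x. \<phi> x \<noteq> 0} \<subseteq> \<Omega>"
    using assms unfolding test_functions_def by auto
  have cl: "\<phi> x = 0" if "x \<notin> closure {x. \<phi> x \<noteq> 0}" for x :: "real^2"
    using that closure_subset[of "{x. \<phi> x \<noteq> 0}"] by blast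
  show "\<phi> x = 0" if "x \<notin> \<Omega>" for x
    by (rule cl) (use 2(2) that in blast)
  show "C1 \<phi> (\<lambda>i. partial i \<phi>)" using C_k_C1[OF 1, of "[]"] by simp
  obtain R where R: "\<forall>x\<in>closure {x. \<phi> x \<noteq> 0}. norm x \<le> R"
    using compact_imp_bounded[OF 2(1)] unfolding bounded_iff by blast
  show "csupp \<phi>" unfolding csupp_def
  proof (intro exI[of _ "max R 1"] conjI allI impI)
    fix x :: "real^2" assume "norm x > max R 1"
    then have "x \<notin> closure {x. \<phi> x \<noteq> 0}" using R by force
    then show "\<phi> x = 0" by (rule cl)
  qed simp
qed

lemma test_functions_partial:
  assumes \<phi>: "\<phi> \<in> test_functions \<Omega>" shows "partial i \<phi> \<in> test_functions \<Omega>"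
proof -
  note t = test_functionsD[OF \<phi>]
  have ip: "iter_partial is (partial i \<phi>) = iter_partial (is @ [i]) \<phi>" for "is"
    by (induction "is") auto
  have 1: "partial i \<phi> \<in> C_k k" for k
  proof -
    have "\<phi> \<in> C_k (Suc k)" using t(1) by (rule spec)
    then have "\<forall>js. length js < Suc k \<longrightarrow> (\<forall>x. iter_partial js \<phi> differentiable (at x))"
      "\<forall>js. length js \<le> Suc k \<longrightarrow> continuous_on UNIV (iter_partial js \<phi>)"
      unfolding C_k_def by simp_all
    then show ?thesis unfolding C_k_def mem_Collect_eq ip by simp
  qed
  have sub: "{x. partial i \<phi> x \<noteq> 0} \<subseteq> closure {x. \<phi> x \<noteq> 0}"
  proof (rule subsetI, rule ccontr)
    fix x assume "x \<in> {x. partial i \<phi> x \<noteq> 0}" and xc: "x \<notin> closure {x. \<phi> x \<noteq> 0}"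
    then have x: "partial i \<phi> x \<noteq> 0" by simp
    let ?O = "(\<lambda>t. x + t *\<^sub>R ax i) -` (- closure {x. \<phi> x \<noteq> 0})"
    have "continuous_on UNIV (\<lambda>t::real. x + t *\<^sub>R ax i)" by (intro continuous_intros)
    then have o: "open ?O" by (intro open_vimage open_Compl closed_closure)
    have "((\<lambda>t. \<phi> (x + t *\<^sub>R ax i)) has_real_derivative 0) (at 0)"
    proof (rule has_field_derivative_transform_within_open[OF DERIV_const o])
      show "0 \<in> ?O" using xc by simp
      fix t assume "t \<in> ?O"
      then have "x + t *\<^sub>R ax i \<notin> {x. \<phi> x \<noteq> 0}" using closure_subset[of "{x. \<phi> x \<noteq> 0}"] by blast
      then show "0 = \<phi> (x + t *\<^sub>R ax i)" by simp
    qed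
    moreover have "((\<lambda>t. \<phi> (x + t *\<^sub>R ax i)) has_real_derivative partial i \<phi> x) (at 0)"
      using C1_pd[OF t(4), of i] unfolding pd_def by blast
    ultimately show False using x DERIV_unique by blast
  qed
  have cl: "closure {x. partial i \<phi> x \<noteq> 0} \<subseteq> closure {x. \<phi> x \<noteq> 0}"
    by (rule closure_minimal[OF sub closed_closure])
  have co: "compact (closure {x. partial i \<phi> x \<noteq> 0})"
    unfolding compact_closure by (rule bounded_subset[OF compact_imp_bounded[OF t(5)] sub])
  show ?thesis unfolding test_functions_def
    by (intro CollectI conjI allI 1 co order_trans[OF cl t(6)])
qed

lemma regular_lebesgue:
  assumes "open \<Omega>" "\<And>x. x \<notin> \<Omega> \<Longrightarrow> \<phi> x = 0"
  shows "regular \<Omega> h \<phi> = (LINT x|lebesgue. h x * \<phi> x)"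
proof -
  have "regular \<Omega> h \<phi> = (LINT x|lebesgue. indicator \<Omega> x *\<^sub>R (h x * \<phi> x))"
    unfolding regular_def by (rule integral_restrict_space) (use assms in auto)
  also have "(\<lambda>x. indicator \<Omega> x *\<^sub>R (h x * \<phi> x)) = (\<lambda>x. h x * \<phi> x)"
    by (rule ext) (use assms(2) in \<open>auto simp: indicator_def\<close>)
  finally show ?thesis .
qed

lemma Lp_loc_1_integrable:
  assumes "h \<in> Lp_loc 1 \<Omega>" "compact K" "K \<subseteq> \<Omega>"
  shows "integrable lebesgue (\<lambda>x. indicator K x * h x)"
proof -
  have K: "K \<in> sets lebesgue" using assms(2) by (simp add: compact_imp_closed lebesgue_closedin borel_closed)
  have m: "h \<in> borel_measurable (lebesgue_on K)" and i: "integrable (lebesgue_on K) (\<lambda>x. \<bar>h x\<bar> powr 1)"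
    using assms unfolding Lp_loc_def Lp_def by auto
  have "integrable (lebesgue_on K) (\<lambda>x. norm (h x))" using i by simp
  then have "integrable (lebesgue_on K) h" by (rule integrable_norm_iff[THEN iffD1, OF m])
  then show ?thesis using K by (subst (asm) integrable_restrict_space) auto
qed

lemma test_product_integrable:
  assumes "h \<in> Lp_loc 1 \<Omega>" "\<phi> \<in> test_functions \<Omega>"
  shows "integrable lebesgue (\<lambda>x. h x * \<phi> x)"
proof -
  note t = test_functionsD[OF assms(2)]
  have c: "continuous_on UNIV \<phi>" using C1_cont[OF t(4)] .
  obtain B where B: "\<And>x. \<bar>\<phi> x\<bar> \<le> B" using csupp_bounded[OF c t(2)] by blast
  let ?K = "closure {x. \<phi> x \<noteq> 0}"
  have "integrable lebesgue (\<lambda>x. \<phi> x * (indicator ?K x * h x))"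
  proof (rule Bochner_Integration.integrable_bound)
    show "integrable lebesgue (\<lambda>x. B * (indicator ?K x * h x))"
      by (intro integrable_mult_right Lp_loc_1_integrable[OF assms(1) t(5,6)])
    have "\<phi> \<in> borel_measurable lebesgue"
      using borel_measurable_continuous_onI[OF c] by (simp add: measurable_completion)
    then show "(\<lambda>x. \<phi> x * (indicator ?K x * h x)) \<in> borel_measurable lebesgue"
      using borel_measurable_integrable[OF Lp_loc_1_integrable[OF assms(1) t(5,6)]] by measurable
    show "AE x in lebesgue. norm (\<phi> x * (indicator ?K x * h x)) \<le> norm (B * (indicator ?K x * h x))"
    proof (rule AE_I2)
      fix x have "\<bar>\<phi> x\<bar> \<le> \<bar>B\<bar>" using B[of x] by linarith
      then show "norm (\<phi> x * (indicator ?K x * h x)) \<le> norm (B * (indicator ?K x * h x))"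
        unfolding real_norm_def abs_mult by (rule mult_right_mono) auto
    qed
  qed
  moreover have "(\<lambda>x. \<phi> x * (indicator ?K x * h x)) = (\<lambda>x. h x * \<phi> x)"
  proof
    fix x show "\<phi> x * (indicator ?K x * h x) = h x * \<phi> x"
      using closure_subset[of "{x. \<phi> x \<noteq> 0}"] by (cases "\<phi> x = 0") (auto simp: indicator_def)
  qed
  ultimately show ?thesis by simp
qed

text \<open>Bumps approximate indicators of boxes by dominated convergence, so the integrals over
  all small boxes vanish. The argument runs inside one closed box, where \<open>h\<close> is
  integrable, and countably many closed boxes exhaust \<open>\<Omega>\<close>.\<close>

lemma fundamental_lemma:
  assumes "open \<Omega>" and h: "h \<in> Lp_loc 1 \<Omega>" and z: "\<And>\<phi>. \<phi> \<in> test_functions \<Omega> \<Longrightarrow> (LINT x|lebesgue. h x * \<phi> x) = 0"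
  shows "AE x in lebesgue. x \<in> \<Omega> \<longrightarrow> h x = 0"
proof -
  have cb: "AE x in lebesgue. x \<in> cbox a b \<longrightarrow> h x = 0" if ab: "cbox a b \<subseteq> \<Omega>" for a b
  proof -
    define f where "f = (\<lambda>x. indicator (cbox a b) x * h x)"
    have f: "integrable lebesgue f" unfolding f_def by (rule Lp_loc_1_integrable[OF h compact_cbox ab])
    \<comment> \<open>Passing to a Borel representative moves the question from the completed
      measure to \<open>lborel\<close>, on which the uniqueness lemma is stated.\<close>
    have "f \<in> borel_measurable (completion lborel)" using f by auto
    then obtain f' where f': "f' \<in> borel_measurable lborel" "AE x in lborel. f x = f' x"
      using completion_ex_borel_measurable_real by blast
    then have ae: "AE x in lebesgue. f x = f' x" by (simp add: AE_completion)
    have f'm: "f' \<in> borel_measurable lebesgue" using f'(1) measurable_completion by blast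
    have "integrable lebesgue f'" using integrable_cong_AE_imp[OF f f'm] ae by (simp add: eq_commute)
    then have f'i: "integrable lborel f'" using f'(1) by (simp add: integrable_completion)
    let ?g = "\<lambda>x. indicator (box a b) x * f' x"
    have g: "integrable lborel ?g" using integrable_mult_indicator[OF _ f'i, of "box a b"] by simp
    have "AE x in lborel. ?g x = 0"
    proof (rule AE_zero_if_box_integrals_zero[OF g])
      fix c d :: "real^2"
      obtain c' d' where cd: "box c d \<inter> box a b = box c' d'" by (rule that[OF box_Int_box])
      have sub: "box c' d' \<subseteq> box a b" using cd by blast
      have "(LINT x:box c d|lborel. ?g x) = (LINT x|lborel. indicator (box c' d') x * f' x)"
        unfolding set_lebesgue_integral_def cd[symmetric] by (simp add: indicator_inter_arith mult.assoc)
      also have "\<dots> = 0"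
      proof (cases "box c' d' = {}")
        case False
        then have le: "c'$1 \<le> d'$1" "c'$2 \<le> d'$2" by (auto simp: box2)
        have "cbox c' d' \<subseteq> cbox a b" 
          using closure_minimal[OF order_trans[OF sub box_subset_cbox] closed_cbox] closure_box[OF False] by simp
        then have csupp: "cbox c' d' \<subseteq> \<Omega>" using ab by blast
        note t = bump_test[OF le csupp]
        have "(\<lambda>n. LINT x|lborel. bump c' d' n x * f' x) \<longlonglongrightarrow> (LINT x|lborel. indicator (box c' d') x * f' x)"
        proof (rule integral_dominated_convergence[where w = "\<lambda>x. \<bar>f' x\<bar>"])
          have [measurable]: "bump c' d' n \<in> borel_measurable borel" for n
            by (rule borel_measurable_continuous_onI) (rule C1_cont[OF test_functionsD(4)[OF t]])
          have [measurable]: "f' \<in> borel_measurable borel" using f'(1) by simp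
          show "(\<lambda>x. indicator (box c' d') x * f' x) \<in> borel_measurable lborel" by simp
          show "(\<lambda>x. bump c' d' n x * f' x) \<in> borel_measurable lborel" for n by simp
          show "integrable lborel (\<lambda>x. \<bar>f' x\<bar>)" using f'i by simp
          show "AE x in lborel. (\<lambda>n. bump c' d' n x * f' x) \<longlonglongrightarrow> indicator (box c' d') x * f' x"
            by (intro AE_I2 tendsto_intros bump_limit le)
          show "AE x in lborel. norm (bump c' d' n x * f' x) \<le> \<bar>f' x\<bar>" for n
            by (intro AE_I2) (use bump_bounds[of c' d' n] in \<open>auto simp: abs_mult mult_left_le_one_le\<close>)
        qed
        moreover have "(LINT x|lborel. bump c' d' n x * f' x) = 0" for n
        proof -
          have m: "(\<lambda>x. bump c' d' n x * f' x) \<in> borel_measurable lborel"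
            using f'(1) borel_measurable_continuous_onI[OF C1_cont[OF test_functionsD(4)[OF t]]] by simp
          have "(LINT x|lborel. bump c' d' n x * f' x) = (LINT x|lebesgue. bump c' d' n x * f' x)"
            by (rule integral_completion[OF m, symmetric])
          also have "\<dots> = (LINT x|lebesgue. h x * bump c' d' n x)"
          proof (rule integral_cong_AE)
            show "(\<lambda>x. bump c' d' n x * f' x) \<in> borel_measurable lebesgue" using m measurable_completion by blast
            show "(\<lambda>x. h x * bump c' d' n x) \<in> borel_measurable lebesgue"
              using test_product_integrable[OF h t] by auto
            show "AE x in lebesgue. bump c' d' n x * f' x = h x * bump c' d' n x"
              using ae
            proof eventually_elim
              case (elim x)
              show ?case
              proof (cases "x \<in> box c' d'")
                case True
                then have "x \<in> cbox a b" using sub box_subset_cbox by blast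
                then show ?thesis using elim by (simp add: f_def)
              qed (simp add: bump_zero[OF le])
            qed
          qed
          also have "\<dots> = 0" by (rule z[OF t])
          finally show ?thesis .
        qed
        ultimately show ?thesis by (simp add: LIMSEQ_const_iff)
      qed simp
      finally show "(LINT x:box c d|lborel. ?g x) = 0" .
    qed
    then have "AE x in lebesgue. ?g x = 0" by (simp add: AE_completion)
    \<comment> \<open>Only the open box has been treated so far; the boundary of a box is a null
      set.\<close>
    moreover have "AE x in lebesgue. x \<notin> cbox a b - box a b"
      by (rule AE_not_in) (simp add: negligible_iff_null_sets[symmetric] negligible_frontier_interval)
    ultimately show ?thesis using ae
      by eventually_elim (auto simp: f_def)
  qed
  obtain \<D> where D: "countable \<D>" "\<D> \<subseteq> Pow \<Omega>" "\<And>X. X \<in> \<D> \<Longrightarrow> \<exists>a b. X = cbox a b" "\<Union>\<D> = \<Omega>"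
    by (rule open_countable_Union_open_cbox[OF assms(1)]) (rule that, assumption+)
  have "AE x in lebesgue. \<forall>X\<in>\<D>. x \<in> X \<longrightarrow> h x = 0"
  proof (subst AE_ball_countable[OF D(1)], rule ballI)
    fix X assume "X \<in> \<D>"
    then show "AE x in lebesgue. x \<in> X \<longrightarrow> h x = 0" using D cb by (metis PowD subsetD)
  qed
  then show ?thesis by eventually_elim (use D(4) in blast)
qed

section \<open>The very weak Hessian determinant of a C1 function\<close>

lemma continuous_Lp_loc:
  assumes "continuous_on UNIV u" "\<And>x. x \<in> \<Omega> \<Longrightarrow> v x = u x" "q > 0" shows "v \<in> Lp_loc q \<Omega>"
  unfolding Lp_loc_def Lp_def
proof (intro CollectI allI impI conjI; elim conjE)
  fix K assume K: "compact K" "K \<subseteq> \<Omega>"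
  have Ks: "K \<in> sets lebesgue" using K(1) by (simp add: compact_imp_closed borel_closed)
  have e: "v x = u x" if "x \<in> K" for x using that K assms(2) by blast
  have um: "u \<in> borel_measurable (lebesgue_on K)"
    using borel_measurable_continuous_onI[OF assms(1)] by (simp add: measurable_completion measurable_restrict_space1)
  show "v \<in> borel_measurable (lebesgue_on K)"
    by (rule measurable_cong[THEN iffD1, OF _ um]) (use e in auto)
  have "continuous_on K (\<lambda>x. \<bar>u x\<bar> powr q)"
    by (intro continuous_on_powr' continuous_intros continuous_on_subset[OF assms(1)]) (use assms(3) in auto)
  from borel_integrable_compact[OF K(1) this]
  have "integrable lebesgue (\<lambda>x. indicator K x *\<^sub>R \<bar>u x\<bar> powr q)"
    by (simp add: integrable_completion borel_measurable_integrable)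
  then have "integrable (lebesgue_on K) (\<lambda>x. \<bar>u x\<bar> powr q)"
    using Ks by (subst integrable_restrict_space) auto
  moreover have "integrable (lebesgue_on K) (\<lambda>x. \<bar>v x\<bar> powr q) = integrable (lebesgue_on K) (\<lambda>x. \<bar>u x\<bar> powr q)"
    by (rule Bochner_Integration.integrable_cong) (use e in auto)
  ultimately show "integrable (lebesgue_on K) (\<lambda>x. \<bar>v x\<bar> powr q)" by simp
qed

lemma regular_continuous:
  assumes "open \<Omega>" "\<phi> \<in> test_functions \<Omega>" "continuous_on UNIV u" "\<And>x. x \<in> \<Omega> \<Longrightarrow> v x = u x"
  shows "regular \<Omega> v \<phi> = (LINT x|lborel. u x * \<phi> x)"
proof -
  note t = test_functionsD[OF assms(2)]
  have "regular \<Omega> v \<phi> = (LINT x|lebesgue. v x * \<phi> x)" by (rule regular_lebesgue[OF assms(1) t(3)])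
  also have "(\<lambda>x. v x * \<phi> x) = (\<lambda>x. u x * \<phi> x)"
    by (rule ext) (use assms(4) t(3) in \<open>metis mult_zero_right\<close>)
  also have "(LINT x|lebesgue. u x * \<phi> x) = (LINT x|lborel. u x * \<phi> x)"
    by (rule integral_completion)
      (use borel_measurable_continuous_onI[OF continuous_on_mult[OF assms(3) C1_cont[OF t(4)]]] in simp)
  finally show ?thesis .
qed

lemma C1_weak_gradient:
  assumes \<Omega>: "open \<Omega>" and u: "C1 u u'" and v: "\<forall>x\<in>\<Omega>. v x = u x"
  shows "weak_gradient \<Omega> v (\<lambda>x. \<chi> i. u' i x)"
  unfolding weak_gradient_def
proof (intro allI conjI ballI)
  fix i
  show "(\<lambda>x. (\<chi> i. u' i x) $ i) \<in> Lp_loc 1 \<Omega>"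
    by (rule continuous_Lp_loc[OF C1_cont'[OF u]]) auto
  fix \<phi> assume \<phi>: "\<phi> \<in> test_functions \<Omega>"
  note t = test_functionsD[OF \<phi>]
  have "dpartial i (regular \<Omega> v) \<phi> = - (LINT x|lborel. u x * partial i \<phi> x)"
    unfolding dpartial_def using regular_continuous[OF \<Omega> test_functions_partial[OF \<phi>] C1_cont[OF u]] v by auto
  also have "\<dots> = (LINT x|lborel. u' i x * \<phi> x)" by (rule integration_by_parts[OF u t(4,2), symmetric])
  also have "\<dots> = regular \<Omega> (\<lambda>x. (\<chi> i. u' i x) $ i) \<phi>"
    by (rule regular_continuous[OF \<Omega> \<phi> C1_cont'[OF u], symmetric]) simp
  finally show "dpartial i (regular \<Omega> v) \<phi> = regular \<Omega> (\<lambda>x. (\<chi> i. u' i x) $ i) \<phi>" .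
qed

text \<open>\<open>weak_grad\<close> is an unspecified choice. The classical gradient shows that
  there is something to choose, and the fundamental lemma that any choice agrees with it almost
  everywhere.\<close>

lemma weak_grad_C1:
  assumes \<Omega>: "open \<Omega>" and u: "C1 u u'" and v: "\<forall>x\<in>\<Omega>. v x = u x"
  shows "AE x in lebesgue. x \<in> \<Omega> \<longrightarrow> weak_grad \<Omega> v x $ i = u' i x" and "(\<lambda>x. weak_grad \<Omega> v x $ i) \<in> Lp_loc 1 \<Omega>"
proof -
  let ?g = "weak_grad \<Omega> v"
  note cw = C1_weak_gradient[OF \<Omega> u v]
  have w: "weak_gradient \<Omega> v ?g" unfolding weak_grad_def by (rule someI[of "weak_gradient \<Omega> v", OF cw])
  then show gL: "(\<lambda>x. ?g x $ i) \<in> Lp_loc 1 \<Omega>" unfolding weak_gradient_def by auto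
  have uL: "u' i \<in> Lp_loc 1 \<Omega>" by (rule continuous_Lp_loc[OF C1_cont'[OF u]]) auto
  have hL: "(\<lambda>x. ?g x $ i - u' i x) \<in> Lp_loc 1 \<Omega>"
    unfolding Lp_loc_def Lp_def
  proof (intro CollectI allI impI)
    fix K assume K: "compact K \<and> K \<subseteq> \<Omega>"
    then have m: "(\<lambda>x. ?g x $ i) \<in> borel_measurable (lebesgue_on K)" "u' i \<in> borel_measurable (lebesgue_on K)"
      and i: "integrable (lebesgue_on K) (\<lambda>x. norm (?g x $ i))" "integrable (lebesgue_on K) (\<lambda>x. norm (u' i x))"
      using gL uL unfolding Lp_loc_def Lp_def by auto
    have "integrable (lebesgue_on K) (\<lambda>x. ?g x $ i)" "integrable (lebesgue_on K) (u' i)"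
      using i m by (auto intro: integrable_norm_iff[THEN iffD1])
    then have "integrable (lebesgue_on K) (\<lambda>x. ?g x $ i - u' i x)" by (rule Bochner_Integration.integrable_diff)
    then show "(\<lambda>x. ?g x $ i - u' i x) \<in> borel_measurable (lebesgue_on K) \<and>
       integrable (lebesgue_on K) (\<lambda>x. \<bar>?g x $ i - u' i x\<bar> powr 1)"
      by (auto intro: borel_measurable_integrable integrable_abs)
  qed
  have "AE x in lebesgue. x \<in> \<Omega> \<longrightarrow> ?g x $ i - u' i x = 0"
  proof (rule fundamental_lemma[OF \<Omega> hL])
    fix \<phi> assume \<phi>: "\<phi> \<in> test_functions \<Omega>"
    note t = test_functionsD[OF \<phi>]
    have "regular \<Omega> (\<lambda>x. ?g x $ i) \<phi> = regular \<Omega> (\<lambda>x. (\<chi> i. u' i x) $ i) \<phi>"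
      using w cw \<phi> unfolding weak_gradient_def by metis
    then have "(LINT x|lebesgue. ?g x $ i * \<phi> x) = (LINT x|lebesgue. u' i x * \<phi> x)"
      by (simp add: regular_lebesgue[OF \<Omega>, of \<phi>] t(3))
    then show "(LINT x|lebesgue. (?g x $ i - u' i x) * \<phi> x) = 0"
      using test_product_integrable[OF gL \<phi>] test_product_integrable[OF uL \<phi>] by (simp add: left_diff_distrib)
  qed
  then show "AE x in lebesgue. x \<in> \<Omega> \<longrightarrow> ?g x $ i = u' i x" by simp
qed

lemma regular_weak_grad_product:
  assumes \<Omega>: "open \<Omega>" and u: "C1 u u'" and v: "\<forall>x\<in>\<Omega>. v x = u x" and \<phi>: "\<phi> \<in> test_functions \<Omega>"
  shows "regular \<Omega> (\<lambda>x. weak_grad \<Omega> v x $ i * weak_grad \<Omega> v x $ j) \<phi> = (LINT x|lborel. (u' i x * u' j x) * \<phi> x)"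
proof -
  note t = test_functionsD[OF \<phi>]
  let ?g = "weak_grad \<Omega> v"
  let ?\<phi> = "\<lambda>x. (u' i x * u' j x) * \<phi> x"
  have "continuous_on UNIV ?\<phi>" by (intro continuous_intros C1_cont'[OF u] C1_cont[OF t(4)])
  then have m: "?\<phi> \<in> borel_measurable lborel" using borel_measurable_continuous_onI by auto
  then have m': "?\<phi> \<in> borel_measurable lebesgue" using measurable_completion by blast
  have ae: "AE x in lebesgue. (?g x $ i * ?g x $ j) * \<phi> x = ?\<phi> x"
    using weak_grad_C1(1)[OF \<Omega> u v, of i] weak_grad_C1(1)[OF \<Omega> u v, of j]
    by eventually_elim (use t(3) in auto)
  have ae': "AE x in lebesgue. ?\<phi> x = (?g x $ i * ?g x $ j) * \<phi> x"
    using ae by eventually_elim (rule sym)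
  have "regular \<Omega> (\<lambda>x. ?g x $ i * ?g x $ j) \<phi> = (LINT x|lebesgue. (?g x $ i * ?g x $ j) * \<phi> x)"
    by (rule regular_lebesgue[OF \<Omega> t(3)])
  also have "\<dots> = (LINT x|lebesgue. ?\<phi> x)"
    by (rule integral_cong_AE[OF _ m' ae]) (rule borel_measurable_AE[OF m' ae'])
  also have "\<dots> = (LINT x|lborel. ?\<phi> x)" by (rule integral_completion[OF m])
  finally show ?thesis .
qed

text \<open>Two transposed derivatives cancel their signs and reverse their order, so the mixed term
  meets the test function as \<open>iter_partial [2,1] \<phi>\<close>.\<close>

lemma Det_Hess_C1:
  assumes \<Omega>: "open \<Omega>" and u: "C1 u u'" and v: "\<forall>x\<in>\<Omega>. v x = u x" and \<phi>: "\<phi> \<in> test_functions \<Omega>"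
  shows "Det_Hess \<Omega> v \<phi> = - (1 / 2) * (LINT x|lborel. (u' 1 x * u' 1 x) * iter_partial [2,2] \<phi> x
    + (u' 2 x * u' 2 x) * iter_partial [1,1] \<phi> x - 2 * ((u' 1 x * u' 2 x) * iter_partial [2,1] \<phi> x))"
proof -
  note r = regular_weak_grad_product[OF \<Omega> u v]
  have p2: "iter_partial [i,j] \<phi> \<in> test_functions \<Omega>" for i j using test_functions_partial \<phi> by simp
  have i: "integrable lborel (\<lambda>x. (u' i x * u' j x) * iter_partial [k,l] \<phi> x)" for i j k l
    using test_functionsD(2)[OF p2] C1_cont[OF test_functionsD(4)[OF p2]] C1_cont'[OF u]
    by (intro csupp_integrable csupp_mult continuous_intros) auto
  have "Det_Hess \<Omega> v \<phi> = - (1/2) * ((LINT x|lborel. (u' 1 x * u' 1 x) * iter_partial [2,2] \<phi> x)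
    + (LINT x|lborel. (u' 2 x * u' 2 x) * iter_partial [1,1] \<phi> x) - 2 * (LINT x|lborel. (u' 1 x * u' 2 x) * iter_partial [2,1] \<phi> x))"
    unfolding Det_Hess_def curl_curl_def dpartial_def outer_def using r[OF p2] by simp
  also have "\<dots> = - (1 / 2) * (LINT x|lborel. (u' 1 x * u' 1 x) * iter_partial [2,2] \<phi> x
    + (u' 2 x * u' 2 x) * iter_partial [1,1] \<phi> x - 2 * ((u' 1 x * u' 2 x) * iter_partial [2,1] \<phi> x))"
    using i by (simp del: iter_partial.simps)
  finally show ?thesis .
qed

lemma C1_W12_loc:
  assumes \<Omega>: "open \<Omega>" and u: "C1 u u'" and v: "\<forall>x\<in>\<Omega>. v x = u x"
  shows "v \<in> W12_loc \<Omega>"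
proof -
  have "v \<in> Lp_loc 2 \<Omega>" by (rule continuous_Lp_loc[OF C1_cont[OF u]]) (use v in auto)
  moreover have "(\<lambda>x. (\<chi> i. u' i x) $ i) \<in> Lp_loc 2 \<Omega>" for i
    by (rule continuous_Lp_loc[OF C1_cont'[OF u]]) auto
  ultimately show ?thesis unfolding W12_loc_def using C1_weak_gradient[OF \<Omega> u v] by blast
qed

section \<open>A potential with a cone kernel\<close>

definition vec2 :: "real \<Rightarrow> real \<Rightarrow> real^2" where "vec2 a b = a *\<^sub>R ax 1 + b *\<^sub>R ax 2"

lemma vec2_nth [simp]: "vec2 a b $ 1 = a" "vec2 a b $ 2 = b"
  by (simp_all add: vec2_def axis_nth)

lemma vec2_measurable [measurable]: "(\<lambda>(a, b). vec2 a b) \<in> borel_measurable (lborel \<Otimes>\<^sub>M lborel)"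
proof -
  have "(\<lambda>p. vec2 (fst p) (snd p)) \<in> borel_measurable borel"
    unfolding vec2_def by (intro borel_measurable_continuous_onI continuous_intros)
  then show ?thesis by (simp add: lborel_prod split_def)
qed

lemma Basis_vec2: "(Basis :: (real^2) set) = {ax 1, ax 2}"
  by (auto simp: Basis_vec_def UNIV_2)

text \<open>Vectors indexed by \<open>2\<close> and pairs of reals are different types. Comparing
  the measures of boxes transports the product measure, so that iterated integrals and the slope
  substitution become available.\<close>

lemma lborel_vec2: "lborel = distr (lborel \<Otimes>\<^sub>M lborel) borel (\<lambda>(a, b). vec2 a b)"
proof (rule lborel_eqI)
  fix l u :: "real^2" assume le: "\<And>b. b \<in> Basis \<Longrightarrow> l \<bullet> b \<le> u \<bullet> b"
  have le': "l$1 \<le> u$1" "l$2 \<le> u$2" using le[of "ax 1"] le[of "ax 2"] by (simp_all add: Basis_vec2 inner_axis)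
  have "emeasure (distr (lborel \<Otimes>\<^sub>M lborel) borel (\<lambda>(a, b). vec2 a b)) (box l u)
    = emeasure (lborel \<Otimes>\<^sub>M lborel) ({l$1<..<u$1} \<times> {l$2<..<u$2})"
  proof (subst emeasure_distr)
    have "(\<lambda>(a, b). vec2 a b) -` box l u = {l$1<..<u$1} \<times> {l$2<..<u$2}" by (auto simp: box2)
    then show "emeasure (lborel \<Otimes>\<^sub>M lborel) ((\<lambda>(a, b). vec2 a b) -` box l u \<inter> space (lborel \<Otimes>\<^sub>M lborel))
      = emeasure (lborel \<Otimes>\<^sub>M lborel) ({l$1<..<u$1} \<times> {l$2<..<u$2})" by (simp add: space_pair_measure)
  qed auto
  also have "\<dots> = ennreal (u$1 - l$1) * ennreal (u$2 - l$2)"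
    using le' by (subst lborel.emeasure_pair_measure_Times) auto
  also have "\<dots> = ennreal (\<Prod>b\<in>Basis. (u - l) \<bullet> b)"
    using le' by (simp add: Basis_vec2 axis_eq_axis inner_axis ennreal_mult)
  finally show "emeasure (distr (lborel \<Otimes>\<^sub>M lborel) borel (\<lambda>(a, b). vec2 a b)) (box l u) = ennreal (\<Prod>b\<in>Basis. (u - l) \<bullet> b)" .
qed simp

lemma nn_integral_vec2:
  assumes [measurable]: "f \<in> borel_measurable borel"
  shows "(\<integral>\<^sup>+x. f x \<partial>lborel) = (\<integral>\<^sup>+a. \<integral>\<^sup>+b. f (vec2 a b) \<partial>lborel \<partial>lborel)"
proof -
  have "(\<integral>\<^sup>+x. f x \<partial>lborel) = (\<integral>\<^sup>+p. f ((\<lambda>(a, b). vec2 a b) p) \<partial>(lborel \<Otimes>\<^sub>M lborel))"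
    by (subst lborel_vec2, subst nn_integral_distr) auto
  also have "\<dots> = (\<integral>\<^sup>+a. \<integral>\<^sup>+b. f ((\<lambda>(a, b). vec2 a b) (a, b)) \<partial>lborel \<partial>lborel)"
    by (rule lborel.nn_integral_fst[symmetric]) measurable
  finally show ?thesis by simp
qed

lemma integral_vec2:
  fixes f :: "real^2 \<Rightarrow> real"
  assumes f: "integrable lborel f"
  shows "integral\<^sup>L lborel f = (LINT a|lborel. LINT b|lborel. f (vec2 a b))"
proof -
  have m: "f \<in> borel_measurable borel" using f by auto
  have "integrable (distr (lborel \<Otimes>\<^sub>M lborel) borel (\<lambda>(a, b). vec2 a b)) f" using f lborel_vec2 by simp
  then have i: "integrable (lborel \<Otimes>\<^sub>M lborel) (\<lambda>p. f ((\<lambda>(a, b). vec2 a b) p))"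
    by (subst (asm) integrable_distr_eq) (use m in auto)
  have "integral\<^sup>L lborel f = integral\<^sup>L (lborel \<Otimes>\<^sub>M lborel) (\<lambda>p. f ((\<lambda>(a, b). vec2 a b) p))"
    by (subst lborel_vec2, subst integral_distr) (use m in auto)
  also have "\<dots> = (LINT a|lborel. LINT b|lborel. f ((\<lambda>(a, b). vec2 a b) (a, b)))"
    by (rule lborel_pair.integral_fst'[OF i, symmetric])
  finally show ?thesis by simp
qed

text \<open>The bound has to be uniform in the position \<open>a\<close> of the singularity. At
  distance above 1 from \<open>a\<close> the weight is at most 1; closer to \<open>a\<close> it is
  covered by one of two one-sided copies of \<open>j\<close>, each with integral
  \<open>1 / (1 - \<kappa>)\<close>.\<close>

lemma powr_weight_bound:
  fixes \<kappa> R :: real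
  assumes \<kappa>: "0 < \<kappa>" "\<kappa> < 1" and R: "R \<ge> 0"
  shows "\<exists>C\<ge>0. \<forall>a. (\<integral>\<^sup>+t. ennreal (indicator {-R..R} t * \<bar>a - t\<bar> powr (-\<kappa>)) \<partial>lborel) \<le> ennreal C"
proof -
  define j where "j = (\<lambda>u::real. indicator {0..1} u * u powr (-\<kappa>) :: real)"
  have [measurable]: "j \<in> borel_measurable borel" unfolding j_def by measurable
  have "((\<lambda>x. x powr (-\<kappa>)) has_integral (1 powr (-\<kappa>+1) / (-\<kappa>+1))) {0..1}"
    by (rule has_integral_powr_from_0) (use \<kappa> in auto)
  from nn_integral_has_integral_lebesgue[OF _ this]
  have J: "(\<integral>\<^sup>+u. ennreal (j u) \<partial>lborel) = ennreal (1 / (1 - \<kappa>))"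
    using \<kappa> by (simp add: j_def)
  have J1: "(\<integral>\<^sup>+t. ennreal (j (a - t)) \<partial>lborel) = ennreal (1 / (1 - \<kappa>))" for a
    using nn_integral_real_affine[of "\<lambda>u. ennreal (j u)" "-1" a] J by simp
  have J2: "(\<integral>\<^sup>+t. ennreal (j (t - a)) \<partial>lborel) = ennreal (1 / (1 - \<kappa>))" for a
    using nn_integral_real_affine[of "\<lambda>u. ennreal (j u)" "1" "-a"] J by (simp add: add.commute)
  have pw: "indicator {-R..R} t * \<bar>a - t\<bar> powr (-\<kappa>) \<le> indicator {-R..R} t + j (a - t) + j (t - a)" for a t
  proof -
    have jn: "0 \<le> j u" for u by (simp add: j_def)
    consider "\<bar>a - t\<bar> > 1" | "\<bar>a - t\<bar> \<le> 1" "a \<ge> t" | "\<bar>a - t\<bar> \<le> 1" "a < t" by linarith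
    then show ?thesis
    proof cases
      case 1
      then have "\<bar>a - t\<bar> powr (-\<kappa>) \<le> \<bar>a - t\<bar> powr 0" using \<kappa> by (intro powr_mono) auto
      then have "indicator {-R..R} t * \<bar>a - t\<bar> powr (-\<kappa>) \<le> indicator {-R..R} t"
        using 1 by (auto simp: indicator_def split: if_splits)
      then show ?thesis using jn[of "a - t"] jn[of "t - a"] by linarith
    next
      case 2
      then have "j (a - t) = \<bar>a - t\<bar> powr (-\<kappa>)" by (simp add: j_def)
      then show ?thesis using jn[of "t - a"] by (auto simp: indicator_def)
    next
      case 3
      then have "j (t - a) = \<bar>a - t\<bar> powr (-\<kappa>)" by (simp add: j_def)
      then show ?thesis using jn[of "a - t"] by (auto simp: indicator_def)
    qed
  qed
  have jn: "0 \<le> j u" for u by (simp add: j_def)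
  have "(\<integral>\<^sup>+t. ennreal (indicator {-R..R} t * \<bar>a - t\<bar> powr (-\<kappa>)) \<partial>lborel) \<le> ennreal (2 * R + 2 / (1 - \<kappa>))" for a
  proof -
    have "(\<integral>\<^sup>+t. ennreal (indicator {-R..R} t * \<bar>a - t\<bar> powr (-\<kappa>)) \<partial>lborel)
      \<le> (\<integral>\<^sup>+t. (indicator {-R..R} t + ennreal (j (a - t))) + ennreal (j (t - a)) \<partial>lborel)"
    proof (rule nn_integral_mono)
      fix t
      have "ennreal (indicator {-R..R} t * \<bar>a - t\<bar> powr (-\<kappa>)) \<le> ennreal (indicator {-R..R} t + j (a - t) + j (t - a))"
        by (rule ennreal_leI[OF pw])
      also have "\<dots> = (indicator {-R..R} t + ennreal (j (a - t))) + ennreal (j (t - a))"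
        using jn by (simp add: ennreal_plus ennreal_indicator)
      finally show "ennreal (indicator {-R..R} t * \<bar>a - t\<bar> powr (-\<kappa>)) \<le> (indicator {-R..R} t + ennreal (j (a - t))) + ennreal (j (t - a))" .
    qed
    also have "\<dots> = (\<integral>\<^sup>+t. indicator {-R..R} t \<partial>lborel) + (\<integral>\<^sup>+t. ennreal (j (a - t)) \<partial>lborel) + (\<integral>\<^sup>+t. ennreal (j (t - a)) \<partial>lborel)"
      by (simp add: nn_integral_add)
    also have "\<dots> = ennreal (2 * R) + ennreal (1 / (1 - \<kappa>)) + ennreal (1 / (1 - \<kappa>))"
      unfolding J1 J2 using R by simp
    also have "\<dots> = ennreal (2 * R + 2 / (1 - \<kappa>))"
      using R \<kappa> by (simp add: ennreal_plus[symmetric] del: ennreal_plus)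
    finally show ?thesis .
  qed
  moreover have "0 \<le> 2 * R + 2 / (1 - \<kappa>)" using R \<kappa> by simp
  ultimately show ?thesis by blast
qed

lemma powr_weight_bound2:
  fixes \<kappa> R :: real
  assumes \<kappa>: "0 < \<kappa>" "\<kappa> < 1" and R: "R \<ge> 0"
  shows "\<exists>C. \<forall>x :: real^2. let h = (\<lambda>y :: real^2. indicator {-R..R} (y$1) * \<bar>x$1 - y$1\<bar> powr (-\<kappa>) * (indicator {-R..R} (y$2) * \<bar>x$2 - y$2\<bar> powr (-\<kappa>)))
     in integrable lborel h \<and> integral\<^sup>L lborel h \<le> C"
proof -
  obtain C where C: "C \<ge> 0" "\<And>a. (\<integral>\<^sup>+t. ennreal (indicator {-R..R} t * \<bar>a - t\<bar> powr (-\<kappa>)) \<partial>lborel) \<le> ennreal C"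
    using powr_weight_bound[OF assms] by blast
  show ?thesis
  proof (intro exI[of _ "C * C"] allI)
    fix x :: "real^2"
    define g where "g = (\<lambda>a t. indicator {-R..R} t * \<bar>a - t\<bar> powr (-\<kappa>) :: real)"
    have gn: "g a t \<ge> 0" for a t by (simp add: g_def)
    have [measurable]: "g a \<in> borel_measurable borel" for a unfolding g_def by measurable
    define h where "h = (\<lambda>y::real^2. g (x$1) (y$1) * g (x$2) (y$2))"
    have [measurable]: "h \<in> borel_measurable borel" unfolding h_def by measurable
    have "(\<integral>\<^sup>+y. ennreal (h y) \<partial>lborel) = (\<integral>\<^sup>+a. \<integral>\<^sup>+b. ennreal (h (vec2 a b)) \<partial>lborel \<partial>lborel)"
      by (rule nn_integral_vec2) measurable
    also have "\<dots> = (\<integral>\<^sup>+a. \<integral>\<^sup>+b. ennreal (g (x$1) a) * ennreal (g (x$2) b) \<partial>lborel \<partial>lborel)"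
      by (simp add: h_def ennreal_mult gn)
    also have "\<dots> = (\<integral>\<^sup>+a. ennreal (g (x$1) a) \<partial>lborel) * (\<integral>\<^sup>+b. ennreal (g (x$2) b) \<partial>lborel)"
      by (simp add: nn_integral_cmult nn_integral_multc)
    also have "\<dots> \<le> ennreal C * ennreal C"
      unfolding g_def by (intro mult_mono C(2)) auto
    also have "\<dots> = ennreal (C * C)" using C(1) by (simp add: ennreal_mult)
    finally have n: "(\<integral>\<^sup>+y. ennreal (h y) \<partial>lborel) \<le> ennreal (C * C)" .
    have hn: "h y \<ge> 0" for y using gn by (simp add: h_def)
    have i: "integrable lborel h"
      by (rule integrableI_nonneg) (use le_less_trans[OF n ennreal_less_top] hn in auto)
    have "ennreal (integral\<^sup>L lborel h) = (\<integral>\<^sup>+y. ennreal (h y) \<partial>lborel)"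
      by (rule nn_integral_eq_integral[OF i, symmetric]) (simp add: hn)
    then have "ennreal (integral\<^sup>L lborel h) \<le> ennreal (C * C)" using n by (simp only:)
    then have "integral\<^sup>L lborel h \<le> C * C" using C(1) by (subst (asm) ennreal_le_iff) auto
    with i show "let h = (\<lambda>y :: real^2. indicator {-R..R} (y$1) * \<bar>x$1 - y$1\<bar> powr (-\<kappa>) * (indicator {-R..R} (y$2) * \<bar>x$2 - y$2\<bar> powr (-\<kappa>)))
     in integrable lborel h \<and> integral\<^sup>L lborel h \<le> C * C" by (simp add: Let_def h_def g_def)
  qed
qed

section \<open>The cone kernel and its Hoelder continuity\<close>

definition clamp01 :: "real \<Rightarrow> real" where "clamp01 s = max 0 (min 1 s)"
text \<open>On \<open>[0, 1]\<close> this is \<open>s ^ m\<close> times the probability density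
  \<open>6 * s * (1 - s)\<close> of the slopes; \<open>m\<close> counts the factors \<open>s\<close>
  in an entry of \<open>(1, s) \<otimes> (1, s)\<close>. The density vanishes at both ends, so
  clamping extends the profile by zero to a Lipschitz function, and the kernel is continuous across
  the boundary of the cone away from the origin.\<close>

definition cone_profile :: "nat \<Rightarrow> real \<Rightarrow> real" where "cone_profile m s = 6 * (clamp01 s ^ (m + 1) * (1 - clamp01 s))"
definition cone_kernel :: "nat \<Rightarrow> real^2 \<Rightarrow> real" where "cone_kernel m z = (if 0 < z$1 then cone_profile m (z$2 / z$1) else 0)"

lemma clamp01: "0 \<le> clamp01 s" "clamp01 s \<le> 1" "\<bar>clamp01 s - clamp01 t\<bar> \<le> \<bar>s - t\<bar>"
  by (auto simp: clamp01_def)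

lemma cone_profile_cont: "continuous_on S (cone_profile m)"
  unfolding cone_profile_def[abs_def] clamp01_def by (intro continuous_intros)

lemma cone_profile_bound: "\<bar>cone_profile m s\<bar> \<le> 6"
proof -
  have "clamp01 s ^ (m+1) * (1 - clamp01 s) \<le> 1 * 1"
    using clamp01 by (intro mult_mono power_le_one) auto
  moreover have "0 \<le> clamp01 s ^ (m+1) * (1 - clamp01 s)" using clamp01 by simp
  ultimately show ?thesis by (simp add: cone_profile_def)
qed

lemma power_diff_le: "0 \<le> a \<Longrightarrow> a \<le> 1 \<Longrightarrow> 0 \<le> b \<Longrightarrow> b \<le> 1 \<Longrightarrow> \<bar>a ^ n - b ^ n\<bar> \<le> real n * \<bar>a - b\<bar>" for a b :: real
proof (induction n)
  case (Suc n)
  have "\<bar>a ^ Suc n - b ^ Suc n\<bar> = \<bar>a * (a ^ n - b ^ n) + (a - b) * b ^ n\<bar>" by (simp add: algebra_simps)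
  also have "\<dots> \<le> \<bar>a * (a ^ n - b ^ n)\<bar> + \<bar>(a - b) * b ^ n\<bar>" by (rule abs_triangle_ineq)
  also have "\<dots> \<le> 1 * (real n * \<bar>a - b\<bar>) + \<bar>a - b\<bar> * 1"
    unfolding abs_mult using Suc by (intro add_mono mult_mono) (auto simp: power_le_one)
  finally show ?case by (simp add: algebra_simps)
qed simp

lemma cone_profile_lipschitz: assumes "m \<le> 2" shows "\<bar>cone_profile m s - cone_profile m t\<bar> \<le> 42 * \<bar>s - t\<bar>"
proof -
  let ?a = "clamp01 s" and ?b = "clamp01 t"
  have 1: "\<bar>?a ^ (m+1) - ?b ^ (m+1)\<bar> \<le> real (m+1) * \<bar>s - t\<bar>"
    by (rule order_trans[OF power_diff_le]) (use clamp01 in \<open>auto intro!: mult_left_mono\<close>)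
  have 2: "\<bar>?a ^ (m+2) - ?b ^ (m+2)\<bar> \<le> real (m+2) * \<bar>s - t\<bar>"
    by (rule order_trans[OF power_diff_le]) (use clamp01 in \<open>auto intro!: mult_left_mono\<close>)
  have "real (m+1) * \<bar>s - t\<bar> \<le> 3 * \<bar>s - t\<bar>" "real (m+2) * \<bar>s - t\<bar> \<le> 4 * \<bar>s - t\<bar>"
    using assms by (auto intro!: mult_right_mono)
  note 1 = order_trans[OF 1 this(1)] and 2 = order_trans[OF 2 this(2)]
  have "cone_profile m s - cone_profile m t = 6 * ((?a ^ (m+1) - ?b ^ (m+1)) - (?a ^ (m+2) - ?b ^ (m+2)))"
    by (simp add: cone_profile_def algebra_simps)
  moreover have "\<bar>6 * (u - v)\<bar> \<le> 42 * e" if "\<bar>u\<bar> \<le> 3 * e" "\<bar>v\<bar> \<le> 4 * e" for u v e :: real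
  proof -
    have "\<bar>u - v\<bar> \<le> 7 * e" using that by linarith
    then show ?thesis by (simp add: abs_mult)
  qed
  ultimately show ?thesis using 1 2 by (simp only:)
qed

lemma cone_kernel_bound: "\<bar>cone_kernel m z\<bar> \<le> 6"
  using cone_profile_bound by (simp add: cone_kernel_def)

lemma cone_kernel_measurable [measurable]: "cone_kernel m \<in> borel_measurable borel"
proof -
  have [measurable]: "cone_profile m \<in> borel_measurable borel" by (rule borel_measurable_continuous_onI[OF cone_profile_cont])
  show ?thesis unfolding cone_kernel_def[abs_def] by measurable
qed

lemma cone_kernel_zero: assumes "\<not> (0 < z$2 \<and> z$2 < z$1)" shows "cone_kernel m z = 0"
proof (cases "0 < z$1")
  case True
  then have "z$2 / z$1 \<le> 0 \<or> z$2 / z$1 \<ge> 1" using assms by (auto simp: field_simps)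
  then show ?thesis using True by (auto simp: cone_kernel_def cone_profile_def clamp01_def)
qed (simp add: cone_kernel_def)

text \<open>A function homogeneous of degree 0 has Lipschitz constant of order
  \<open>1 / z$1\<close>. This is derived from the slopes when \<open>z'$1\<close> is at least half
  of \<open>z$1\<close>; otherwise the points are so far apart that boundedness of the kernel
  suffices.\<close>

lemma cone_kernel_lipschitz_cone:
  assumes m: "m \<le> 2" and z: "0 < z$2" "z$2 < z$1"
  shows "\<bar>cone_kernel m z - cone_kernel m z'\<bar> \<le> 84 * ((\<bar>z$1 - z'$1\<bar> + \<bar>z$2 - z'$2\<bar>) / z$1)"
proof -
  let ?d = "\<bar>z$1 - z'$1\<bar> + \<bar>z$2 - z'$2\<bar>"
  show ?thesis
  proof (cases "z'$1 \<ge> z$1 / 2")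
    case True
    then have z1: "0 < z'$1" "0 < z$1" using z by linarith+
    have "z$2 / z$1 - z'$2 / z'$1 = (z$2 * (z'$1 - z$1) + z$1 * (z$2 - z'$2)) / (z$1 * z'$1)"
      using z1 by (simp add: field_simps)
    also have "\<bar>\<dots>\<bar> \<le> (z$1 * ?d) / (z$1 * z'$1)"
    proof -
      have "\<bar>z$2 * (z'$1 - z$1) + z$1 * (z$2 - z'$2)\<bar> \<le> z$2 * \<bar>z$1 - z'$1\<bar> + z$1 * \<bar>z$2 - z'$2\<bar>"
        using z z1 by (intro order_trans[OF abs_triangle_ineq]) (auto simp: abs_mult abs_minus_commute)
      also have "\<dots> \<le> z$1 * \<bar>z$1 - z'$1\<bar> + z$1 * \<bar>z$2 - z'$2\<bar>"
        using z by (intro add_right_mono mult_right_mono) auto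
      finally show ?thesis using z1 by (simp add: abs_mult divide_right_mono distrib_left)
    qed
    also have "\<dots> = ?d / z'$1" using z1 by simp
    also have "\<dots> \<le> ?d / (z$1 / 2)" using True z1 by (intro divide_left_mono) auto
    finally have "\<bar>z$2 / z$1 - z'$2 / z'$1\<bar> \<le> 2 * (?d / z$1)" by (simp add: mult.commute)
    moreover have "\<bar>cone_kernel m z - cone_kernel m z'\<bar> \<le> 42 * \<bar>z$2 / z$1 - z'$2 / z'$1\<bar>"
      using cone_profile_lipschitz[OF m] z1 by (simp add: cone_kernel_def)
    ultimately have "\<bar>cone_kernel m z - cone_kernel m z'\<bar> \<le> 42 * (2 * (?d / z$1))"
      by (meson mult_left_mono order_trans zero_le_numeral)
    then show ?thesis by simp
  next
    case False
    then have "z$1 / 2 \<le> ?d" using z by linarith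
    then have "1/2 \<le> ?d / z$1" using z by (simp add: field_simps)
    moreover have "\<bar>cone_kernel m z - cone_kernel m z'\<bar> \<le> 12" using cone_kernel_bound[of m z] cone_kernel_bound[of m z'] by linarith
    moreover have "12 \<le> 84 * (1/2 :: real)" by simp
    ultimately show ?thesis by (meson mult_left_mono order_trans zero_le_numeral)
  qed
qed

text \<open>In the cone \<open>1 / z\<^sub>1\<close> is at most \<open>(z\<^sub>1 z\<^sub>2)\<close> to the power \<open>- 1 / 2\<close>, and a product weight only needs
  one-dimensional integrals.\<close>

definition cone_weight :: "real \<Rightarrow> real^2 \<Rightarrow> real" where
  "cone_weight \<beta> z = \<bar>z$1\<bar> powr (- \<beta>/2) * \<bar>z$2\<bar> powr (- \<beta>/2)"

lemma cone_weight_nonneg: "0 \<le> cone_weight \<beta> z" by (simp add: cone_weight_def)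

lemma cone_kernel_holder_cone:
  assumes m: "m \<le> 2" and z: "0 < z$2" "z$2 < z$1" and \<beta>: "0 < \<beta>" "\<beta> < 1"
  shows "\<bar>cone_kernel m z - cone_kernel m z'\<bar> \<le> 84 * (\<bar>z$1 - z'$1\<bar> + \<bar>z$2 - z'$2\<bar>) powr \<beta> * cone_weight \<beta> z"
proof -
  let ?d = "\<bar>z$1 - z'$1\<bar> + \<bar>z$2 - z'$2\<bar>"
  have z1: "0 < z$1" using z by linarith
  \<comment> \<open>The true bound 12 is enlarged to the Lipschitz constant, so that the two powers
    recombine to a single factor 84.\<close>
  have "\<bar>cone_kernel m z - cone_kernel m z'\<bar> \<le> 84" using cone_kernel_bound[of m z] cone_kernel_bound[of m z'] by linarith
  from interpolation[OF _ this cone_kernel_lipschitz_cone[OF m z] \<beta>]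
  have "\<bar>cone_kernel m z - cone_kernel m z'\<bar> \<le> 84 powr (1 - \<beta>) * (84 * (?d / z$1)) powr \<beta>" by simp
  also have "(84 * (?d / z$1)) powr \<beta> = 84 powr \<beta> * (?d powr \<beta> * (1 / z$1) powr \<beta>)"
  proof -
    have "(84 * (d / z$1)) powr \<beta> = 84 powr \<beta> * (d powr \<beta> * (1 / z$1) powr \<beta>)" if "0 \<le> d" for d
      using z1 that by (simp add: powr_mult powr_divide)
    from this[of ?d] show ?thesis by simp
  qed
  also have "84 powr (1 - \<beta>) * (84 powr \<beta> * (?d powr \<beta> * (1 / z$1) powr \<beta>)) =
     (84 powr (1 - \<beta>) * 84 powr \<beta>) * (?d powr \<beta> * (1 / z$1) powr \<beta>)" by (simp only: mult.assoc)
  also have "84 powr (1 - \<beta>) * 84 powr \<beta> = (84::real)" by (simp add: powr_add[symmetric])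
  also have "(1 / z$1) powr \<beta> \<le> cone_weight \<beta> z"
  proof -
    have "(1 / z$1) powr \<beta> = z$1 powr (- \<beta>/2) * z$1 powr (- \<beta>/2)"
      using z1 by (simp add: powr_add[symmetric] powr_minus_divide powr_divide)
    also have "\<dots> \<le> z$1 powr (- \<beta>/2) * z$2 powr (- \<beta>/2)"
      using z \<beta> by (intro mult_left_mono powr_mono2') auto
    finally show ?thesis using z z1 by (simp add: cone_weight_def)
  qed
  finally show ?thesis by (simp add: mult_left_mono mult.assoc)
qed

text \<open>Either one of the points lies in the open cone, and the previous estimate applies with
  the weight at that point, or both values vanish. The sum of the weights covers all cases.\<close>

lemma cone_kernel_holder:
  assumes m: "m \<le> 2" and \<beta>: "0 < \<beta>" "\<beta> < 1"
  shows "\<bar>cone_kernel m z - cone_kernel m z'\<bar> \<le> 84 * (\<bar>z$1 - z'$1\<bar> + \<bar>z$2 - z'$2\<bar>) powr \<beta> * (cone_weight \<beta> z + cone_weight \<beta> z')"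
proof -
  let ?d = "\<bar>z$1 - z'$1\<bar> + \<bar>z$2 - z'$2\<bar>"
  have n: "0 \<le> 84 * ?d powr \<beta> * cone_weight \<beta> z" "0 \<le> 84 * ?d powr \<beta> * cone_weight \<beta> z'" using cone_weight_nonneg by simp_all
  consider "0 < z$2 \<and> z$2 < z$1" | "0 < z'$2 \<and> z'$2 < z'$1" | "cone_kernel m z = 0" "cone_kernel m z' = 0" using cone_kernel_zero by blast
  then show ?thesis
  proof cases
    case 1
    then have "\<bar>cone_kernel m z - cone_kernel m z'\<bar> \<le> 84 * ?d powr \<beta> * cone_weight \<beta> z" by (intro cone_kernel_holder_cone[OF m _ _ \<beta>]) auto
    then show ?thesis unfolding distrib_left using n(2) by (rule add_increasing2[rotated])
  next
    case 2
    then have "\<bar>cone_kernel m z' - cone_kernel m z\<bar> \<le> 84 * (\<bar>z'$1 - z$1\<bar> + \<bar>z'$2 - z$2\<bar>) powr \<beta> * cone_weight \<beta> z'"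
      by (intro cone_kernel_holder_cone[OF m _ _ \<beta>]) auto
    then have "\<bar>cone_kernel m z - cone_kernel m z'\<bar> \<le> 84 * ?d powr \<beta> * cone_weight \<beta> z'" by (simp only: abs_minus_commute)
    then show ?thesis unfolding distrib_left using n(1) by (rule add_increasing[rotated])
  qed (use n in \<open>simp add: distrib_left\<close>)
qed

lemma C1_ray:
  assumes "C1 u u'"
  shows "((\<lambda>a. u (y + vec2 a (a * s))) has_real_derivative u' 1 (y + vec2 a (a * s)) + s * u' 2 (y + vec2 a (a * s))) (at a within S)"
proof -
  have d: "((\<lambda>a. y + vec2 a (a * s)) has_derivative (\<lambda>h. vec2 h (h * s))) (at a)"
    unfolding vec2_def by (auto intro!: derivative_eq_intros)
  have "((\<lambda>a. u (y + vec2 a (a * s))) has_derivative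
      (\<lambda>h. \<Sum>i\<in>UNIV. u' i (y + vec2 a (a * s)) * vec2 h (h * s) $ i)) (at a)"
    by (rule has_derivative_compose[OF d C1_has_derivative[OF assms]])
  moreover have "(\<lambda>h. \<Sum>i\<in>UNIV. u' i (y + vec2 a (a * s)) * vec2 h (h * s) $ i)
     = (*) (u' 1 (y + vec2 a (a * s)) + s * u' 2 (y + vec2 a (a * s)))"
    by (rule ext) (simp add: sum_2 algebra_simps)
  ultimately show ?thesis by (simp add: has_field_derivative_def has_derivative_at_withinI)
qed

lemma vec2_norm_ge: "\<bar>a\<bar> \<le> norm (vec2 a b)"
  using component_le_norm_cart[of "vec2 a b" 1] by simp

text \<open>The bracket is the second derivative in \<open>a\<close> of U(a) = u(y + (a, a s)), and
  a U'' has the primitive a U' - U. Its value at \<open>R + 1\<close>, strictly beyond the support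
  radius, is 0, and its value at 0 is \<open>- u y\<close>.\<close>

lemma ray_integral:
  assumes u: "C1 u u'" and u': "\<And>i. C1 (u' i) (u'' i)" and R: "R > 0" "\<And>z. norm z > R \<Longrightarrow> u (y + z) = 0 \<and> (\<forall>i. u' i (y + z) = 0)"
  shows "(LINT a|lborel. indicator {0..R+1} a *\<^sub>R (a * (u'' 1 1 (y + vec2 a (a * s)) + s * (u'' 1 2 (y + vec2 a (a * s)) + u'' 2 1 (y + vec2 a (a * s)))
     + s\<^sup>2 * u'' 2 2 (y + vec2 a (a * s))))) = u y"
proof -
  let ?z = "\<lambda>a. y + vec2 a (a * s)"
  let ?F = "\<lambda>a. a * (u' 1 (?z a) + s * u' 2 (?z a)) - u (?z a)"
  have v: "u (?z (R+1)) = 0 \<and> (\<forall>i. u' i (?z (R+1)) = 0)"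
    using vec2_norm_ge[of "R+1" "(R+1) * s"] R(1) by (intro R(2)) auto
  have "(LINT a|lborel. indicator {0..R+1} a *\<^sub>R (a * (u'' 1 1 (?z a) + s * (u'' 1 2 (?z a) + u'' 2 1 (?z a)) + s\<^sup>2 * u'' 2 2 (?z a))))
    = ?F (R+1) - ?F 0"
  proof (rule integral_FTC_atLeastAtMost)
    show "0 \<le> R + 1" using R by simp
    fix a
    have "(?F has_real_derivative (a * ((u'' 1 1 (?z a) + s * u'' 1 2 (?z a)) + s * (u'' 2 1 (?z a) + s * u'' 2 2 (?z a)))
        + 1 * (u' 1 (?z a) + s * u' 2 (?z a))) - (u' 1 (?z a) + s * u' 2 (?z a))) (at a within {0..R+1})"
      by (intro DERIV_diff DERIV_mult' DERIV_add DERIV_cmult DERIV_ident C1_ray u u')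
    then show "(?F has_vector_derivative a * (u'' 1 1 (?z a) + s * (u'' 1 2 (?z a) + u'' 2 1 (?z a)) + s\<^sup>2 * u'' 2 2 (?z a))) (at a within {0..R+1})"
      by (simp add: has_real_derivative_iff_has_vector_derivative[symmetric] algebra_simps power2_eq_square)
  next
    have c: "continuous_on S (\<lambda>a. u'' i j (?z a))" for i j S
      by (rule continuous_on_compose2[OF C1_cont'[OF u']]) (auto simp: vec2_def intro!: continuous_intros)
    show "continuous_on {0..R+1} (\<lambda>a. a * (u'' 1 1 (?z a) + s * (u'' 1 2 (?z a) + u'' 2 1 (?z a)) + s\<^sup>2 * u'' 2 2 (?z a)))"
      by (intro continuous_intros c)
  qed
  also have "\<dots> = u y" using v by (simp add: vec2_def)
  finally show ?thesis .
qed

lemma cone_profile_integral: "(LINT s|lborel. cone_profile 0 s) = 1"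
proof -
  have "(LINT s|lborel. cone_profile 0 s) = (LINT s|lborel. indicator {0..1} s *\<^sub>R (6 * (s * (1 - s))))"
    by (intro Bochner_Integration.integral_cong) (auto simp: cone_profile_def clamp01_def indicator_def)
  also have "\<dots> = (3 * 1\<^sup>2 - 2 * 1 ^ 3) - (3 * 0\<^sup>2 - 2 * 0 ^ 3)"
  proof (rule integral_FTC_atLeastAtMost)
    show "((\<lambda>s. 3 * s\<^sup>2 - 2 * s ^ 3) has_vector_derivative 6 * (s * (1 - s))) (at s within {0..1})" for s :: real
      unfolding has_real_derivative_iff_has_vector_derivative[symmetric]
      by (auto intro!: derivative_eq_intros simp: algebra_simps power2_eq_square)
  qed (auto intro!: continuous_intros)
  finally show ?thesis by simp
qed

lemma cone_kernel_product_integrable: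
  assumes "continuous_on UNIV \<psi>" "csupp \<psi>"
  shows "integrable lborel (\<lambda>z. cone_kernel m z * \<psi> (y + z))"
proof (rule Bochner_Integration.integrable_bound)
  have c: "continuous_on UNIV (\<lambda>z. \<psi> (y + z))"
    using cont_shift[OF assms(1), of y] by (simp add: add.commute)
  obtain R where R: "R > 0" "\<And>x. norm x > R \<Longrightarrow> \<psi> x = 0" using assms(2) unfolding csupp_def by blast
  have "csupp (\<lambda>z. \<psi> (y + z))"
    unfolding csupp_def
  proof (intro exI[of _ "R + norm y"] conjI allI impI)
    fix z :: "real^2" assume "norm z > R + norm y"
    then show "\<psi> (y + z) = 0" using norm_diff_ineq[of z y] by (intro R(2)) (simp add: add.commute)
  qed (use R in \<open>simp add: add_pos_nonneg\<close>)
  then have i: "integrable lborel (\<lambda>z. \<psi> (y + z))" by (rule csupp_integrable[OF c])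
  then show "integrable lborel (\<lambda>z. 6 * \<psi> (y + z))" by simp
  show "(\<lambda>z. cone_kernel m z * \<psi> (y + z)) \<in> borel_measurable lborel" using i by simp
  show "AE z in lborel. norm (cone_kernel m z * \<psi> (y + z)) \<le> norm (6 * \<psi> (y + z))"
    using cone_kernel_bound[of m] by (intro AE_I2) (simp add: abs_mult mult_right_mono)
qed

lemma cone_profile_power: "s \<in> {0..1} \<Longrightarrow> cone_profile m s = s ^ m * cone_profile 0 s"
  by (simp add: cone_profile_def clamp01_def)

lemma cone_profile_outside: "s \<notin> {0..1} \<Longrightarrow> cone_profile m s = 0"
  by (auto simp: cone_profile_def clamp01_def)

text \<open>Substituting \<open>z = (a, a s)\<close> turns the left-hand side into the average over the slopes \<open>s\<close>, with
  density \<open>6 s (1 - s)\<close>, of the integrals of \<open>ray_integral\<close>.\<close>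

lemma kernel_representation:
  assumes u: "C1 u u'" and u': "\<And>i. C1 (u' i) (u'' i)" and csupp: "csupp u"
  shows "(LINT z|lborel. cone_kernel 2 z * u'' 2 2 (y + z) + cone_kernel 0 z * u'' 1 1 (y + z) + (cone_kernel 1 z * u'' 1 2 (y + z) + cone_kernel 1 z * u'' 2 1 (y + z))) = u y"
proof -
  note cs' = csupp_pd[OF u csupp] and cs'' = csupp_pd[OF u' csupp_pd[OF u csupp]]
  obtain R0 where R0: "R0 > 0" "\<And>x. norm x > R0 \<Longrightarrow> u x = 0" using csupp unfolding csupp_def by blast
  have "\<forall>i. \<exists>R>0. \<forall>x. norm x > R \<longrightarrow> u' i x = 0" using cs' unfolding csupp_def by blast
  then obtain R1 where R1: "\<And>i. R1 i > 0" "\<And>i x. norm x > R1 i \<Longrightarrow> u' i x = 0" by metis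
  have "\<forall>i j. \<exists>R>0. \<forall>x. norm x > R \<longrightarrow> u'' i j x = 0" using cs'' unfolding csupp_def by blast
  then obtain R2 where R2: "\<And>i j. R2 i j > 0" "\<And>i j x. norm x > R2 i j \<Longrightarrow> u'' i j x = 0" by metis
  define R where "R = R0 + (\<Sum>i\<in>UNIV. R1 i) + (\<Sum>i\<in>UNIV. \<Sum>j\<in>UNIV. R2 i j) + norm y"
  have s0: "0 < R1 1" "0 < R1 2" "0 < R2 1 1" "0 < R2 1 2" "0 < R2 2 1" "0 < R2 2 2" using R1 R2 by auto
  have Rp: "R > 0" using R0 s0 norm_ge_zero[of y] unfolding R_def sum_2 by linarith
  have R: "u (y + z) = 0 \<and> (\<forall>i. u' i (y + z) = 0) \<and> (\<forall>i j. u'' i j (y + z) = 0)" if "norm z > R" for z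
  proof -
    have n: "norm (y + z) > R - norm y" using that norm_diff_ineq[of z y] by (simp add: add.commute)
    have "norm (y + z) > R0" "norm (y + z) > R1 1" "norm (y + z) > R1 2" "norm (y + z) > R2 1 1" "norm (y + z) > R2 1 2"
      "norm (y + z) > R2 2 1" "norm (y + z) > R2 2 2"
      using n R0(1) s0 unfolding R_def sum_2 by linarith+
    then show ?thesis using R0(2) R1(2) R2(2) by (simp add: forall_2)
  qed
  let ?G = "\<lambda>z. cone_kernel 2 z * u'' 2 2 (y + z) + cone_kernel 0 z * u'' 1 1 (y + z) + (cone_kernel 1 z * u'' 1 2 (y + z) + cone_kernel 1 z * u'' 2 1 (y + z))"
  let ?h = "\<lambda>a s. cone_profile 2 s * u'' 2 2 (y + vec2 a (a * s)) + cone_profile 0 s * u'' 1 1 (y + vec2 a (a * s))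
    + (cone_profile 1 s * u'' 1 2 (y + vec2 a (a * s)) + cone_profile 1 s * u'' 2 1 (y + vec2 a (a * s)))"
  \<comment> \<open>\<open>max a 0\<close> is the Jacobian of \<open>z = (a, a s)\<close>, continued
    by zero to negative \<open>a\<close>. This keeps the integrand continuous in both variables, and
    its support is compact.\<close>
  define M where "M = (\<lambda>a s. max a 0 * ?h a s)"
  have iG: "integrable lborel ?G"
    by (intro Bochner_Integration.integrable_add cone_kernel_product_integrable C1_cont'[OF u'] cs'')
  have inner: "(LINT b|lborel. ?G (vec2 a b)) = (LINT s|lborel. M a s)" for a
  proof (cases "a > 0")
    case True
    have "(LINT b|lborel. ?G (vec2 a b)) = (LINT b|lborel. ?h a (b / a))"
      using True by (intro Bochner_Integration.integral_cong) (auto simp: cone_kernel_def)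
    also have "\<dots> = \<bar>a\<bar> *\<^sub>R (LINT s|lborel. ?h a ((0 + a * s) / a))"
      by (rule lborel_integral_real_affine) (use True in auto)
    also have "\<dots> = (LINT s|lborel. M a s)" using True by (simp add: M_def)
    finally show ?thesis .
  qed (simp add: cone_kernel_def M_def)
  have cM: "continuous_on UNIV (\<lambda>p. M (fst p) (snd p))"
  proof -
    have c: "continuous_on UNIV (\<lambda>p :: real \<times> real. u'' i j (y + vec2 (fst p) (fst p * snd p)))" for i j
      by (rule continuous_on_compose2[OF C1_cont'[OF u']]) (auto simp: vec2_def intro!: continuous_intros)
    have k: "continuous_on UNIV (\<lambda>p :: real \<times> real. cone_profile m (snd p))" for m
      by (rule continuous_on_compose2[OF cone_profile_cont[of UNIV]]) (auto intro!: continuous_intros)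
    show ?thesis unfolding M_def by (intro continuous_intros c k)
  qed
  have M0: "M a s = 0" if "\<not> (a \<in> {0..R+1} \<and> s \<in> {0..1})" for a s
  proof -
    have "a < 0 \<or> a > R + 1 \<or> s \<notin> {0..1}" using that by auto
    then consider "a < 0" | "a > R + 1" | "s \<notin> {0..1}" by blast
    then show ?thesis
    proof cases
      case 2
      then have "norm (vec2 a (a * s)) > R" using vec2_norm_ge[of a "a * s"] Rp by linarith
      then show ?thesis using R by (simp add: M_def)
    qed (auto simp: M_def cone_profile_outside)
  qed
  have "integrable lborel (\<lambda>p. indicator (cbox (0, 0) (R+1, 1)) p *\<^sub>R M (fst p) (snd p))"
    by (rule borel_integrable_compact) (auto intro: continuous_on_subset[OF cM])
  moreover have "(\<lambda>p. indicator (cbox (0, 0) (R+1, 1)) p *\<^sub>R M (fst p) (snd p)) = (\<lambda>(a, s). M a s)"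
    using M0 by (auto simp: fun_eq_iff indicator_def cbox_Pair_eq)
  ultimately have iM: "integrable (lborel \<Otimes>\<^sub>M lborel) (\<lambda>(a, s). M a s)" by (simp add: lborel_prod)
  have ray: "(LINT a|lborel. M a s) = cone_profile 0 s * u y" for s
  proof (cases "s \<in> {0..1}")
    case True
    have "(LINT a|lborel. M a s) = (LINT a|lborel. cone_profile 0 s * (indicator {0..R+1} a *\<^sub>R (a * (u'' 1 1 (y + vec2 a (a * s))
       + s * (u'' 1 2 (y + vec2 a (a * s)) + u'' 2 1 (y + vec2 a (a * s))) + s\<^sup>2 * u'' 2 2 (y + vec2 a (a * s))))))"
    proof (intro Bochner_Integration.integral_cong refl)
      fix a
      show "M a s = cone_profile 0 s * (indicator {0..R+1} a *\<^sub>R (a * (u'' 1 1 (y + vec2 a (a * s))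
       + s * (u'' 1 2 (y + vec2 a (a * s)) + u'' 2 1 (y + vec2 a (a * s))) + s\<^sup>2 * u'' 2 2 (y + vec2 a (a * s)))))"
      proof (cases "a \<in> {0..R+1}")
        case True
        then show ?thesis unfolding M_def cone_profile_power[OF \<open>s \<in> {0..1}\<close>, of 2] cone_profile_power[OF \<open>s \<in> {0..1}\<close>, of 1]
          by (simp add: algebra_simps)
      qed (use M0[of a s] in auto)
    qed
    also have "\<dots> = cone_profile 0 s * u y"
      using ray_integral[OF u u' Rp, of y s] R by simp
    finally show ?thesis .
  qed (simp add: M_def cone_profile_outside)
  have "integral\<^sup>L lborel ?G = (LINT a|lborel. LINT b|lborel. ?G (vec2 a b))" by (rule integral_vec2[OF iG])
  also have "\<dots> = (LINT a|lborel. LINT s|lborel. M a s)" by (simp only: inner)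
  also have "\<dots> = integral\<^sup>L (lborel \<Otimes>\<^sub>M lborel) (\<lambda>(a, s). M a s)" by (rule lborel_pair.integral_fst[OF iM])
  also have "\<dots> = (LINT s|lborel. LINT a|lborel. M a s)" by (rule lborel_pair.integral_snd[OF iM, symmetric])
  also have "\<dots> = u y" by (simp add: ray cone_profile_integral)
  finally show ?thesis .
qed

section \<open>Convolution of the data with the kernel\<close>

lemma lborel_shift: "(LINT x|lborel. g (x - y)) = (LINT x|lborel. g x)" if [measurable]: "g \<in> borel_measurable borel"
  for g :: "real^2 \<Rightarrow> real"
proof -
  have "(LINT x|lborel. g x) = integral\<^sup>L (distr lborel borel ((+) (- y))) g" by (simp add: lborel_distr_plus)
  also have "\<dots> = (LINT x|lborel. g (- y + x))" by (rule integral_distr) auto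
  finally show ?thesis by simp
qed

text \<open>The kernel is bounded, hence the double integrand is dominated by
  \<open>6 * \<bar>\<psi> x * F y\<bar>\<close>, and the convolution moves from the rough datum to
  the test function.\<close>

lemma potential_fubini:
  assumes F: "integrable lborel F" and c: "continuous_on UNIV \<psi>" and csupp: "csupp \<psi>"
  shows "(LINT x|lborel. (LINT y|lborel. cone_kernel m (x - y) * F y) * \<psi> x) = (LINT y|lborel. F y * (LINT z|lborel. cone_kernel m z * \<psi> (y + z)))"
    and "integrable lborel (\<lambda>x. (LINT y|lborel. cone_kernel m (x - y) * F y) * \<psi> x)"
    and "integrable lborel (\<lambda>y. F y * (LINT z|lborel. cone_kernel m z * \<psi> (y + z)))"
proof -
  have Fm [measurable]: "F \<in> borel_measurable borel" using F by auto
  have pm [measurable]: "\<psi> \<in> borel_measurable borel" using borel_measurable_continuous_onI[OF c] .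
  have ip: "integrable lborel \<psi>" by (rule csupp_integrable[OF c csupp])
  let ?f = "\<lambda>x y. cone_kernel m (x - y) * F y * \<psi> x"
  have i1: "integrable (lborel \<Otimes>\<^sub>M lborel) (\<lambda>(x, y). \<psi> x * F y)"
  proof (rule lborel_pair.Fubini_integrable)
    show "(\<lambda>(x, y). \<psi> x * F y) \<in> borel_measurable (lborel \<Otimes>\<^sub>M lborel)" by measurable
    show "integrable lborel (\<lambda>x. LINT y|lborel. norm (case (x, y) of (x, y) \<Rightarrow> \<psi> x * F y))"
      using ip F by (simp add: abs_mult)
    show "AE x in lborel. integrable lborel (\<lambda>y. case (x, y) of (x, y) \<Rightarrow> \<psi> x * F y)"
      using F by simp
  qed
  have i: "integrable (lborel \<Otimes>\<^sub>M lborel) (\<lambda>(x, y). ?f x y)"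
  proof (rule Bochner_Integration.integrable_bound)
    show "integrable (lborel \<Otimes>\<^sub>M lborel) (\<lambda>p. 6 * (case p of (x, y) \<Rightarrow> \<psi> x * F y))"
      using i1 by (rule integrable_mult_right)
    show "(\<lambda>(x, y). ?f x y) \<in> borel_measurable (lborel \<Otimes>\<^sub>M lborel)" by measurable
    show "AE p in lborel \<Otimes>\<^sub>M lborel. norm (case p of (x, y) \<Rightarrow> ?f x y) \<le> norm (6 * (case p of (x, y) \<Rightarrow> \<psi> x * F y))"
    proof (intro AE_I2)
      fix p :: "(real^2) \<times> (real^2)"
      obtain x y where p: "p = (x, y)" by (cases p)
      have "\<bar>cone_kernel m (x - y)\<bar> * (\<bar>F y\<bar> * \<bar>\<psi> x\<bar>) \<le> 6 * (\<bar>F y\<bar> * \<bar>\<psi> x\<bar>)"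
        by (intro mult_right_mono cone_kernel_bound) auto
      then show "norm (case p of (x, y) \<Rightarrow> ?f x y) \<le> norm (6 * (case p of (x, y) \<Rightarrow> \<psi> x * F y))"
        by (simp add: p abs_mult mult_ac)
    qed
  qed
  have dir2: "(LINT x|lborel. ?f x y) = F y * (LINT z|lborel. cone_kernel m z * \<psi> (y + z))" for y
  proof -
    have "(LINT x|lborel. ?f x y) = F y * (LINT x|lborel. cone_kernel m (x - y) * \<psi> (y + (x - y)))"
      by (simp add: mult_ac flip: integral_mult_right_zero)
    also have "(LINT x|lborel. cone_kernel m (x - y) * \<psi> (y + (x - y))) = (LINT z|lborel. cone_kernel m z * \<psi> (y + z))"
      by (rule lborel_shift) measurable
    finally show ?thesis .
  qed
  have dir1: "(LINT y|lborel. ?f x y) = (LINT y|lborel. cone_kernel m (x - y) * F y) * \<psi> x" for x by simp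
  have "(LINT x|lborel. LINT y|lborel. ?f x y) = (LINT y|lborel. LINT x|lborel. ?f x y)"
    using lborel_pair.integral_fst[OF i] lborel_pair.integral_snd[OF i] by simp
  then show "(LINT x|lborel. (LINT y|lborel. cone_kernel m (x - y) * F y) * \<psi> x) = (LINT y|lborel. F y * (LINT z|lborel. cone_kernel m z * \<psi> (y + z)))"
    unfolding dir1 dir2 .
  show "integrable lborel (\<lambda>x. (LINT y|lborel. cone_kernel m (x - y) * F y) * \<psi> x)"
    using lborel_pair.integrable_fst[OF i] unfolding dir1 .
  show "integrable lborel (\<lambda>y. F y * (LINT z|lborel. cone_kernel m z * \<psi> (y + z)))"
    using lborel_pair.integrable_snd[OF i] unfolding dir2 .
qed

text \<open>The convolution wants a Borel datum on the whole plane, so \<open>f\<close> is extended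
  by zero and changed on a null set. Integrability follows because \<open>\<bar>F x\<bar>\<close> is
  at most 1 or at most \<open>\<bar>F x\<bar> powr p\<close>, and \<open>\<Omega>\<close> has finite
  measure.\<close>

lemma Lp_borel_representative:
  assumes \<Omega>: "open \<Omega>" "bounded \<Omega>" and f: "f \<in> Lp p \<Omega>" and p: "1 < p"
  obtains F where "integrable lborel F" "integrable lborel (\<lambda>x. \<bar>F x\<bar> powr p)" "\<And>x. x \<notin> \<Omega> \<Longrightarrow> F x = 0"
    "\<And>\<phi>. \<phi> \<in> test_functions \<Omega> \<Longrightarrow> regular \<Omega> f \<phi> = (LINT x|lborel. F x * \<phi> x)"
proof -
  have Os: "\<Omega> \<in> sets lebesgue" "\<Omega> \<inter> space lebesgue \<in> sets lebesgue" using \<Omega> by auto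
  have fm: "f \<in> borel_measurable (lebesgue_on \<Omega>)" and fi: "integrable (lebesgue_on \<Omega>) (\<lambda>x. \<bar>f x\<bar> powr p)"
    using f by (auto simp: Lp_def)
  have "(\<lambda>x. indicator \<Omega> x *\<^sub>R f x) \<in> borel_measurable (completion lborel)"
    using fm borel_measurable_restrict_space_iff[OF Os(2), of f] by blast
  then obtain F0 where F0: "F0 \<in> borel_measurable lborel" "AE x in lborel. indicator \<Omega> x *\<^sub>R f x = F0 x"
    using completion_ex_borel_measurable_real by blast
  define F where "F = (\<lambda>x. indicator \<Omega> x * F0 x)"
  have Fm [measurable]: "F \<in> borel_measurable borel" using F0(1) \<Omega> unfolding F_def by simp
  have Fl: "F \<in> borel_measurable lebesgue" by (simp add: measurable_completion)
  have "AE x in lebesgue. indicator \<Omega> x *\<^sub>R f x = F0 x" by (rule AE_completion[OF F0(2)])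
  then have ae: "AE x in lebesgue. indicator \<Omega> x * f x = F x"
    by eventually_elim (auto simp: F_def indicator_def)
  have F0': "F x = 0" if "x \<notin> \<Omega>" for x using that by (simp add: F_def)
  have "integrable lebesgue (\<lambda>x. indicator \<Omega> x *\<^sub>R \<bar>f x\<bar> powr p)"
    using fi integrable_restrict_space[OF Os(2), of "\<lambda>x. \<bar>f x\<bar> powr p"] by blast
  moreover have "(\<lambda>x. \<bar>F x\<bar> powr p) \<in> borel_measurable lborel" by simp
  then have "(\<lambda>x. \<bar>F x\<bar> powr p) \<in> borel_measurable lebesgue" using measurable_completion by blast
  moreover have "AE x in lebesgue. indicator \<Omega> x *\<^sub>R \<bar>f x\<bar> powr p = \<bar>F x\<bar> powr p"
    using ae
  proof eventually_elim
    case (elim x)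
    then show ?case using F0'[of x] by (cases "x \<in> \<Omega>") auto
  qed
  ultimately have "integrable lebesgue (\<lambda>x. \<bar>F x\<bar> powr p)" by (rule integrable_cong_AE_imp)
  then have ip: "integrable lborel (\<lambda>x. \<bar>F x\<bar> powr p)" by (simp add: integrable_completion)
  have "emeasure lborel \<Omega> < \<infinity>" by (rule emeasure_bounded_finite[OF \<Omega>(2)])
  then have iO: "integrable lborel (indicator \<Omega> :: real^2 \<Rightarrow> real)" using \<Omega>(1) by (simp add: integrable_real_indicator)
  have "integrable lborel F"
  proof (rule Bochner_Integration.integrable_bound)
    show "integrable lborel (\<lambda>x. indicator \<Omega> x + \<bar>F x\<bar> powr p)" using iO ip by (rule Bochner_Integration.integrable_add)
    show "AE x in lborel. norm (F x) \<le> norm (indicator \<Omega> x + \<bar>F x\<bar> powr p)"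
    proof (rule AE_I2)
      fix x
      have "\<bar>F x\<bar> \<le> indicator \<Omega> x + \<bar>F x\<bar> powr p"
      proof (cases "\<bar>F x\<bar> \<le> 1")
        case True
        then show ?thesis using F0'[of x] by (cases "x \<in> \<Omega>") (auto intro: add_increasing2)
      next
        case False
        then have "\<bar>F x\<bar> powr 1 \<le> \<bar>F x\<bar> powr p" using p by (intro powr_mono) auto
        then show ?thesis using False by (simp add: add_increasing)
      qed
      then show "norm (F x) \<le> norm (indicator \<Omega> x + \<bar>F x\<bar> powr p)" by (simp add: abs_of_nonneg)
    qed
  qed simp
  moreover have "regular \<Omega> f \<phi> = (LINT x|lborel. F x * \<phi> x)" if \<phi>: "\<phi> \<in> test_functions \<Omega>" for \<phi>
  proof -
    note t = test_functionsD[OF \<phi>]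
    have m: "(\<lambda>x. F x * \<phi> x) \<in> borel_measurable lborel"
      using borel_measurable_continuous_onI[OF C1_cont[OF t(4)]] by simp
    then have m': "(\<lambda>x. F x * \<phi> x) \<in> borel_measurable lebesgue" using measurable_completion by blast
    have ae': "AE x in lebesgue. F x * \<phi> x = f x * \<phi> x"
      using ae
    proof eventually_elim
      case (elim x)
      then show ?case using t(3)[of x] by (cases "x \<in> \<Omega>") auto
    qed
    have ae'': "AE x in lebesgue. f x * \<phi> x = F x * \<phi> x" using ae' by eventually_elim (rule sym)
    have "regular \<Omega> f \<phi> = (LINT x|lebesgue. f x * \<phi> x)" by (rule regular_lebesgue[OF \<Omega>(1) t(3)])
    also have "\<dots> = (LINT x|lebesgue. F x * \<phi> x)"
      by (rule integral_cong_AE[OF borel_measurable_AE[OF m' ae'] m' ae''])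
    also have "\<dots> = (LINT x|lborel. F x * \<phi> x)" by (rule integral_completion[OF m])
    finally show ?thesis .
  qed
  ultimately show thesis using that ip F0' by blast
qed

text \<open>Young's inequality, with the conjugate exponent \<open>q\<close> on the kernel weight, plays the role of Hoelder's.\<close>

lemma potential_holder:
  assumes F: "integrable lborel F" "integrable lborel (\<lambda>x. \<bar>F x\<bar> powr p)" and S: "\<And>x. F x \<noteq> 0 \<Longrightarrow> \<bar>x$1\<bar> \<le> R \<and> \<bar>x$2\<bar> \<le> R"
    and p: "1 < p" and \<beta>: "0 < \<beta>" "\<beta> < 1" "\<beta> < 2 - 2 / p" and R: "R \<ge> 0"
  shows "\<exists>L\<ge>0. \<forall>m\<le>2. \<forall>x x'. \<bar>(LINT y|lborel. cone_kernel m (x - y) * F y) - (LINT y|lborel. cone_kernel m (x' - y) * F y)\<bar>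
     \<le> L * (\<bar>x$1 - x'$1\<bar> + \<bar>x$2 - x'$2\<bar>) powr \<beta>"
proof -
  have Fm [measurable]: "F \<in> borel_measurable borel" using F by auto
  define q where "q = p / (p - 1)"
  have q: "1 < q" "1/p + 1/q = 1" using p by (auto simp: q_def field_simps)
  \<comment> \<open>The exponent of each coordinate in \<open>cone_weight \<beta> z powr q\<close>.
    Since \<open>2 / q = 2 - 2 / p\<close>, the hypothesis on \<open>\<beta>\<close> says precisely
    that it is below 1, the condition for integrability in one variable.\<close>
  define \<kappa> where "\<kappa> = \<beta> * q / 2"
  have "\<beta> * q < (2 - 2/p) * q" using \<beta>(3) q by (intro mult_strict_right_mono) auto
  also have "(2 - 2/p) * q = 2" using p by (simp add: q_def field_simps)
  finally have \<kappa>: "0 < \<kappa>" "\<kappa> < 1" using \<beta> q by (auto simp: \<kappa>_def)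
  define h where "h = (\<lambda>(x :: real^2) (y :: real^2). indicator {-R..R} (y$1) * \<bar>x$1 - y$1\<bar> powr (-\<kappa>) * (indicator {-R..R} (y$2) * \<bar>x$2 - y$2\<bar> powr (-\<kappa>)) :: real)"
  obtain C where C: "\<And>x. integrable lborel (h x) \<and> integral\<^sup>L lborel (h x) \<le> C"
    using powr_weight_bound2[OF \<kappa> R] unfolding Let_def h_def by blast
  define P where "P = (LINT y|lborel. \<bar>F y\<bar> powr p)"
  have hn: "0 \<le> h x y" for x y by (simp add: h_def)
  have "0 \<le> integral\<^sup>L lborel (h 0)" by (rule Bochner_Integration.integral_nonneg) (rule hn)
  then have C0: "C \<ge> 0" using C[of 0] by linarith
  have P0: "P \<ge> 0" unfolding P_def by (rule Bochner_Integration.integral_nonneg) simp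
  have young: "cone_weight \<beta> (x - y) * \<bar>F y\<bar> \<le> h x y + \<bar>F y\<bar> powr p" for x y
  proof (cases "F y = 0")
    case False
    then have ind: "indicator {-R..R} (y$1) = (1::real)" "indicator {-R..R} (y$2) = (1::real)" using S[OF False] by (auto simp: indicator_def abs_le_iff)
    have pq: "cone_weight \<beta> z powr q = \<bar>z$1\<bar> powr (-\<kappa>) * \<bar>z$2\<bar> powr (-\<kappa>)" for z
      by (simp add: cone_weight_def powr_mult powr_powr \<kappa>_def field_simps)
    have "cone_weight \<beta> (x - y) * \<bar>F y\<bar> \<le> cone_weight \<beta> (x - y) powr q / q + \<bar>F y\<bar> powr p / p"
      by (rule Youngs_inequality) (use p q cone_weight_nonneg in \<open>auto simp: add.commute\<close>)
    also have "\<dots> \<le> cone_weight \<beta> (x - y) powr q + \<bar>F y\<bar> powr p"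
      using p q by (intro add_mono) (auto simp: divide_le_eq mult_left_le intro: order_trans[OF _ mult_left_mono[of 1]])
    also have "cone_weight \<beta> (x - y) powr q = h x y" unfolding pq h_def ind by simp
    finally show ?thesis .
  qed (simp add: hn)
  have iK: "integrable lborel (\<lambda>y. cone_kernel m (x - y) * F y)" for m x
  proof (rule Bochner_Integration.integrable_bound)
    show "integrable lborel (\<lambda>y. 6 * F y)" using F by simp
    show "AE y in lborel. norm (cone_kernel m (x - y) * F y) \<le> norm (6 * F y)"
      using cone_kernel_bound by (intro AE_I2) (simp add: abs_mult mult_right_mono)
  qed simp
  show ?thesis
  proof (intro exI[of _ "84 * (C + C + 2 * P)"] conjI allI impI)
    show "0 \<le> 84 * (C + C + 2 * P)" using C0 P0 by simp
    fix m :: nat and x x' :: "real^2" assume m: "m \<le> 2"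
    let ?d = "(\<bar>x$1 - x'$1\<bar> + \<bar>x$2 - x'$2\<bar>) powr \<beta>"
    let ?B = "\<lambda>y. 84 * ?d * ((h x y + h x' y) + 2 * \<bar>F y\<bar> powr p)"
    have iB: "integrable lborel ?B" 
      using C F(2) by (intro integrable_mult_right Bochner_Integration.integrable_add) auto
    have "\<bar>(LINT y|lborel. cone_kernel m (x - y) * F y) - (LINT y|lborel. cone_kernel m (x' - y) * F y)\<bar>
      = norm (LINT y|lborel. cone_kernel m (x - y) * F y - cone_kernel m (x' - y) * F y)"
      using iK by simp
    also have "\<dots> \<le> (LINT y|lborel. norm (cone_kernel m (x - y) * F y - cone_kernel m (x' - y) * F y))"
      by (rule integral_norm_bound)
    also have "\<dots> \<le> integral\<^sup>L lborel ?B"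
    proof (rule integral_mono[OF _ iB])
      show "integrable lborel (\<lambda>y. norm (cone_kernel m (x - y) * F y - cone_kernel m (x' - y) * F y))"
        using iK by (intro integrable_norm Bochner_Integration.integrable_diff)
      fix y
      have "norm (cone_kernel m (x - y) * F y - cone_kernel m (x' - y) * F y) = \<bar>cone_kernel m (x - y) - cone_kernel m (x' - y)\<bar> * \<bar>F y\<bar>"
        by (simp add: abs_mult[symmetric] left_diff_distrib)
      also have "\<dots> \<le> (84 * ?d * (cone_weight \<beta> (x - y) + cone_weight \<beta> (x' - y))) * \<bar>F y\<bar>"
        using cone_kernel_holder[OF m \<beta>(1,2), of "x - y" "x' - y"] by (intro mult_right_mono) auto
      also have "\<dots> = 84 * ?d * (cone_weight \<beta> (x - y) * \<bar>F y\<bar> + cone_weight \<beta> (x' - y) * \<bar>F y\<bar>)" by (simp add: algebra_simps)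
      also have "\<dots> \<le> ?B y"
        using young[of x y] young[of x' y] by (intro mult_left_mono) auto
      finally show "norm (cone_kernel m (x - y) * F y - cone_kernel m (x' - y) * F y) \<le> ?B y" .
    qed
    also have "\<dots> = 84 * ?d * ((integral\<^sup>L lborel (h x) + integral\<^sup>L lborel (h x')) + 2 * P)"
      using C F(2) by (simp add: P_def)
    also have "\<dots> \<le> 84 * ?d * ((C + C) + 2 * P)"
      using C by (intro mult_left_mono add_mono) auto
    finally show "\<bar>(LINT y|lborel. cone_kernel m (x - y) * F y) - (LINT y|lborel. cone_kernel m (x' - y) * F y)\<bar>
      \<le> 84 * (C + C + 2 * P) * ?d" by (simp only: mult.commute mult.left_commute mult.assoc)
  qed
qed

lemma potential:
  assumes \<Omega>: "open \<Omega>" "bounded \<Omega>" and f: "f \<in> Lp p \<Omega>" and p: "1 < p" and \<beta>: "0 < \<beta>" "\<beta> < 1" "\<beta> < 2 - 2 / p"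
  shows "\<exists>A :: 2 \<Rightarrow> 2 \<Rightarrow> real^2 \<Rightarrow> real. \<exists>L\<ge>0. \<exists>B. (\<forall>x. A 1 2 x = A 2 1 x) \<and>
     (\<forall>i j x x'. \<bar>A i j x - A i j x'\<bar> \<le> L * (\<bar>x$1 - x'$1\<bar> + \<bar>x$2 - x'$2\<bar>) powr \<beta>) \<and>
     (\<forall>i j x. \<bar>A i j x\<bar> \<le> B) \<and>
     (\<forall>\<phi> \<in> test_functions \<Omega>. (LINT x|lborel. A 1 1 x * iter_partial [2,2] \<phi> x + A 2 2 x * iter_partial [1,1] \<phi> x
        - 2 * (A 1 2 x * iter_partial [2,1] \<phi> x)) = - regular \<Omega> f \<phi>)"
proof -
  obtain F where F: "integrable lborel F" "integrable lborel (\<lambda>x. \<bar>F x\<bar> powr p)" "\<And>x. x \<notin> \<Omega> \<Longrightarrow> F x = 0"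
    "\<And>\<phi>. \<phi> \<in> test_functions \<Omega> \<Longrightarrow> regular \<Omega> f \<phi> = (LINT x|lborel. F x * \<phi> x)"
    by (rule Lp_borel_representative[OF \<Omega> f p]) (rule that, assumption+)
  obtain R where R: "R > 0" "\<And>x. x \<in> \<Omega> \<Longrightarrow> norm x \<le> R" using \<Omega>(2) unfolding bounded_pos by blast
  have S: "\<bar>x$1\<bar> \<le> R \<and> \<bar>x$2\<bar> \<le> R" if "F x \<noteq> 0" for x
    using F(3)[of x] that R(2)[of x] component_le_norm_cart[of x] by (meson order_trans)
  define Am where "Am = (\<lambda>m x. LINT y|lborel. cone_kernel m (x - y) * F y)"
  obtain L where L: "L \<ge> 0" "\<And>m x x'. m \<le> 2 \<Longrightarrow> \<bar>Am m x - Am m x'\<bar> \<le> L * (\<bar>x$1 - x'$1\<bar> + \<bar>x$2 - x'$2\<bar>) powr \<beta>"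
    using potential_holder[OF F(1,2) S p \<beta> less_imp_le[OF R(1)]] unfolding Am_def by blast
  have Fm [measurable]: "F \<in> borel_measurable borel" using F by auto
  define B where "B = (LINT y|lborel. 6 * \<bar>F y\<bar>)"
  have B: "\<bar>Am m x\<bar> \<le> B" for m x
    unfolding Am_def B_def
  proof (rule order_trans[OF integral_abs_bound], rule integral_mono)
    show i: "integrable lborel (\<lambda>y. 6 * \<bar>F y\<bar>)" using F by simp
    show b: "\<bar>cone_kernel m (x - y) * F y\<bar> \<le> 6 * \<bar>F y\<bar>" for y
      unfolding abs_mult by (intro mult_right_mono cone_kernel_bound) auto
    show "integrable lborel (\<lambda>y. \<bar>cone_kernel m (x - y) * F y\<bar>)"
      by (rule Bochner_Integration.integrable_bound[OF i]) (use b in auto)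
  qed
  \<comment> \<open>Tested against the Hessian of \<open>\<phi>\<close>, \<open>curl curl\<close>
    pairs that Hessian with the cofactor matrix. Hence \<open>A\<close> is the average of minus the
    cofactor matrix of \<open>(1, s) \<otimes> (1, s)\<close>: this swaps the indices 0 and 2 and
    makes the off-diagonal sign positive.\<close>
  define A :: "2 \<Rightarrow> 2 \<Rightarrow> real^2 \<Rightarrow> real" where
    "A = (\<lambda>i j x. if i = 1 \<and> j = 1 then - Am 2 x else if i = 2 \<and> j = 2 then - Am 0 x else Am 1 x)"
  have eq: "(LINT x|lborel. A 1 1 x * iter_partial [2,2] \<phi> x + A 2 2 x * iter_partial [1,1] \<phi> x
        - 2 * (A 1 2 x * iter_partial [2,1] \<phi> x)) = - regular \<Omega> f \<phi>" if \<phi>: "\<phi> \<in> test_functions \<Omega>" for \<phi>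
  proof -
    note t = test_functionsD[OF \<phi>]
    note C = C_k_C1[OF t(1)]
    have C0: "C1 \<phi> (\<lambda>i. iter_partial [i] \<phi>)" and C1': "C1 (iter_partial [i] \<phi>) (\<lambda>j. iter_partial [j,i] \<phi>)" for i
      using C[of "[]"] C[of "[i]"] by simp_all
    have csp: "csupp (iter_partial [j,i] \<phi>)" for i j using csupp_pd[OF C1' csupp_pd[OF C0 t(2)]] .
    have cp: "continuous_on UNIV (iter_partial [j,i] \<phi>)" for i j using C1_cont'[OF C1'] .
    have mix: "iter_partial [1,2] \<phi> = iter_partial [2,1] \<phi>"
      using mixed_partials[OF C0 C1'] by simp
    note fub = potential_fubini[OF F(1) cp csp]
    have Ai: "integrable lborel (\<lambda>x. Am m x * iter_partial [j,i] \<phi> x)" for m i j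
      using fub(2) unfolding Am_def .
    have Fi: "integrable lborel (\<lambda>y. F y * (LINT z|lborel. cone_kernel m z * iter_partial [j,i] \<phi> (y + z)))" for m i j
      by (rule fub(3))
    have AF: "(LINT x|lborel. Am m x * iter_partial [j,i] \<phi> x) = (LINT y|lborel. F y * (LINT z|lborel. cone_kernel m z * iter_partial [j,i] \<phi> (y + z)))" for m i j
      using fub(1) unfolding Am_def .
    have Ki: "integrable lborel (\<lambda>z. cone_kernel m z * iter_partial [j,i] \<phi> (y + z))" for m i j y
      by (rule cone_kernel_product_integrable[OF cp csp])
    have "(LINT x|lborel. A 1 1 x * iter_partial [2,2] \<phi> x + A 2 2 x * iter_partial [1,1] \<phi> x
        - 2 * (A 1 2 x * iter_partial [2,1] \<phi> x)) = 
        - ((LINT x|lborel. Am 2 x * iter_partial [2,2] \<phi> x) + (LINT x|lborel. Am 0 x * iter_partial [1,1] \<phi> x)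
         + ((LINT x|lborel. Am 1 x * iter_partial [2,1] \<phi> x) + (LINT x|lborel. Am 1 x * iter_partial [1,2] \<phi> x)))"
      using Ai unfolding mix by (simp add: A_def del: iter_partial.simps)
    also have "\<dots> = - (LINT y|lborel. F y * ((LINT z|lborel. cone_kernel 2 z * iter_partial [2,2] \<phi> (y + z)) + (LINT z|lborel. cone_kernel 0 z * iter_partial [1,1] \<phi> (y + z))
         + ((LINT z|lborel. cone_kernel 1 z * iter_partial [2,1] \<phi> (y + z)) + (LINT z|lborel. cone_kernel 1 z * iter_partial [1,2] \<phi> (y + z)))))"
      unfolding AF using Fi by (simp add: distrib_left del: iter_partial.simps)
    also have "\<dots> = - (LINT y|lborel. F y * (LINT z|lborel. cone_kernel 2 z * iter_partial [2,2] \<phi> (y + z) + cone_kernel 0 z * iter_partial [1,1] \<phi> (y + z)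
         + (cone_kernel 1 z * iter_partial [2,1] \<phi> (y + z) + cone_kernel 1 z * iter_partial [1,2] \<phi> (y + z))))"
      using Ki by (simp del: iter_partial.simps)
    also have "\<dots> = - (LINT y|lborel. F y * \<phi> y)"
      using kernel_representation[OF C0 C1' t(2)] by (simp del: iter_partial.simps)
    finally show ?thesis using F(4)[OF \<phi>] by simp
  qed
  have hold: "\<bar>A i j x - A i j x'\<bar> \<le> L * (\<bar>x$1 - x'$1\<bar> + \<bar>x$2 - x'$2\<bar>) powr \<beta>" for i j x x'
    using L(2)[of 0 x x'] L(2)[of 1 x x'] L(2)[of 2 x x'] by (simp add: A_def abs_minus_commute)
  have bd: "\<bar>A i j x\<bar> \<le> B" for i j x using B by (simp add: A_def)
  have sym: "A 1 2 x = A 2 1 x" for x by (simp add: A_def)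
  show ?thesis
    by (intro exI[of _ A] exI[of _ L] exI[of _ B] conjI allI ballI L(1) sym hold bd eq)
qed

section \<open>Density of the solutions\<close>

lemma jet_sin: "\<exists>K. \<forall>x. jet (\<lambda>z. sin (c * (z $ k - b))) x K"
proof -
  have th: "C1 (\<lambda>z. c * (z $ k - b)) (\<lambda>i z. c * ((if i = k then 1 else 0) - 0))"
    by (rule C1_cmult[OF C1_diff[OF C1_nth C1_const]])
  have s: "C1 (\<lambda>z. sin (c * (z $ k - b))) (\<lambda>i z. cos (c * (z $ k - b)) * (c * ((if i = k then 1 else 0) - 0)))"
    by (rule C1_compose[OF th DERIV_sin]) (intro continuous_intros)
  have co: "C1 (\<lambda>z. cos (c * (z $ k - b))) (\<lambda>i z. - sin (c * (z $ k - b)) * (c * ((if i = k then 1 else 0) - 0)))"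
    by (rule C1_compose[OF th DERIV_cos]) (intro continuous_intros)
  let ?e = "\<lambda>i. c * ((if i = k then 1 else 0) - 0)"
  have s2: "C1 (\<lambda>z. cos (c * (z $ k - b)) * ?e i)
     (\<lambda>j z. - sin (c * (z $ k - b)) * ?e j * ?e i + cos (c * (z $ k - b)) * 0)" for i
    by (rule C1_mult[OF co C1_const])
  have e: "\<bar>?e i\<bar> \<le> \<bar>c\<bar>" for i by simp
  show ?thesis
    unfolding jet_def
  proof (intro exI[of _ "1 + \<bar>c\<bar> + \<bar>c\<bar> * \<bar>c\<bar>"] allI exI conjI, rule s, rule s2)
    fix x :: "real^2" and i j
    have sc: "\<bar>sin t\<bar> \<le> 1" "\<bar>cos t\<bar> \<le> 1" for t :: real by simp_all
    have "0 \<le> \<bar>c\<bar> * \<bar>c\<bar>" by simp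
    show "\<bar>sin (c * (x $ k - b))\<bar> \<le> 1 + \<bar>c\<bar> + \<bar>c\<bar> * \<bar>c\<bar>"
      using sc(1)[of "c * (x $ k - b)"] \<open>0 \<le> \<bar>c\<bar> * \<bar>c\<bar>\<close> by linarith
    have "\<bar>cos (c * (x $ k - b)) * ?e i\<bar> \<le> 1 * \<bar>c\<bar>"
      unfolding abs_mult[of "cos _"] by (intro mult_mono sc e) auto
    then show "\<bar>cos (c * (x $ k - b)) * ?e i\<bar> \<le> 1 + \<bar>c\<bar> + \<bar>c\<bar> * \<bar>c\<bar>"
      using \<open>0 \<le> \<bar>c\<bar> * \<bar>c\<bar>\<close> by linarith
    have "\<bar>- sin (c * (x $ k - b)) * ?e j * ?e i\<bar> \<le> 1 * \<bar>c\<bar> * \<bar>c\<bar>"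
      unfolding abs_mult[of "_ * _" "?e i"] abs_mult[of "- sin _"] abs_minus_cancel by (intro mult_mono sc e) auto
    then show "\<bar>- sin (c * (x $ k - b)) * ?e j * ?e i + cos (c * (x $ k - b)) * 0\<bar> \<le> 1 + \<bar>c\<bar> + \<bar>c\<bar> * \<bar>c\<bar>"
      by simp
  qed
qed

text \<open>Stone-Weierstrass in the algebra of functions with a uniform jet bound on the whole
  plane. Coordinate functions are unbounded, so sines separate points instead; the frequency is
  chosen to give the values \<open>sin 0\<close> and \<open>sin 1\<close> at the two points.\<close>

lemma smooth_approximation:
  assumes "compact S" "continuous_on S v0" "\<epsilon> > 0"
  shows "\<exists>u. (\<exists>K. \<forall>x. jet u x K) \<and> (\<forall>x\<in>S. \<bar>v0 x - u x\<bar> < \<epsilon>)"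
proof -
  define P where "P = (\<lambda>u. \<exists>K. \<forall>x. jet u x K)"
  have "\<exists>u. P u \<and> (\<forall>x\<in>S. \<bar>v0 x - u x\<bar> < \<epsilon>)"
  proof (rule Stone_Weierstrass_HOL[OF assms(1) _ _ _ _ _ assms(2,3)])
    show "P (\<lambda>x. c)" for c unfolding P_def using jet_const by blast
    show "continuous_on S f" if Pf: "P f" for f
    proof -
      obtain K where "jet f 0 K" using Pf unfolding P_def by blast
      then obtain u' where "C1 f u'" unfolding jet_def by blast
      from continuous_on_subset[OF C1_cont[OF this]] show ?thesis by simp
    qed
    show "P (\<lambda>x. f x + g x)" if "P f \<and> P g" for f g using that unfolding P_def by (blast intro: jet_add)
    show "P (\<lambda>x. f x * g x)" if "P f \<and> P g" for f g using that unfolding P_def by (blast intro: jet_mult)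
    fix x y :: "real^2" assume "x \<in> S \<and> y \<in> S \<and> x \<noteq> y"
    then obtain k where k: "x $ k \<noteq> y $ k" by (auto simp: vec_eq_iff)
    let ?f = "\<lambda>z. sin (1 / (y $ k - x $ k) * (z $ k - x $ k))"
    have "P ?f" unfolding P_def by (rule jet_sin)
    moreover have "sin (1::real) \<noteq> 0" using sin_gt_zero_02[of 1] by simp
    then have "?f x \<noteq> ?f y" using k by simp
    ultimately show "\<exists>f. P f \<and> f x \<noteq> f y" by blast
  qed
  then show ?thesis unfolding P_def .
qed

text \<open>Symmetric gradients vanish when tested, so the fields \<open>ws n\<close> need not converge.\<close>

lemma weak_limit_identity:
  fixes A :: "2 \<Rightarrow> 2 \<Rightarrow> real^2 \<Rightarrow> real"
  assumes g: "\<And>i. continuous_on UNIV (g i)" and A: "\<And>i j. continuous_on UNIV (A i j)"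
    and w: "\<And>n i. C1 (ws n i) (Ws n i)"
    and b: "b \<longlonglongrightarrow> 0" "\<And>n i j x. \<bar>A i j x - metric_form g (Ws n) i j x\<bar> \<le> b n"
    and f: "\<forall>k. \<phi> \<in> C_k k" and csupp: "csupp \<phi>"
  shows "(LINT x|lborel. (g 1 x * g 1 x) * iter_partial [2,2] \<phi> x + (g 2 x * g 2 x) * iter_partial [1,1] \<phi> x - 2 * ((g 1 x * g 2 x) * iter_partial [2,1] \<phi> x))
    = 2 * (LINT x|lborel. A 1 1 x * iter_partial [2,2] \<phi> x + A 2 2 x * iter_partial [1,1] \<phi> x - 2 * (A 1 2 x * iter_partial [2,1] \<phi> x))"
proof -
  note C = C_k_C1[OF f]
  have cp: "csupp (iter_partial is \<phi>)" for "is"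
    by (induction "is") (use csupp csupp_pd[OF C] in auto)
  let ?p = "\<lambda>is. iter_partial is \<phi>"
  have c: "continuous_on UNIV (?p is)" for "is" using C1_cont[OF C] .
  let ?Q = "\<lambda>B x. B 1 1 x * ?p [2,2] x + B 2 2 x * ?p [1,1] x - 2 * (B 1 2 x * ?p [2,1] x)"
  have csQ: "csupp (?Q B)" for B :: "2 \<Rightarrow> 2 \<Rightarrow> real^2 \<Rightarrow> real"
  proof -
    from cp[of "[2,2]"] obtain R1 where "\<And>x. norm x > R1 \<Longrightarrow> ?p [2,2] x = 0" unfolding csupp_def by blast
    moreover from cp[of "[1,1]"] obtain R2 where "\<And>x. norm x > R2 \<Longrightarrow> ?p [1,1] x = 0" unfolding csupp_def by blast
    moreover from cp[of "[2,1]"] obtain R3 where "\<And>x. norm x > R3 \<Longrightarrow> ?p [2,1] x = 0" unfolding csupp_def by blast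
    ultimately have "?Q B x = 0" if "norm x > max 1 (max R1 (max R2 R3))" for x using that by (simp del: iter_partial.simps)
    then show ?thesis unfolding csupp_def by (intro exI[of _ "max 1 (max R1 (max R2 R3))"]) auto
  qed
  have iQ: "integrable lborel (?Q B)" if "\<And>i j. continuous_on UNIV (B i j)" for B :: "2 \<Rightarrow> 2 \<Rightarrow> real^2 \<Rightarrow> real"
    by (rule csupp_integrable[OF _ csQ]) (intro continuous_intros that c)
  let ?gg = "\<lambda>i j x. g i x * g j x"
  have cgg: "continuous_on UNIV (?gg i j)" for i j by (intro continuous_intros g)
  have cSG: "continuous_on UNIV (metric_form g (Ws n) i j)" for n i j
    unfolding metric_form_def[abs_def] using C1_cont'[OF w] by (intro continuous_intros g) auto
  \<comment> \<open>The symmetric gradient drops out here, so the integral on the left does not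
    depend on \<open>n\<close>.\<close>
  have half: "integral\<^sup>L lborel (?Q (metric_form g (Ws n))) = (1/2) * integral\<^sup>L lborel (?Q ?gg)" for n
  proof -
    let ?S = "\<lambda>x. Ws n 1 1 x * ?p [2,2] x + Ws n 2 2 x * ?p [1,1] x - (Ws n 1 2 x + Ws n 2 1 x) * ?p [2,1] x"
    have e: "?Q (metric_form g (Ws n)) = (\<lambda>x. (1/2) * ?Q ?gg x + ?S x)"
      by (rule ext) (simp add: metric_form_def field_simps del: iter_partial.simps)
    have iS: "integrable lborel ?S"
    proof -
      have "?S = (\<lambda>x. ?Q (metric_form g (Ws n)) x - (1/2) * ?Q ?gg x)"
        by (rule ext) (simp add: metric_form_def field_simps del: iter_partial.simps)
      moreover have "integrable lborel (\<lambda>x. ?Q (metric_form g (Ws n)) x - (1/2) * ?Q ?gg x)"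
        by (rule Bochner_Integration.integrable_diff[OF iQ[of "metric_form g (Ws n)", OF cSG] integrable_mult_right[OF iQ[of ?gg, OF cgg]]])
      ultimately show ?thesis by (simp only:)
    qed
    have "integral\<^sup>L lborel (?Q (metric_form g (Ws n))) = integral\<^sup>L lborel (\<lambda>x. (1/2) * ?Q ?gg x) + integral\<^sup>L lborel ?S"
      unfolding e by (rule Bochner_Integration.integral_add[OF integrable_mult_right[OF iQ[of ?gg, OF cgg]] iS])
    also have "integral\<^sup>L lborel ?S = 0" by (rule symmetric_gradient_curl_curl[OF w f csupp])
    finally show ?thesis by (simp del: iter_partial.simps)
  qed
  define N where "N = (LINT x|lborel. \<bar>?p [2,2] x\<bar> + \<bar>?p [1,1] x\<bar> + 2 * \<bar>?p [2,1] x\<bar>)"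
  have ip: "integrable lborel (?p is)" for "is" by (rule csupp_integrable[OF c cp])
  have iN: "integrable lborel (\<lambda>x. \<bar>?p [2,2] x\<bar> + \<bar>?p [1,1] x\<bar> + 2 * \<bar>?p [2,1] x\<bar>)"
    by (intro Bochner_Integration.integrable_add integrable_mult_right integrable_abs ip)
  have id1: "a * p + a' * q - 2 * (a'' * r) - (s * p + s' * q - 2 * (s'' * r)) = (a - s) * p + (a' - s') * q - 2 * ((a'' - s'') * r)"
    for a a' a'' s s' s'' p q r :: real by (simp add: algebra_simps)
  have id2: "a * p + a * q + 2 * (a * r) = a * (p + q + 2 * r)" for a p q r :: real by (simp add: algebra_simps)
  have id3: "\<bar>p + q - 2 * r\<bar> \<le> \<bar>p\<bar> + \<bar>q\<bar> + 2 * \<bar>r\<bar>" for p q r :: real by linarith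
  have id4: "p + q + 2 * r \<le> p' + q' + 2 * r'" if "p \<le> p'" "q \<le> q'" "r \<le> r'" for p q r p' q' r' :: real using that by linarith
  have bound: "\<bar>integral\<^sup>L lborel (?Q A) - (1/2) * integral\<^sup>L lborel (?Q ?gg)\<bar> \<le> b n * N" for n
  proof -
    have "(LINT x|lborel. ?Q A x - ?Q (metric_form g (Ws n)) x) = integral\<^sup>L lborel (?Q A) - (1/2) * integral\<^sup>L lborel (?Q ?gg)"
      unfolding half[of n, symmetric] by (rule Bochner_Integration.integral_diff[OF iQ[of A, OF A] iQ[of "metric_form g (Ws n)", OF cSG]])
    then have "\<bar>integral\<^sup>L lborel (?Q A) - (1/2) * integral\<^sup>L lborel (?Q ?gg)\<bar> = \<bar>LINT x|lborel. ?Q A x - ?Q (metric_form g (Ws n)) x\<bar>"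
      by (simp only:)
    also have "\<dots> \<le> (LINT x|lborel. \<bar>?Q A x - ?Q (metric_form g (Ws n)) x\<bar>)" by (rule integral_abs_bound)
    also have "\<dots> \<le> (LINT x|lborel. b n * (\<bar>?p [2,2] x\<bar> + \<bar>?p [1,1] x\<bar> + 2 * \<bar>?p [2,1] x\<bar>))"
    proof (rule integral_mono)
      show "integrable lborel (\<lambda>x. \<bar>?Q A x - ?Q (metric_form g (Ws n)) x\<bar>)"
        by (rule integrable_abs[OF Bochner_Integration.integrable_diff[OF iQ[of A, OF A] iQ[of "metric_form g (Ws n)", OF cSG]]])
      show "integrable lborel (\<lambda>x. b n * (\<bar>?p [2,2] x\<bar> + \<bar>?p [1,1] x\<bar> + 2 * \<bar>?p [2,1] x\<bar>))"
        by (rule integrable_mult_right[OF iN])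
      fix x
      let ?E = "\<lambda>i j. A i j x - metric_form g (Ws n) i j x"
      have m: "\<bar>?E i j * t\<bar> \<le> b n * \<bar>t\<bar>" for i j t unfolding abs_mult by (intro mult_right_mono b) auto
      have e: "?Q A x - ?Q (metric_form g (Ws n)) x = ?E 1 1 * ?p [2,2] x + ?E 2 2 * ?p [1,1] x - 2 * (?E 1 2 * ?p [2,1] x)"
        by (rule id1)
      have "\<bar>?Q A x - ?Q (metric_form g (Ws n)) x\<bar> \<le> \<bar>?E 1 1 * ?p [2,2] x\<bar> + \<bar>?E 2 2 * ?p [1,1] x\<bar> + 2 * \<bar>?E 1 2 * ?p [2,1] x\<bar>"
        unfolding e by (rule id3)
      from order_trans[OF this id4[OF m m m]]
      show "\<bar>?Q A x - ?Q (metric_form g (Ws n)) x\<bar> \<le> b n * (\<bar>?p [2,2] x\<bar> + \<bar>?p [1,1] x\<bar> + 2 * \<bar>?p [2,1] x\<bar>)"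
        unfolding id2 .
    qed
    also have "\<dots> = b n * N" unfolding N_def by simp
    finally show ?thesis .
  qed
  have "(\<lambda>n. b n * N) \<longlonglongrightarrow> 0 * N" by (rule tendsto_mult_right[OF b(1)])
  then have "\<bar>integral\<^sup>L lborel (?Q A) - (1/2) * integral\<^sup>L lborel (?Q ?gg)\<bar> \<le> 0 * N"
    by (rule LIMSEQ_le_const) (intro exI allI impI bound)
  then show ?thesis by linarith
qed

text \<open>One number \<open>\<nu>\<close> strictly between \<open>\<alpha>\<close> and
  \<open>1 - 1 / p\<close> governs all exponents: \<open>A\<close> gets the Hoelder exponent
  \<open>\<beta> = 2 * \<nu>\<close>, and the Hessian grows by \<open>\<rho>\<close> to the power
  \<open>N - 1\<close> with \<open>N = 1 / \<nu>\<close>. Then \<open>N > 7\<close> leaves room for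
  the cost of the corrugations, \<open>N * \<alpha> < 1\<close> makes the Hoelder bounds summable,
  and \<open>N * \<beta> = 2\<close> matches the decay of the defect.\<close>

lemma approximate_solution:
  assumes \<Omega>: "open \<Omega>" "bounded \<Omega>" and f: "f \<in> Lp p \<Omega>" and p: "1 < p" "p \<le> 7/6" and \<alpha>: "0 < \<alpha>" "\<alpha> < 1 - 1/p"
    and v0: "continuous_on (closure \<Omega>) v0" and \<epsilon>: "\<epsilon> > 0"
  shows "\<exists>v \<in> holder_space 1 \<alpha>. solves_Det_Hess \<Omega> f v \<and> (\<forall>x\<in>closure \<Omega>. \<bar>v x - v0 x\<bar> < \<epsilon>)"
proof -
  obtain C where C1: "C \<ge> 1" and "iteration_constant C" using convex_integration by blast
  note ci = this(2)[unfolded iteration_constant_def]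
  obtain \<nu> where \<nu>: "\<alpha> < \<nu>" "\<nu> < 1 - 1/p" using dense[OF \<alpha>(2)] by blast
  have "1 - 1/p \<le> 1/7" using p by (simp add: field_simps)
  then have \<nu>7: "0 < \<nu>" "\<nu> < 1/7" using \<nu> \<alpha> by linarith+
  define \<beta> where "\<beta> = 2 * \<nu>"
  have \<beta>: "0 < \<beta>" "\<beta> < 1" "\<beta> < 2 - 2/p" using \<nu> \<nu>7 by (auto simp: \<beta>_def)
  define N where "N = 1 / \<nu>"
  have N7: "N > 7" "N * \<alpha> < 1" "N * \<beta> = 2" using \<nu> \<nu>7 \<alpha> by (auto simp: N_def \<beta>_def field_simps)
  obtain A0 :: "2 \<Rightarrow> 2 \<Rightarrow> real^2 \<Rightarrow> real" and L B where A0: "\<And>x. A0 1 2 x = A0 2 1 x" and L: "L \<ge> 0"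
    "\<And>i j x x'. \<bar>A0 i j x - A0 i j x'\<bar> \<le> L * (\<bar>x$1 - x'$1\<bar> + \<bar>x$2 - x'$2\<bar>) powr \<beta>"
    and B: "\<And>i j x. \<bar>A0 i j x\<bar> \<le> B"
    and eq: "\<And>\<phi>. \<phi> \<in> test_functions \<Omega> \<Longrightarrow> (LINT x|lborel. A0 1 1 x * iter_partial [2,2] \<phi> x + A0 2 2 x * iter_partial [1,1] \<phi> x
        - 2 * (A0 1 2 x * iter_partial [2,1] \<phi> x)) = - regular \<Omega> f \<phi>"
    using potential[OF \<Omega> f p(1) \<beta>] by blast
  have cA0: "continuous_on UNIV (A0 i j)" for i j
    unfolding continuous_on_eq_continuous_at[OF open_UNIV] 
  proof (intro ballI)
    fix x :: "real^2"
    have "((\<lambda>x'. L * (\<bar>x'$1 - x$1\<bar> + \<bar>x'$2 - x$2\<bar>) powr \<beta>) \<longlongrightarrow> L * (\<bar>x$1 - x$1\<bar> + \<bar>x$2 - x$2\<bar>) powr \<beta>) (at x)"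
      by (intro tendsto_intros tendsto_powr') (use \<beta> in auto)
    then have "((\<lambda>x'. A0 i j x' - A0 i j x) \<longlongrightarrow> 0) (at x)"
      by (intro Lim_null_comparison[OF always_eventually[of "\<lambda>x'. norm (A0 i j x' - A0 i j x) \<le> L * (\<bar>x'$1 - x$1\<bar> + \<bar>x'$2 - x$2\<bar>) powr \<beta>"]])
        (use L in auto)
    then show "isCont (A0 i j) x" unfolding isCont_def by (simp add: LIM_zero_iff)
  qed
  obtain u K where uK: "\<And>x. jet u x K" and ud: "\<And>x. x \<in> closure \<Omega> \<Longrightarrow> \<bar>v0 x - u x\<bar> < \<epsilon>/2"
    using smooth_approximation[OF _ v0, of "\<epsilon>/2"] \<epsilon> \<Omega>(2) by (auto simp: compact_closure)
  obtain u' u'' where u: "C1 u u'" "\<And>i. C1 (u' i) (u'' i)" "\<And>x. \<bar>u x\<bar> \<le> K" "\<And>i x. \<bar>u' i x\<bar> \<le> K" "\<And>i j x. \<bar>u'' i j x\<bar> \<le> K"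
    by (rule jet_all[OF uK]) (rule that)
  have K0: "K \<ge> 0" using u(3)[of 0] by simp
  have B0: "B \<ge> 0" using B[of 1 1 0] by simp
  \<comment> \<open>Large enough for \<open>\<rho> powr (N - 7)\<close> to absorb the constant
    \<open>200 * C\<close> of a stage; the value 5 ensures
    \<open>24 \<le> \<rho>\<^sup>2\<close>.\<close>
  define \<rho> where "\<rho> = max 5 ((200 * C) powr (1 / (N - 7)))"
  have \<rho>: "\<rho> \<ge> 5" by (simp add: \<rho>_def)
  define \<kappa> where "\<kappa> = \<rho> powr (N - 1)"
  have \<kappa>: "200 * C * \<rho> ^ 6 \<le> \<kappa>"
  proof -
    have "200 * C = ((200 * C) powr (1 / (N - 7))) powr (N - 7)" using C1 N7 by (simp add: powr_powr)
    also have "\<dots> \<le> \<rho> powr (N - 7)" using N7 by (intro powr_mono2) (auto simp: \<rho>_def)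
    finally have "200 * C * \<rho> ^ 6 \<le> \<rho> powr (N - 7) * \<rho> ^ 6" using \<rho> by (intro mult_right_mono) auto
    also have "\<dots> = \<rho> powr (N - 7) * \<rho> powr 6" using \<rho> by (simp add: powr_numeral)
    also have "\<dots> = \<kappa>" by (simp add: powr_add[symmetric] \<kappa>_def)
    finally show ?thesis .
  qed
  have \<kappa>0: "\<kappa> > 0" using \<rho> by (simp add: \<kappa>_def)
  \<comment> \<open>The multiple of the identity is chosen so large that \<open>A0\<close> and the
    quadratic term of \<open>u\<close> together amount to less than \<open>s0\<^sup>2 / 24\<close>;
    the starting function is then a strict subsolution with \<open>w = 0\<close>.\<close>
  define s0 where "s0 = sqrt (24 * (B + K * K) + 1)"
  have s0: "s0 > 0" "s0\<^sup>2 = 24 * (B + K * K) + 1" using B0 K0 by (auto simp: s0_def add_nonneg_pos)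
  define c where "c = s0\<^sup>2 / (48 * \<rho>\<^sup>2 * (L + 1))"
  have c: "c > 0" using s0(1) \<rho> L(1) by (simp add: c_def)
  define M1 where "M1 = s0 / (50 * c powr (1/\<beta>))"
  define M2 where "M2 = s0 * (9 * C * s0 + 4 * K) * 4 / (100 * \<epsilon>)"
  \<comment> \<open>A bound on the Hessian may be enlarged at will. \<open>K + 1\<close> makes it
    valid and positive, \<open>M1\<close> makes the first averaging length small compared with the
    roughness of \<open>A\<close>, and \<open>M2\<close> keeps the total displacement below
    \<open>\<epsilon> / 4\<close>.\<close>
  define M0 where "M0 = max (K + 1) (max M1 M2)"
  have M0: "M0 > 0" "K \<le> M0" "M1 \<le> M0" "M2 \<le> M0" using K0 by (auto simp: M0_def)
  define A where "A = (\<lambda>i j x. A0 i j x + s0\<^sup>2 * kronecker i j)"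
  have cA: "\<forall>i j. continuous_on UNIV (A i j)" unfolding A_def by (intro allI continuous_intros cA0)
  have symA: "\<forall>x. A 1 2 x = A 2 1 x" using A0 by (simp add: A_def kronecker_def)
  have St0: "St u u' u'' (\<lambda>i x. 0) (\<lambda>i j x. 0)" unfolding St_def using u C1_const[of 0] by auto
  have def: "\<forall>i j x. \<bar>A i j x - metric_form u' (\<lambda>i j x. 0) i j x - s0\<^sup>2 * kronecker i j\<bar> \<le> s0\<^sup>2/24"
  proof (intro allI)
    fix i j x
    have "\<bar>u' i x * u' j x\<bar> \<le> K * K" unfolding abs_mult by (intro mult_mono u K0) auto
    then show "\<bar>A i j x - metric_form u' (\<lambda>i j x. 0) i j x - s0\<^sup>2 * kronecker i j\<bar> \<le> s0\<^sup>2/24"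
      using B[of i j x] K0 unfolding A_def metric_form_def s0(2) by (simp add: abs_if split: if_splits)
  qed
  have AQ: "\<forall>n i j x. \<forall>y \<in> fwd_box (2 * (s0 / \<rho> ^ n / (200 * (M0 * \<kappa> ^ n)))) x. \<bar>A i j y - A i j x\<bar> \<le> (s0 / \<rho> ^ n)\<^sup>2 / (48*\<rho>\<^sup>2)"
  proof (intro allI ballI)
    fix n i j x y assume y: "y \<in> fwd_box (2 * (s0 / \<rho> ^ n / (200 * (M0 * \<kappa> ^ n)))) x"
    let ?d = "\<bar>y$1 - x$1\<bar> + \<bar>y$2 - x$2\<bar>"
    \<comment> \<open>The averaging length shrinks by
      \<open>\<rho> * \<kappa> = \<rho> powr N\<close> per stage. As \<open>N * \<beta> = 2\<close>,
      both sides of the claim decay like \<open>1 / (\<rho> ^ n)\<^sup>2\<close>, so the choice of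
      \<open>M1\<close> settles all stages at once.\<close>
    have rk: "\<rho> * \<kappa> = \<rho> powr N" using \<rho> by (simp add: \<kappa>_def powr_mult_base)
    have "?d \<le> 4 * (s0 / \<rho> ^ n / (200 * (M0 * \<kappa> ^ n)))" using y unfolding fwd_box_def forall_2 by auto
    also have "\<dots> = (s0 / (50 * M0)) / (\<rho> * \<kappa>) ^ n" by (simp add: power_mult_distrib)
    finally have "?d powr \<beta> \<le> ((s0 / (50 * M0)) / (\<rho> * \<kappa>) ^ n) powr \<beta>" using \<beta> by (intro powr_mono2) auto
    also have "\<dots> = (s0 / (50 * M0)) powr \<beta> / (((\<rho> * \<kappa>) ^ n) powr \<beta>)"
      by (rule powr_divide)
    also have "((\<rho> * \<kappa>) ^ n) powr \<beta> = (\<rho> ^ n)\<^sup>2"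
    proof -
      have "((\<rho> * \<kappa>) ^ n) powr \<beta> = \<rho> powr (N * real n * \<beta>)"
        unfolding rk using \<rho> by (simp add: powr_realpow[symmetric] powr_powr)
      also have "N * real n * \<beta> = 2 * real n" using N7(3) by (metis mult.assoc mult.commute)
      also have "\<rho> powr (2 * real n) = (\<rho> ^ n)\<^sup>2" using \<rho> 
        by (simp add: powr_realpow[symmetric] powr_powr power2_eq_square powr_add[symmetric])
      finally show ?thesis .
    qed
    also have "(s0 / (50 * M0)) powr \<beta> / (\<rho> ^ n)\<^sup>2 \<le> c / (\<rho> ^ n)\<^sup>2"
    proof (intro divide_right_mono)
      have "s0 / (50 * M0) \<le> c powr (1/\<beta>)"
      proof -
        have "s0 \<le> M0 * (50 * c powr (1/\<beta>))" using M0(3) c unfolding M1_def by (simp add: divide_le_eq)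
        then show ?thesis using M0(1) by (simp add: divide_le_eq mult_ac)
      qed
      then have "(s0 / (50 * M0)) powr \<beta> \<le> (c powr (1/\<beta>)) powr \<beta>" using \<beta> s0 M0 by (intro powr_mono2) auto
      also have "\<dots> = c" using c \<beta> by (simp add: powr_powr)
      finally show "(s0 / (50 * M0)) powr \<beta> \<le> c" .
    qed simp
    finally have d: "?d powr \<beta> \<le> c / (\<rho> ^ n)\<^sup>2" .
    have "\<bar>A i j y - A i j x\<bar> \<le> L * ?d powr \<beta>" using L(2)[of i j y x] by (simp add: A_def)
    also have "\<dots> \<le> (L + 1) * (c / (\<rho> ^ n)\<^sup>2)" using L(1) d by (intro mult_mono) auto
    also have "\<dots> = (s0 / \<rho> ^ n)\<^sup>2 / (48*\<rho>\<^sup>2)" using L(1) \<rho> by (simp add: c_def power_divide)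
    finally show "\<bar>A i j y - A i j x\<bar> \<le> (s0 / \<rho> ^ n)\<^sup>2 / (48*\<rho>\<^sup>2)" .
  qed
  have H: "\<forall>i j x. \<bar>u'' i j x\<bar> \<le> M0" using u(5) M0(2) by (meson order_trans)
  have Gb: "\<forall>i x. \<bar>u' i x\<bar> \<le> K" using u(4) by blast
  from ci[THEN spec, THEN mp, OF \<rho>, THEN spec, THEN mp, OF \<kappa>, THEN spec, THEN mp, OF s0(1), THEN spec, THEN mp, OF M0(1),
      THEN spec, THEN spec, THEN spec, THEN spec, THEN spec, THEN spec, THEN spec,
      THEN mp, OF St0, THEN mp, OF cA, THEN mp, OF symA, THEN mp, OF H, THEN mp, OF Gb, THEN mp, OF def, THEN mp, OF AQ]
  obtain v g where vg: "C1 v g \<and> (\<forall>x. \<bar>v x - u x\<bar> \<le> (s0 / (100 * M0)) * (9 * C * s0 + 4 * K)) \<and>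
      (\<forall>\<alpha>. 0 < \<alpha> \<longrightarrow> \<alpha> < 1 \<longrightarrow> \<rho> powr (\<alpha> - 1) * \<kappa> powr \<alpha> < 1 \<longrightarrow>
         (\<exists>L. \<forall>i x y. \<bar>g i x - g i y\<bar> \<le> L * dist x y powr \<alpha>)) \<and>
      (\<exists>G. \<forall>i x. \<bar>g i x\<bar> \<le> G) \<and>
      (\<exists>ws Ws b. b \<longlonglongrightarrow> 0 \<and> (\<forall>n i. C1 (ws n i) (Ws n i)) \<and>
         (\<forall>n i j x. \<bar>A i j x - metric_form g (Ws n) i j x\<bar> \<le> b n))" by (elim exE) (rule that)
  have Cv: "C1 v g" using vg by blast
  have vu: "\<bar>v x - u x\<bar> \<le> \<epsilon> / 4" for x
  proof -
    have "\<bar>v x - u x\<bar> \<le> (s0 / (100 * M0)) * (9 * C * s0 + 4 * K)" using vg by blast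
    also have "\<dots> \<le> \<epsilon> / 4"
    proof -
      have "s0 * (9 * C * s0 + 4 * K) * 4 \<le> M0 * (100 * \<epsilon>)" using M0(4) \<epsilon> unfolding M2_def by (simp add: divide_le_eq)
      then show ?thesis using M0(1) by (simp add: divide_le_eq mult_ac)
    qed
    finally show ?thesis .
  qed
  have "\<alpha> < 1" using \<nu> \<nu>7 by linarith
  moreover have "\<rho> powr (\<alpha> - 1) * \<kappa> powr \<alpha> < 1"
  proof -
    have "\<rho> powr (\<alpha> - 1) * \<kappa> powr \<alpha> = \<rho> powr (\<alpha> - 1 + (N - 1) * \<alpha>)"
      by (simp add: \<kappa>_def powr_powr powr_add)
    also have "\<alpha> - 1 + (N - 1) * \<alpha> = N * \<alpha> - 1" by (simp add: algebra_simps)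
    also have "\<rho> powr (N * \<alpha> - 1) < \<rho> powr 0" using \<rho> N7(2) by (intro powr_less_mono) auto
    finally show ?thesis using \<rho> by simp
  qed
  ultimately obtain Lg where Lg: "\<And>i x y. \<bar>g i x - g i y\<bar> \<le> Lg * dist x y powr \<alpha>" using vg \<alpha>(1) by blast
  obtain G where G: "\<And>i x. \<bar>g i x\<bar> \<le> G" using vg by blast
  obtain ws Ws b where wb: "b \<longlonglongrightarrow> 0" "\<And>n i. C1 (ws n i) (Ws n i)" "\<And>n i j x. \<bar>A i j x - metric_form g (Ws n) i j x\<bar> \<le> b n"
    using vg by blast
  have vb: "\<bar>v x\<bar> \<le> K + \<epsilon>" for x using vu[of x] u(3)[of x] \<epsilon> by linarith
  have pv: "partial i v = g i" for i by (rule C1_partial[OF Cv])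
  have "v \<in> holder_space 1 \<alpha>"
  proof -
    have len1: "P is" if "P []" "\<And>i. P [i]" "length is \<le> 1" for P and "is" :: "2 list"
      using that by (cases "is") auto
    have "v \<in> C_k 1" unfolding C_k_def
    proof (intro CollectI conjI allI impI)
      fix "is" :: "2 list" and x assume "length is < 1"
      then show "iter_partial is v differentiable (at x)"
        using C1_has_derivative[OF Cv] unfolding differentiable_def by auto
    next
      fix "is" :: "2 list" assume "length is \<le> 1"
      then show "continuous_on UNIV (iter_partial is v)"
        by (rule len1[rotated 2]) (use C1_cont[OF Cv] C1_cont'[OF Cv] pv in auto)
    qed
    moreover have "bounded (range (iter_partial is v))" if "length is \<le> 1" for "is"
      using that by (rule len1[rotated 2]) (use vb G pv in \<open>auto simp: bounded_iff\<close>)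
    moreover have "\<exists>C. \<forall>x y. \<bar>iter_partial is v x - iter_partial is v y\<bar> \<le> C * dist x y powr \<alpha>" if l: "length is = 1" for "is"
    proof -
      obtain i where "is = [i]" using l by (cases "is") auto
      then show ?thesis using Lg pv by auto
    qed
    ultimately show ?thesis unfolding holder_space_def by auto
  qed
  moreover have "solves_Det_Hess \<Omega> f v"
    unfolding solves_Det_Hess_def
  proof (intro conjI ballI)
    show "v \<in> W12_loc \<Omega>" by (rule C1_W12_loc[OF \<Omega>(1) Cv]) simp
    fix \<phi> assume \<phi>: "\<phi> \<in> test_functions \<Omega>"
    note t = test_functionsD[OF \<phi>]
    note Ck = C_k_C1[OF t(1)]
    have cp: "csupp (iter_partial is \<phi>)" for "is"
      by (induction "is") (use t(2) csupp_pd[OF Ck] in auto)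
    have z: "(LINT x|lborel. iter_partial (i # is) \<phi> x) = 0" for i "is" by (rule integral_pd_zero[OF Ck cp])
    have ip: "integrable lborel (iter_partial is \<phi>)" for "is" by (rule csupp_integrable[OF C1_cont[OF Ck] cp])
    have iA: "integrable lborel (\<lambda>x. A0 i j x * iter_partial is \<phi> x)" for i j "is"
      by (rule csupp_integrable[OF _ csupp_mult[OF cp]]) (intro continuous_intros cA0 C1_cont[OF Ck])
    have "(LINT x|lborel. A 1 1 x * iter_partial [2,2] \<phi> x + A 2 2 x * iter_partial [1,1] \<phi> x - 2 * (A 1 2 x * iter_partial [2,1] \<phi> x))
      = (LINT x|lborel. (A0 1 1 x * iter_partial [2,2] \<phi> x + A0 2 2 x * iter_partial [1,1] \<phi> x - 2 * (A0 1 2 x * iter_partial [2,1] \<phi> x))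
        + s0\<^sup>2 * (iter_partial [2,2] \<phi> x + iter_partial [1,1] \<phi> x))"
      by (intro Bochner_Integration.integral_cong) (simp_all add: A_def kronecker_def algebra_simps del: iter_partial.simps)
    also have "\<dots> = (LINT x|lborel. A0 1 1 x * iter_partial [2,2] \<phi> x + A0 2 2 x * iter_partial [1,1] \<phi> x - 2 * (A0 1 2 x * iter_partial [2,1] \<phi> x))
        + (LINT x|lborel. s0\<^sup>2 * (iter_partial [2,2] \<phi> x + iter_partial [1,1] \<phi> x))"
      by (rule Bochner_Integration.integral_add)
        (intro Bochner_Integration.integrable_add Bochner_Integration.integrable_diff integrable_mult_right iA ip)+
    also have "(LINT x|lborel. s0\<^sup>2 * (iter_partial [2,2] \<phi> x + iter_partial [1,1] \<phi> x)) = 0"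
      using ip z by (simp del: iter_partial.simps)
    finally have "(LINT x|lborel. A 1 1 x * iter_partial [2,2] \<phi> x + A 2 2 x * iter_partial [1,1] \<phi> x - 2 * (A 1 2 x * iter_partial [2,1] \<phi> x)) = - regular \<Omega> f \<phi>"
      using eq[OF \<phi>] by (simp del: iter_partial.simps)
    then show "Det_Hess \<Omega> v \<phi> = regular \<Omega> f \<phi>"
      using Det_Hess_C1[OF \<Omega>(1) Cv _ \<phi>, of v]
        weak_limit_identity[OF C1_cont'[OF Cv] cA[rule_format] wb(2,1,3) t(1,2)] by (simp del: iter_partial.simps)
  qed
  moreover have "\<bar>v x - v0 x\<bar> < \<epsilon>" if "x \<in> closure \<Omega>" for x
    using vu[of x] ud[OF that] \<epsilon> by linarith
  ultimately show ?thesis by blast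
qed

theorem theorem1p1:
  fixes \<Omega> :: "(real^2) set" and f :: "real^2 \<Rightarrow> real" and p \<alpha> :: real
  assumes "open \<Omega>" "bounded \<Omega>" "simply_connected \<Omega>"
    and "f \<in> Lp p \<Omega>" and "0 < \<alpha>"
    and "(p = 7/6 \<and> \<alpha> < 1/7) \<or> (1 < p \<and> p < 7/6 \<and> \<alpha> < 1 - 1/p)"
  shows
    "mtopology_of (cfunspace (top_of_set (closure \<Omega>)) (euclidean_metric :: real metric)) closure_of
       ((\<lambda>v. restrict v (closure \<Omega>)) ` {v \<in> holder_space_closure 1 \<alpha> \<Omega>. solves_Det_Hess \<Omega> f v})
     = mspace (cfunspace (top_of_set (closure \<Omega>)) euclidean_metric) \<and>
     (\<forall>v0. continuous_on (closure \<Omega>) v0 \<longrightarrow>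
       (\<exists>v :: nat \<Rightarrow> real^2 \<Rightarrow> real.
          (\<forall>n. v n \<in> holder_space_closure 1 \<alpha> \<Omega>) \<and>
          uniform_limit (closure \<Omega>) v v0 sequentially \<and>
          (\<forall>n. solves_Det_Hess \<Omega> f (v n))))"
proof -
  have p: "1 < p" "p \<le> 7/6" using assms(6) by (elim disjE conjE; simp)+
  \<comment> \<open>For \<open>p = 7 / 6\<close> the number \<open>1 - 1 / p\<close> is
    \<open>1 / 7\<close>, so both alternatives amount to the same inequality.\<close>
  have \<alpha>: "\<alpha> < 1 - 1/p"
  proof (cases "p = 7/6")
    case True
    have "\<alpha> < 1/7" using assms(6) True by (elim disjE conjE) simp_all
    also have "1/7 = 1 - 1/p" unfolding True by simp
    finally show ?thesis .
  next
    case False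
    then show ?thesis using assms(6) by (elim disjE conjE) simp_all
  qed
  have approx: "\<exists>v \<in> holder_space 1 \<alpha>. solves_Det_Hess \<Omega> f v \<and> (\<forall>x\<in>closure \<Omega>. \<bar>v x - v0 x\<bar> < \<epsilon>)"
    if "continuous_on (closure \<Omega>) v0" "\<epsilon> > 0" for v0 \<epsilon>
    using approximate_solution[OF assms(1,2,4) p assms(5) \<alpha> that] .
  have hc: "v \<in> holder_space_closure 1 \<alpha> \<Omega>" if "v \<in> holder_space 1 \<alpha>" for v
    unfolding holder_space_closure_def by (intro CollectI bexI[of _ v] ballI refl that)
  let ?X = "top_of_set (closure \<Omega>)"
  let ?m = "euclidean_metric :: real metric"
  let ?c = "cfunspace ?X ?m"
  have cX: "compactin ?X (topspace ?X)" using assms(2) by (simp add: compactin_subtopology compact_closure)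
  \<comment> \<open>On a compact set the boundedness required in \<open>cfunspace\<close> is
    automatic. The elements are extensional, which is why solutions enter the closure as
    restrictions.\<close>
  have ms: "mspace ?c = {f. f \<in> extensional (closure \<Omega>) \<and> continuous_on (closure \<Omega>) f}"
    unfolding compactin_mspace_cfunspace[OF cX] by simp
  interpret MS: Metric_space "mspace ?c" "mdist ?c" by (rule Metric_space_mspace_mdist)
  have res: "restrict v (closure \<Omega>) \<in> mspace ?c" if "v \<in> holder_space 1 \<alpha>" for v
  proof -
    have "v \<in> C_k 1" using that unfolding holder_space_def by simp
    then have "\<forall>is. length is \<le> 1 \<longrightarrow> continuous_on UNIV (iter_partial is v)" unfolding C_k_def by simp
    from this[THEN spec, of "[]"] have "continuous_on UNIV v" by simp
    then have "continuous_on (closure \<Omega>) v" by (rule continuous_on_subset) simp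
    then have "continuous_on (closure \<Omega>) (restrict v (closure \<Omega>))" by (rule continuous_on_eq) simp
    then show ?thesis unfolding ms by (intro CollectI conjI restrict_extensional)
  qed
  have "mtopology_of ?c closure_of ((\<lambda>v. restrict v (closure \<Omega>)) ` {v \<in> holder_space_closure 1 \<alpha> \<Omega>. solves_Det_Hess \<Omega> f v}) = mspace ?c"
  proof -
    let ?S = "(\<lambda>v. restrict v (closure \<Omega>)) ` {v \<in> holder_space_closure 1 \<alpha> \<Omega>. solves_Det_Hess \<Omega> f v}"
    have near: "\<exists>y\<in>?S. y \<in> MS.mball u r" if u: "u \<in> mspace ?c" and r: "0 < r" for u and r :: real
    proof -
      have "continuous_on (closure \<Omega>) u" using u unfolding ms by (elim CollectE conjE)
      from approx[OF this, of "r/2"] r obtain v where v: "v \<in> holder_space 1 \<alpha>" "solves_Det_Hess \<Omega> f v" "\<forall>x\<in>closure \<Omega>. \<bar>v x - u x\<bar> < r/2" by auto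
      \<comment> \<open>Strict pointwise bounds give only a weak inequality for the supremum
        distance; the radius \<open>r/2\<close> leaves room for the open ball.\<close>
      have "mdist ?c u (restrict v (closure \<Omega>)) \<le> r/2"
      proof (rule mdist_cfunspace_le)
        fix x assume "x \<in> topspace ?X"
        then have "x \<in> closure \<Omega>" by simp
        then show "mdist ?m (u x) (restrict v (closure \<Omega>) x) \<le> r/2"
          using v(3) by (auto simp: dist_real_def abs_minus_commute less_imp_le)
      qed (use r in simp)
      then have "restrict v (closure \<Omega>) \<in> MS.mball u r" unfolding MS.in_mball using r by (intro conjI u res[OF v(1)]) linarith
      moreover have "restrict v (closure \<Omega>) \<in> ?S"
        by (intro imageI CollectI conjI hc v)
      ultimately show ?thesis by (rule rev_bexI[rotated])
    qed
    show ?thesis unfolding mtopology_of_def MS.metric_closure_of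
      by (intro equalityI subsetI CollectI conjI allI impI near, erule CollectE, erule conjunct1)
  qed
  moreover have "\<exists>v :: nat \<Rightarrow> real^2 \<Rightarrow> real. (\<forall>n. v n \<in> holder_space_closure 1 \<alpha> \<Omega>) \<and>
          uniform_limit (closure \<Omega>) v v0 sequentially \<and> (\<forall>n. solves_Det_Hess \<Omega> f (v n))"
    if v0: "continuous_on (closure \<Omega>) v0" for v0
  proof -
    have "\<forall>n. \<exists>v. v \<in> holder_space 1 \<alpha> \<and> solves_Det_Hess \<Omega> f v \<and> (\<forall>x\<in>closure \<Omega>. \<bar>v x - v0 x\<bar> < 1 / real (Suc n))"
    proof
      fix n
      from approx[OF v0, of "1 / real (Suc n)"]
      show "\<exists>v. v \<in> holder_space 1 \<alpha> \<and> solves_Det_Hess \<Omega> f v \<and> (\<forall>x\<in>closure \<Omega>. \<bar>v x - v0 x\<bar> < 1 / real (Suc n))"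
        by auto
    qed
    then obtain v where v: "\<And>n. v n \<in> holder_space 1 \<alpha>" "\<And>n. solves_Det_Hess \<Omega> f (v n)"
      "\<And>n. \<forall>x\<in>closure \<Omega>. \<bar>v n x - v0 x\<bar> < 1 / real (Suc n)" by metis
    have "uniform_limit (closure \<Omega>) v v0 sequentially"
      unfolding uniform_limit_iff
    proof (intro allI impI)
      fix e :: real assume "e > 0"
      then have "\<forall>\<^sub>F n in sequentially. 1 / real (Suc n) < e"
        using order_tendstoD(2)[OF LIMSEQ_Suc[OF lim_inverse_n']] by blast
      then show "\<forall>\<^sub>F n in sequentially. \<forall>x\<in>closure \<Omega>. dist (v n x) (v0 x) < e"
      proof eventually_elim
        case (elim n)
        then show ?case using v(3)[of n] unfolding dist_real_def by (meson less_trans)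
      qed
    qed
    then show ?thesis using v hc by blast
  qed
  ultimately show ?thesis by (intro conjI allI impI)
qed

end
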